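(* Let $L_0>0$ and let $\tilde z_0$ satisfy $f(L_0,\tilde z_0)=0$. If $(L_0,\tilde z_0)$ is nondegenerate, i.e. $\partial_{\tilde z}f(L_0,\tilde z_0)\neq0$, then there exist $\varepsilon>0$ and a unique real-analytic function $\tilde z:(L_0-\varepsilon,L_0+\varepsilon)\to\mathbb R$ such that $f(L,\tilde z(L))=0$ for $|L-L_0|<\varepsilon$ and $\tilde z(L_0)=\tilde z_0$. Consequently, $L\mapsto\tilde v(\cdot;L,\tilde z(L))\in C^1([0,1])$ is a unique real-analytic branch of steady states near $L_0$, that is, of solutions of $$-\tilde v_{yy}+L^2(\tilde v^3-\tilde v+\zeta(Ly))=0\ \text{ on }(0,1),\qquad \tilde v(0)=c_0,\quad \tilde v_y(1)=0.$$
   Context: $c_0\in\mathbb R$ is a fixed constant and $\zeta$ is a fixed (independent of $L$) real-analytic function with values in $(-1,0)$ on an open interval containing $[0,\infty)$. For $L>0$ and $\tilde z\in\mathbb R$, $\tilde v(\cdot;L,\tilde z)$ denotes the solution on $[0,1]$ of the initial value problem $$-\tilde v_{yy}(y)+L^2\big(\tilde v(y)^3-\tilde v(y)+\zeta(Ly)\big)=0\ \ (y\in(0,1)),\qquad \tilde v(0)=c_0,\quad \tilde v_y(0)=\tilde z,$$ and $f(L,\tilde z):=\tilde v_y(1;L,\tilde z)$ (for those $(L,\tilde z)$ for which the solution exists on all of $[0,1]$). *)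

theory Defs
  imports "HOL-Analysis.Analysis"
begin

definition real_analytic_on :: "(real \<Rightarrow> real) \<Rightarrow> real set \<Rightarrow> bool" where
  "real_analytic_on g S \<longleftrightarrow>
     (\<forall>x\<in>S. \<exists>r>0. \<exists>a :: nat \<Rightarrow> real. \<forall>h. \<bar>h\<bar> < r \<longrightarrow> (\<lambda>n. a n * h ^ n) sums g (x + h))"

text \<open>Elements of \<open>C\<^sup>1([0,1])\<close> are represented by functions on the whole real line of which only
  the values on \<open>[0,1]\<close> matter. Derivatives are taken within \<open>[0,1]\<close>, hence are one-sided at the
  end points; this is why the two-sided library notion \<open>C1_differentiable_on\<close> is not used.\<close>

definition D01 :: "(real \<Rightarrow> real) \<Rightarrow> real \<Rightarrow> real" where
  "D01 u y = vector_derivative u (at y within {0..1})"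

definition C1_01 :: "(real \<Rightarrow> real) set" where
  "C1_01 = {u. (\<forall>y\<in>{0..1}. u differentiable (at y within {0..1})) \<and> continuous_on {0..1} (D01 u)}"

definition C1_norm :: "(real \<Rightarrow> real) \<Rightarrow> real" where
  "C1_norm u = (SUP y\<in>{0..1}. \<bar>u y\<bar>) + (SUP y\<in>{0..1}. \<bar>D01 u y\<bar>)"

text \<open>Real-analyticity of a map with values in the Banach space \<open>C\<^sup>1([0,1])\<close>: local power series
  with coefficients in \<open>C\<^sup>1([0,1])\<close> that converge in the \<open>C\<^sup>1\<close> norm.\<close>

definition real_analytic_C1_on :: "(real \<Rightarrow> real \<Rightarrow> real) \<Rightarrow> real set \<Rightarrow> bool" where
  "real_analytic_C1_on \<Phi> S \<longleftrightarrow>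
     (\<forall>x\<in>S. \<exists>r>0. \<exists>a :: nat \<Rightarrow> real \<Rightarrow> real. (\<forall>n. a n \<in> C1_01) \<and>
        (\<forall>h. \<bar>h\<bar> < r \<longrightarrow> \<Phi> (x + h) \<in> C1_01 \<and>
           (\<lambda>N. C1_norm (\<lambda>y. \<Phi> (x + h) y - (\<Sum>n<N. h ^ n * a n y))) \<longlonglongrightarrow> 0))"

text \<open>Classical solutions, of class \<open>C\<^sup>1([0,1]) \<inter> C\<^sup>2((0,1))\<close>; continuity of the second derivative
  on \<open>(0,1)\<close> follows from the equation.\<close>

definition solves_ode :: "(real \<Rightarrow> real) \<Rightarrow> real \<Rightarrow> (real \<Rightarrow> real) \<Rightarrow> bool" where
  "solves_ode \<zeta> L v \<longleftrightarrow> v \<in> C1_01 \<and>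
     (\<forall>y\<in>{0<..<1}. \<exists>vyy. (D01 v has_real_derivative vyy) (at y) \<and>
        - vyy + L\<^sup>2 * ((v y) ^ 3 - v y + \<zeta> (L * y)) = 0)"

definition solves_ivp :: "(real \<Rightarrow> real) \<Rightarrow> real \<Rightarrow> real \<Rightarrow> real \<Rightarrow> (real \<Rightarrow> real) \<Rightarrow> bool" where
  "solves_ivp \<zeta> c0 L z v \<longleftrightarrow> solves_ode \<zeta> L v \<and> v 0 = c0 \<and> D01 v 0 = z"

definition steady_state :: "(real \<Rightarrow> real) \<Rightarrow> real \<Rightarrow> real \<Rightarrow> (real \<Rightarrow> real) \<Rightarrow> bool" where
  "steady_state \<zeta> c0 L v \<longleftrightarrow> solves_ode \<zeta> L v \<and> v 0 = c0 \<and> D01 v 1 = 0"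

text \<open>The solution of the initial value problem is unique on \<open>[0,1]\<close>, so the choice below only
  affects irrelevant values outside \<open>[0,1]\<close>. It is meaningful on \<open>ivp_domain\<close>.\<close>

definition ivp_domain :: "(real \<Rightarrow> real) \<Rightarrow> real \<Rightarrow> (real \<times> real) set" where
  "ivp_domain \<zeta> c0 = {(L, z). L > 0 \<and> (\<exists>v. solves_ivp \<zeta> c0 L z v)}"

definition ivp_sol :: "(real \<Rightarrow> real) \<Rightarrow> real \<Rightarrow> real \<Rightarrow> real \<Rightarrow> real \<Rightarrow> real" where
  "ivp_sol \<zeta> c0 L z = (SOME v. solves_ivp \<zeta> c0 L z v)"

definition shoot :: "(real \<Rightarrow> real) \<Rightarrow> real \<Rightarrow> real \<Rightarrow> real \<Rightarrow> real" where
  "shoot \<zeta> c0 L z = D01 (ivp_sol \<zeta> c0 L z) 1"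

definition analytic_zero_curve ::
  "(real \<Rightarrow> real) \<Rightarrow> real \<Rightarrow> real \<Rightarrow> real \<Rightarrow> real \<Rightarrow> (real \<Rightarrow> real) \<Rightarrow> bool" where
  "analytic_zero_curve \<zeta> c0 L0 z0 \<epsilon> z \<longleftrightarrow>
     real_analytic_on z {L0 - \<epsilon><..<L0 + \<epsilon>} \<and>
     (\<forall>L\<in>{L0 - \<epsilon><..<L0 + \<epsilon>}. (L, z L) \<in> ivp_domain \<zeta> c0 \<and> shoot \<zeta> c0 L (z L) = 0) \<and>
     z L0 = z0"

definition analytic_branch ::
  "(real \<Rightarrow> real) \<Rightarrow> real \<Rightarrow> real \<Rightarrow> real \<Rightarrow> (real \<Rightarrow> real \<Rightarrow> real) \<Rightarrow> bool" where
  "analytic_branch \<zeta> c0 L0 \<epsilon> \<Phi> \<longleftrightarrow>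
     real_analytic_C1_on \<Phi> {L0 - \<epsilon><..<L0 + \<epsilon>} \<and>
     (\<forall>L\<in>{L0 - \<epsilon><..<L0 + \<epsilon>}. steady_state \<zeta> c0 L (\<Phi> L))"

end

theory Submission
  imports Defs
begin

text \<open>Write \<open>L = L0 + h\<close> and \<open>v = v0 + w\<close>. The boundary value problem becomes
  \<open>w'' = q w + G0(h) + G1(h) w + G2(h) w^2 + G3(h) w^3\<close>, \<open>w(0) = 0\<close>, \<open>w'(1) = 0\<close>, with
  \<open>q = L0^2 (3 v0^2 - 1)\<close> and \<open>G0(0) = G1(0) = 0\<close>. The derivative of the shooting function at
  \<open>z0\<close> is \<open>\<phi>'(1)\<close>, where \<open>\<phi>'' = q \<phi>\<close>, \<open>\<phi>(0) = 0\<close>, \<open>\<phi>'(0) = 1\<close>; so nondegeneracy makes the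
  linear problem boundedly solvable, and the power series of \<open>w\<close> in \<open>h\<close>, with coefficients in
  \<open>C^1([0,1])\<close>, is determined recursively and converges by the method of majorants. The
  initial slope of \<open>v\<close> is the curve \<open>z(L)\<close>, so no analytic implicit function theorem for the shooting
  function is needed. Two steady states at the same \<open>L\<close> whose slopes are close to \<open>z0\<close> coincide, since
  their difference quotient solves an equation close to that of \<open>\<phi>\<close> and so cannot have slope zero
  at \<open>1\<close>. This gives uniqueness near \<open>L0\<close>, and the identity theorem
  propagates it to the whole interval.\<close>

unbundle no vec_syntax and fps_syntax

section \<open>Power series with geometrically bounded coefficients\<close>

text \<open>The main series are in the change \<open>h\<close> of \<open>L\<close> (or of the
  slope), with coefficients that depend on \<open>y\<close>. The obstacle is uniformity: only when a
  single pair \<open>M\<close>, \<open>R\<close> bounds coefficient \<open>n\<close> by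
  \<open>M * R ^ n\<close> for every \<open>y\<close> in \<open>[0,1]\<close> do convergence,
  differentiation in \<open>y\<close> and re-expansion at nearby parameters follow from geometric
  series. For \<open>\<zeta>((L0 + h) y)\<close> this uniformity comes from compactness of
  \<open>[0, L0]\<close>. The whole linear part at \<open>h = 0\<close> sits in \<open>q\<close>.
  What remains on the right-hand side gains an order in \<open>h\<close>, from
  \<open>G0(0) = G1(0) = 0\<close> or from a power of \<open>w\<close> above the first, so that its
  coefficient \<open>n\<close> contains only earlier coefficients of \<open>w\<close>. The
  nondegeneracy hypothesis speaks of \<open>deriv\<close>, which carries information only for a
  function known to be differentiable. Differentiability of the shooting function is obtained from
  the same existence theorem for cubic perturbations, with the side condition
  \<open>w'(0) = 0\<close> in place of \<open>w'(1) = 0\<close>.\<close>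

definition geom_bounded :: "real \<Rightarrow> real \<Rightarrow> real fps \<Rightarrow> bool" where
  "geom_bounded M R F \<longleftrightarrow> 0 \<le> M \<and> 0 < R \<and> (\<forall>n. \<bar>F $ n\<bar> \<le> M * R ^ n)"

lemma geom_boundedD:
  assumes "geom_bounded M R F"
  shows "0 \<le> M" "0 < R" "\<bar>F $ n\<bar> \<le> M * R ^ n"
  using assms by (auto simp: geom_bounded_def)

lemma geom_bounded_mono:
  assumes "geom_bounded M R F" "M \<le> M'" "R \<le> R'"
  shows "geom_bounded M' R' F"
proof -
  have "M * R ^ n \<le> M' * R' ^ n" for n
    using assms by (intro mult_mono power_mono) (auto simp: geom_bounded_def)
  then show ?thesis
    using assms by (fastforce simp: geom_bounded_def intro: order_trans)
qed

lemma geom_bounded_summable: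
  assumes "geom_bounded M R F" "R * \<bar>h\<bar> < 1"
  shows "summable (\<lambda>n. F $ n * h ^ n)" "summable (\<lambda>n. \<bar>F $ n * h ^ n\<bar>)"
    "\<bar>F $ n * h ^ n\<bar> \<le> M * (R * \<bar>h\<bar>) ^ n"
proof -
  have le: "\<bar>F $ n * h ^ n\<bar> \<le> M * (R * \<bar>h\<bar>) ^ n" for n
  proof -
    have "\<bar>F $ n\<bar> * \<bar>h\<bar> ^ n \<le> (M * R ^ n) * \<bar>h\<bar> ^ n"
      by (intro mult_right_mono geom_boundedD(3)[OF assms(1)]) auto
    then show ?thesis
      by (simp add: abs_mult power_abs power_mult_distrib mult.assoc)
  qed
  have "summable (\<lambda>n. M * (R * \<bar>h\<bar>) ^ n)"
    using assms geom_boundedD(2)[OF assms(1)] by (intro summable_mult summable_geometric) (auto simp: abs_mult)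
  then show s: "summable (\<lambda>n. \<bar>F $ n * h ^ n\<bar>)"
    by (rule summable_comparison_test') (use le in auto)
  then show "summable (\<lambda>n. F $ n * h ^ n)"
    by (rule summable_rabs_cancel)
  show "\<bar>F $ n * h ^ n\<bar> \<le> M * (R * \<bar>h\<bar>) ^ n" by (rule le)
qed

lemma geom_bounded_conv_radius:
  assumes "geom_bounded M R F"
  shows "ereal (1 / R) \<le> fps_conv_radius F"
  unfolding fps_conv_radius_def
proof (rule conv_radius_geI_ex)
  fix r :: real assume "0 < r" "ereal r < ereal (1 / R)"
  then have "R * \<bar>r\<bar> < 1" using geom_boundedD(2)[OF assms] by (simp add: field_simps)
  then show "\<exists>z. norm z = r \<and> summable (\<lambda>n. fps_nth F n * z ^ n)"
    using geom_bounded_summable(1)[OF assms] \<open>0 < r\<close> by (intro exI[of _ r]) auto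
qed

lemma geom_bounded_in_conv_radius:
  assumes "geom_bounded M R F" "R * \<bar>h\<bar> < 1"
  shows "ereal (norm h) < fps_conv_radius F"
proof -
  have "ereal (norm h) < ereal (1 / R)"
    using assms geom_boundedD(2)[OF assms(1)] by (simp add: field_simps)
  also have "\<dots> \<le> fps_conv_radius F" by (rule geom_bounded_conv_radius[OF assms(1)])
  finally show ?thesis .
qed

lemma geom_bounded_sums:
  assumes "geom_bounded M R F" "R * \<bar>h\<bar> < 1"
  shows "(\<lambda>n. F $ n * h ^ n) sums eval_fps F h"
  by (rule sums_eval_fps[OF geom_bounded_in_conv_radius[OF assms]])

lemma geom_bounded_eval_le:
  assumes "geom_bounded M R F" "R * \<bar>h\<bar> \<le> 1 / 2"
  shows "\<bar>eval_fps F h\<bar> \<le> 2 * M"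
proof -
  have h: "R * \<bar>h\<bar> < 1" using assms(2) by simp
  have R: "0 < R" "0 \<le> M" using geom_boundedD[OF assms(1)] by auto
  have "\<bar>eval_fps F h\<bar> \<le> (\<Sum>n. \<bar>F $ n * h ^ n\<bar>)"
    unfolding eval_fps_def by (rule summable_rabs[OF geom_bounded_summable(2)[OF assms(1) h]])
  also have "\<dots> \<le> (\<Sum>n. M * (1 / 2) ^ n)"
  proof (rule suminf_le[OF _ geom_bounded_summable(2)[OF assms(1) h]])
    fix n
    have "\<bar>F $ n * h ^ n\<bar> \<le> M * (R * \<bar>h\<bar>) ^ n" by (rule geom_bounded_summable(3)[OF assms(1) h])
    also have "\<dots> \<le> M * (1 / 2) ^ n" using R assms(2) by (intro mult_left_mono power_mono) auto
    finally show "\<bar>F $ n * h ^ n\<bar> \<le> M * (1 / 2) ^ n" .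
  qed (intro summable_mult summable_geometric, simp)
  also have "\<dots> = 2 * M" by (simp add: suminf_mult suminf_geometric)
  finally show ?thesis .
qed

text \<open>Convergence at the single point \<open>r / 2\<close> bounds all terms there by some
  \<open>K\<close>, hence the coefficients by \<open>K * (2 / r) ^ n\<close>.\<close>

lemma sums_imp_geom_bounded:
  assumes "0 < r" "\<And>h. \<bar>h\<bar> < r \<Longrightarrow> (\<lambda>n. a n * h ^ n) sums g h"
  shows "\<exists>M R. geom_bounded M R (Abs_fps a)"
proof -
  have "(\<lambda>n. a n * (r / 2) ^ n) sums g (r / 2)" using assms by auto
  then have "Bseq (\<lambda>n. a n * (r / 2) ^ n)"
    using sums_summable summable_LIMSEQ_zero convergent_def convergent_imp_Bseq by blast
  then obtain K where K: "0 < K" "\<And>n. norm (a n * (r / 2) ^ n) \<le> K" by (rule BseqE) auto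
  have "\<bar>a n\<bar> \<le> K * (2 / r) ^ n" for n
    using K(2)[of n] \<open>0 < r\<close> by (simp add: abs_mult power_divide field_simps)
  then have "geom_bounded K (2 / r) (Abs_fps a)" using \<open>0 < r\<close> K by (auto simp: geom_bounded_def)
  then show ?thesis by blast
qed

section \<open>Re-expansion of a power series about a shifted centre\<close>

definition recenter :: "real fps \<Rightarrow> real \<Rightarrow> real fps" where
  "recenter F k = Abs_fps (\<lambda>n. \<Sum>m. real ((m + n) choose n) * F $ (m + n) * k ^ m)"

text \<open>Coefficient \<open>n\<close> is the Taylor coefficient of \<open>F\<close> at
  \<open>k\<close>. The binomial coefficient is at most \<open>2 ^ (m + n)\<close>: the factor
  \<open>2 ^ n\<close> turns \<open>R\<close> into \<open>2 * R\<close>, and \<open>2 ^ m\<close> is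
  absorbed by \<open>R * |k| \<le> 1 / 4\<close>, which leaves the ratio \<open>1 / 2\<close> in
  \<open>m\<close> and the sum \<open>2 * M\<close>.\<close>

lemma recenter_coeff:
  assumes F: "geom_bounded M R F" and k: "R * \<bar>k\<bar> \<le> 1 / 4"
  shows "\<bar>real ((m + n) choose n) * F $ (m + n) * k ^ m\<bar> \<le> M * (2 * R) ^ n * (1 / 2) ^ m"
    "(\<lambda>m. real ((m + n) choose n) * F $ (m + n) * k ^ m) sums (recenter F k $ n)"
    "geom_bounded (2 * M) (2 * R) (recenter F k)"
proof -
  have R: "0 < R" "0 \<le> M" using geom_boundedD[OF F] by auto
  have le: "\<bar>real ((m + n) choose n) * F $ (m + n) * k ^ m\<bar> \<le> M * (2 * R) ^ n * (1 / 2) ^ m" for m n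
  proof -
    have "real ((m + n) choose n) \<le> 2 ^ (m + n)"
      using binomial_le_pow2[of "m + n" n] by (metis of_nat_le_iff of_nat_numeral of_nat_power)
    then have "\<bar>real ((m + n) choose n) * F $ (m + n) * k ^ m\<bar> \<le> 2 ^ (m + n) * (M * R ^ (m + n)) * \<bar>k\<bar> ^ m"
      using geom_boundedD(3)[OF F, of "m + n"] R
      by (simp only: abs_mult power_abs) (intro mult_mono, auto)
    also have "\<dots> = M * (2 * R) ^ n * (2 * (R * \<bar>k\<bar>)) ^ m"
      by (simp add: power_add power_mult_distrib algebra_simps)
    also have "\<dots> \<le> M * (2 * R) ^ n * (1 / 2) ^ m"
      using R k by (intro mult_left_mono power_mono) auto
    finally show ?thesis .
  qed
  show "\<bar>real ((m + n) choose n) * F $ (m + n) * k ^ m\<bar> \<le> M * (2 * R) ^ n * (1 / 2) ^ m"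
    by (rule le)
  have sg: "summable (\<lambda>m. M * (2 * R) ^ n * (1 / 2) ^ m)" for n
    by (intro summable_mult summable_geometric) simp
  have sa: "summable (\<lambda>m. \<bar>real ((m + n) choose n) * F $ (m + n) * k ^ m\<bar>)" for n
    by (rule summable_comparison_test'[OF sg[of n]]) (use le in auto)
  then have s: "summable (\<lambda>m. real ((m + n) choose n) * F $ (m + n) * k ^ m)" for n
    by (rule summable_rabs_cancel)
  then show "(\<lambda>m. real ((m + n) choose n) * F $ (m + n) * k ^ m) sums (recenter F k $ n)"
    by (auto simp: recenter_def)
  show "geom_bounded (2 * M) (2 * R) (recenter F k)"
    unfolding geom_bounded_def
  proof (intro conjI allI)
    fix n
    have "\<bar>recenter F k $ n\<bar> \<le> (\<Sum>m. \<bar>real ((m + n) choose n) * F $ (m + n) * k ^ m\<bar>)"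
      unfolding recenter_def fps_nth_Abs_fps by (rule summable_rabs[OF sa])
    also have "\<dots> \<le> (\<Sum>m. M * (2 * R) ^ n * (1 / 2) ^ m)"
      by (rule suminf_le[OF le sa sg])
    also have "\<dots> = 2 * M * (2 * R) ^ n" by (subst suminf_mult) (auto simp: suminf_geometric)
    finally show "\<bar>recenter F k $ n\<bar> \<le> 2 * M * (2 * R) ^ n" .
  qed (use R in auto)
qed

text \<open>The array \<open>c n m\<close> is dominated by a product of two geometric series, so it
  may be summed in either order: by rows \<open>n\<close> this gives the re-expanded series, along
  the diagonals \<open>n + m = N\<close> the binomial theorem gives
  \<open>F $ N * (k + h) ^ N\<close>.\<close>

lemma sums_recenter:
  assumes F: "geom_bounded M R F" and k: "R * \<bar>k\<bar> \<le> 1 / 4" and h: "2 * R * \<bar>h\<bar> < 1"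
  shows "(\<lambda>n. recenter F k $ n * h ^ n) sums eval_fps F (k + h)"
proof -
  have R: "0 < R" "0 \<le> M" using geom_boundedD[OF F] by auto
  define c where "c = (\<lambda>n m. real ((m + n) choose n) * F $ (m + n) * k ^ m * h ^ n)"
  have c_le: "\<bar>c n m\<bar> \<le> M * (2 * R * \<bar>h\<bar>) ^ n * (1 / 2) ^ m" for n m
  proof -
    have "\<bar>c n m\<bar> \<le> M * (2 * R) ^ n * (1 / 2) ^ m * \<bar>h\<bar> ^ n"
      unfolding c_def using mult_right_mono[OF recenter_coeff(1)[OF F k, of m n], of "\<bar>h\<bar> ^ n"]
      by (simp add: abs_mult power_abs)
    then show ?thesis by (simp add: power_mult_distrib algebra_simps)
  qed
  have s1: "((\<lambda>m. (1 / 2 :: real) ^ m) has_sum 2) UNIV"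
    using geometric_sums[of "1 / 2 :: real"] by (intro norm_summable_imp_has_sum) (auto intro: summable_geometric)
  have s2: "(\<lambda>n. M * (2 * R * \<bar>h\<bar>) ^ n * 2) summable_on UNIV"
    using R h by (subst summable_on_UNIV_nonneg_real_iff) (auto intro!: summable_geometric summable_mult summable_mult2)
  have "(\<lambda>(n, m). (M * (2 * R * \<bar>h\<bar>) ^ n) * (1 / 2) ^ m) summable_on UNIV \<times> UNIV"
    by (rule summable_on_SigmaI[OF _ s2]) (use R in \<open>auto intro!: has_sum_cmult_right s1\<close>)
  then have "(\<lambda>p. norm (case_prod c p)) summable_on UNIV \<times> UNIV"
    by (rule Infinite_Sum.abs_summable_on_comparison_test') (use c_le in auto)
  then have "case_prod c summable_on UNIV \<times> UNIV"
    by (rule Infinite_Sum.abs_summable_summable)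
  then obtain T where T: "(case_prod c has_sum T) (UNIV \<times> UNIV)"
    by (auto simp: summable_on_def)
  have rows: "((\<lambda>m. c n m) has_sum (recenter F k $ n * h ^ n)) UNIV" for n
  proof -
    have "(\<lambda>m. c n m) sums (recenter F k $ n * h ^ n)"
      unfolding c_def by (intro sums_mult2 recenter_coeff(2)[OF F k])
    moreover have "summable (\<lambda>m. norm (c n m))"
      by (rule summable_comparison_test'[of "\<lambda>m. M * (2 * R * \<bar>h\<bar>) ^ n * (1 / 2) ^ m"])
        (use c_le in \<open>auto intro!: summable_mult summable_geometric\<close>)
    ultimately show ?thesis by (rule norm_summable_imp_has_sum[rotated])
  qed
  have "((\<lambda>n. recenter F k $ n * h ^ n) has_sum T) UNIV"
    by (rule has_sum_SigmaD[OF T]) (use rows in auto)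
  then have 1: "(\<lambda>n. recenter F k $ n * h ^ n) sums T" by (rule has_sum_imp_sums)
  have bij: "bij_betw (\<lambda>(N, n). (n, N - n)) (Sigma UNIV (\<lambda>N. {..N})) (UNIV \<times> UNIV :: (nat \<times> nat) set)"
    by (rule bij_betwI[where g = "\<lambda>(n, m). (n + m, n)"]) auto
  have T': "((\<lambda>p. case_prod c (case p of (N, n) \<Rightarrow> (n, N - n))) has_sum T) (Sigma UNIV (\<lambda>N. {..N}))"
    using T by (subst has_sum_reindex_bij_betw[OF bij])
  have "((\<lambda>N. F $ N * (k + h) ^ N) has_sum T) UNIV"
  proof (rule has_sum_SigmaD[OF T'])
    fix N :: nat
    have "(\<Sum>n\<le>N. c n (N - n)) = F $ N * (k + h) ^ N"
      by (subst add.commute, subst binomial_ring)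
        (auto simp: c_def sum_distrib_left intro!: sum.cong)
    then show "((\<lambda>n. case_prod c (case (N, n) of (N, n) \<Rightarrow> (n, N - n))) has_sum F $ N * (k + h) ^ N) {..N}"
      using has_sum_finite[of "{..N}" "\<lambda>n. c n (N - n)"] by simp
  qed
  then have 2: "(\<lambda>N. F $ N * (k + h) ^ N) sums T" by (rule has_sum_imp_sums)
  have "R * \<bar>k + h\<bar> \<le> R * \<bar>k\<bar> + R * \<bar>h\<bar>" using R by (simp flip: distrib_left)
  then have "R * \<bar>k + h\<bar> < 1" using k h by linarith
  from sums_unique2[OF geom_bounded_sums[OF F this] 2] 1 show ?thesis by simp
qed

text \<open>Enlarging \<open>R\<close> to at least \<open>1 / r\<close> lets one constant describe
  both the growth of the coefficients and the range of \<open>h\<close> in which the series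
  represents the function.\<close>

lemma real_analytic_onD:
  assumes "real_analytic_on g S" "x \<in> S"
  obtains F M R where "geom_bounded M R F" "\<And>h. R * \<bar>h\<bar> < 1 \<Longrightarrow> (\<lambda>n. F $ n * h ^ n) sums g (x + h)"
proof -
  obtain r a where r: "r > 0" "\<And>h. \<bar>h\<bar> < r \<Longrightarrow> (\<lambda>n. a n * h ^ n) sums g (x + h)"
    using assms unfolding real_analytic_on_def by blast
  obtain M R where "geom_bounded M R (Abs_fps a)"
    using sums_imp_geom_bounded[OF r(1), of a "\<lambda>h. g (x + h)"] r(2) by auto
  then have gb: "geom_bounded M (max R (1 / r)) (Abs_fps a)" by (rule geom_bounded_mono) auto
  moreover have "\<bar>h\<bar> < r" if "max R (1 / r) * \<bar>h\<bar> < 1" for h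
  proof -
    have "(1 / r) * \<bar>h\<bar> \<le> max R (1 / r) * \<bar>h\<bar>" by (intro mult_right_mono) auto
    then have "(1 / r) * \<bar>h\<bar> < 1" using that by linarith
    then show ?thesis using r(1) by (simp add: field_simps)
  qed
  ultimately show ?thesis using that[of _ _ "Abs_fps a"] r(2) by auto
qed

lemma real_analytic_onI:
  assumes "\<And>x. x \<in> S \<Longrightarrow> \<exists>r>0. \<exists>F. \<forall>h. \<bar>h\<bar> < r \<longrightarrow> (\<lambda>n. F $ n * h ^ n) sums g (x + h)"
  shows "real_analytic_on g S"
  using assms unfolding real_analytic_on_def by metis

lemma real_analytic_on_subset:
  "real_analytic_on g S \<Longrightarrow> T \<subseteq> S \<Longrightarrow> real_analytic_on g T"
  unfolding real_analytic_on_def by blast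

lemma real_analytic_on_isCont:
  assumes "real_analytic_on g S" "x \<in> S"
  shows "isCont g x"
proof -
  obtain F M R where F: "geom_bounded M R F" "\<And>h. R * \<bar>h\<bar> < 1 \<Longrightarrow> (\<lambda>n. F $ n * h ^ n) sums g (x + h)"
    using real_analytic_onD[OF assms] by blast
  have R: "0 < R" using geom_boundedD[OF F(1)] by auto
  have ev: "eventually (\<lambda>h. R * \<bar>h\<bar> < 1) (nhds 0)"
    using R by (intro eventually_nhds_metric[THEN iffD2] exI[of _ "1 / R"]) (auto simp: field_simps dist_real_def)
  have "isCont (eval_fps F) 0"
    by (intro continuous_eval_fps geom_bounded_in_conv_radius[OF F(1)]) simp
  moreover have "eventually (\<lambda>h. eval_fps F h = g (x + h)) (nhds 0)"
    using ev by eventually_elim (use F geom_bounded_sums[OF F(1)] sums_unique2 in blast)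
  ultimately have "isCont (\<lambda>h. g (x + h)) 0"
    using isCont_cong by force
  then show ?thesis using LIM_offset_zero_iff[of x g "g x"] by (simp add: isCont_def)
qed

section \<open>Real analytic functions\<close>

text \<open>Once the coefficients below \<open>n\<close> agree, the difference of the series divided
  by \<open>h ^ n\<close> is zero for \<open>h \<noteq> 0\<close> and tends to the difference of the
  coefficients at index \<open>n\<close>.\<close>

lemma real_fps_unique:
  fixes F G :: "real fps"
  assumes "0 < r" "\<And>h. \<bar>h\<bar> < r \<Longrightarrow> (\<lambda>n. F $ n * h ^ n) sums g h" "\<And>h. \<bar>h\<bar> < r \<Longrightarrow> (\<lambda>n. G $ n * h ^ n) sums g h"
  shows "F = G"
proof (rule fps_ext)
  fix n
  show "F $ n = G $ n"
  proof (induction n rule: less_induct)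
    case (less n)
    have "((\<lambda>_. 0 :: real) \<longlongrightarrow> (F $ (0 + n) - G $ (0 + n))) (at (0 :: real))"
    proof (rule powser_limit_0_strong[OF assms(1), where a = "\<lambda>m. F $ (m + n) - G $ (m + n)"])
      fix h :: real assume h: "h \<noteq> 0" "norm h < r"
      have "(\<lambda>m. (F $ m - G $ m) * h ^ m) sums (g h - g h)"
        using sums_diff[OF assms(2,3), of h h] h by (simp add: algebra_simps)
      then have "(\<lambda>m. (F $ (m + n) - G $ (m + n)) * h ^ (m + n)) sums 0"
        by (subst sums_iff_shift) (use less.IH in simp)
      from sums_mult[OF this, of "inverse (h ^ n)"]
      have "(\<lambda>m. inverse (h ^ n) * ((F $ (m + n) - G $ (m + n)) * h ^ (m + n))) sums 0" by simp
      moreover have "inverse (h ^ n) * (c * h ^ (m + n)) = c * h ^ m" for c m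
        using h(1) by (simp add: power_add)
      ultimately show "(\<lambda>m. (F $ (m + n) - G $ (m + n)) * h ^ m) sums 0" by simp
    qed
    then show ?case using LIM_const_eq by fastforce
  qed
qed

text \<open>For fixed \<open>n\<close> the re-expanded coefficient is itself a power series in
  \<open>k\<close>, so its continuity in \<open>k\<close>, and its regularity in a parameter of
  \<open>F\<close>, reduce to facts about evaluated power series.\<close>

lemma recenter_coeff_eval:
  assumes F: "geom_bounded M R F"
  shows "geom_bounded (M * (2 * R) ^ n) (2 * R) (Abs_fps (\<lambda>m. real ((m + n) choose n) * F $ (m + n)))"
    "recenter F k $ n = eval_fps (Abs_fps (\<lambda>m. real ((m + n) choose n) * F $ (m + n))) k"
proof -
  have R: "0 < R" "0 \<le> M" using geom_boundedD[OF F] by auto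
  have "\<bar>real ((m + n) choose n) * F $ (m + n)\<bar> \<le> (M * (2 * R) ^ n) * (2 * R) ^ m" for m
  proof -
    have "real ((m + n) choose n) \<le> 2 ^ (m + n)"
      using binomial_le_pow2[of "m + n" n] by (metis of_nat_le_iff of_nat_numeral of_nat_power)
    then have "\<bar>real ((m + n) choose n) * F $ (m + n)\<bar> \<le> 2 ^ (m + n) * (M * R ^ (m + n))"
      using geom_boundedD(3)[OF F, of "m + n"] R unfolding abs_mult by (intro mult_mono) auto
    then show ?thesis by (simp add: power_add power_mult_distrib algebra_simps)
  qed
  then show "geom_bounded (M * (2 * R) ^ n) (2 * R) (Abs_fps (\<lambda>m. real ((m + n) choose n) * F $ (m + n)))"
    using R by (auto simp: geom_bounded_def)
qed (simp add: recenter_def eval_fps_def)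

lemma recenter_continuous:
  assumes F: "geom_bounded M R F"
  shows "continuous_on {k. R * \<bar>k\<bar> \<le> 1 / 4} (\<lambda>k. recenter F k $ n)"
  unfolding recenter_coeff_eval(2)[OF F] using geom_boundedD(2)[OF F]
  by (intro continuous_at_imp_continuous_on ballI)
    (auto intro!: continuous_eval_fps geom_bounded_in_conv_radius[OF recenter_coeff_eval(1)[OF F]])

section \<open>The identity theorem\<close>

lemma real_analytic_on_diff:
  assumes "real_analytic_on f S" "real_analytic_on g S"
  shows "real_analytic_on (\<lambda>x. f x - g x) S"
proof (rule real_analytic_onI)
  fix x assume "x \<in> S"
  then obtain r a s b where ra: "r > 0" "\<And>h. \<bar>h\<bar> < r \<Longrightarrow> (\<lambda>n. a n * h ^ n) sums f (x + h)"
    and sb: "s > 0" "\<And>h. \<bar>h\<bar> < s \<Longrightarrow> (\<lambda>n. b n * h ^ n) sums g (x + h)"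
    using assms unfolding real_analytic_on_def by metis
  show "\<exists>r>0. \<exists>F. \<forall>h. \<bar>h\<bar> < r \<longrightarrow> (\<lambda>n. F $ n * h ^ n) sums (f (x + h) - g (x + h))"
    by (rule exI[of _ "min r s"], intro conjI exI[of _ "Abs_fps (\<lambda>n. a n - b n)"])
      (use ra sb in \<open>auto simp: algebra_simps intro!: sums_diff\<close>)
qed

text \<open>Re-expansion at \<open>u\<close> represents \<open>f\<close> on the whole interval
  \<open>2 * R * |h| < 1\<close>, while near \<open>u\<close> it represents zero. Uniqueness of
  coefficients makes it the zero series, so \<open>f\<close> vanishes on all of that
  interval.\<close>

lemma real_analytic_zero_propagates:
  assumes F: "geom_bounded M R F" "\<And>h. R * \<bar>h\<bar> < 1 \<Longrightarrow> (\<lambda>n. F $ n * h ^ n) sums f (x + h)"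
    and u: "R * \<bar>u - x\<bar> \<le> 1 / 4" and zero: "eventually (\<lambda>t. f t = 0) (nhds u)" and v: "2 * R * \<bar>v - u\<bar> < 1"
  shows "f v = 0"
proof -
  have R: "0 < R" using geom_boundedD[OF F(1)] by auto
  have f_eq: "eval_fps F h = f (x + h)" if "R * \<bar>h\<bar> < 1" for h
    using geom_bounded_sums[OF F(1) that] F(2)[OF that] sums_unique2 by blast
  have lt: "R * \<bar>u - x + h\<bar> < 1" if "2 * R * \<bar>h\<bar> < 1" for h
  proof -
    have "R * \<bar>u - x + h\<bar> \<le> R * \<bar>u - x\<bar> + R * \<bar>h\<bar>" using R by (simp flip: distrib_left)
    then show ?thesis using u that by linarith
  qed
  have rec: "(\<lambda>n. recenter F (u - x) $ n * h ^ n) sums f (u + h)" if "2 * R * \<bar>h\<bar> < 1" for h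
    using sums_recenter[OF F(1) u that] f_eq[OF lt[OF that]] by simp
  obtain e where e: "e > 0" "\<And>t. \<bar>t - u\<bar> < e \<Longrightarrow> f t = 0"
    using zero by (auto simp: eventually_nhds_metric dist_real_def)
  have "recenter F (u - x) = 0"
  proof (rule real_fps_unique[of "min e (1 / (2 * R))" _ "\<lambda>_. 0"])
    fix h assume "\<bar>h\<bar> < min e (1 / (2 * R))"
    then show "(\<lambda>n. recenter F (u - x) $ n * h ^ n) sums 0"
      using rec[of h] e(2)[of "u + h"] R by (simp add: field_simps)
  qed (use e R in auto)
  then show ?thesis using rec[OF v] sums_unique2[OF rec[OF v], of 0] by auto
qed

lemma real_analytic_identity:
  assumes f: "real_analytic_on f S" and g: "real_analytic_on g S" and S: "connected S" "x0 \<in> S" "x \<in> S"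
    and ev: "eventually (\<lambda>t. f t = g t) (nhds x0)"
  shows "f x = g x"
proof -
  let ?d = "\<lambda>t. f t - g t"
  have "eventually (\<lambda>t. ?d t = 0) (nhds x)"
  proof (rule connected_induction_simple[OF S, of "\<lambda>a. eventually (\<lambda>t. ?d t = 0) (nhds a)"])
    show "eventually (\<lambda>t. ?d t = 0) (nhds x0)" using ev by simp
  next
    fix a assume "a \<in> S"
    then obtain F M R where F: "geom_bounded M R F" "\<And>h. R * \<bar>h\<bar> < 1 \<Longrightarrow> (\<lambda>n. F $ n * h ^ n) sums ?d (a + h)"
      using real_analytic_onD[OF real_analytic_on_diff[OF f g]] by blast
    have R: "0 < R" using geom_boundedD[OF F(1)] by auto
    show "\<exists>T. openin (top_of_set S) T \<and> a \<in> T \<and>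
        (\<forall>u\<in>T. \<forall>v\<in>T. eventually (\<lambda>t. ?d t = 0) (nhds u) \<longrightarrow> eventually (\<lambda>t. ?d t = 0) (nhds v))"
    \<comment> \<open>Two points of this ball are less than \<open>1 / (4 * R)\<close> apart and
      each is within \<open>1 / (8 * R)\<close> of the centre, so vanishing near one of them spreads
      over the ball by means of the series at \<open>a\<close>.\<close>
    proof (intro exI[of _ "S \<inter> ball a (1 / (8 * R))"] conjI ballI impI)
      fix u v assume uv: "u \<in> S \<inter> ball a (1 / (8 * R))" "v \<in> S \<inter> ball a (1 / (8 * R))"
        and zero: "eventually (\<lambda>t. ?d t = 0) (nhds u)"
      have u: "R * \<bar>u - a\<bar> \<le> 1 / 4" using uv R by (auto simp: dist_real_def field_simps abs_minus_commute)
      have "?d t = 0" if "t \<in> ball a (1 / (8 * R))" for t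
      proof (rule real_analytic_zero_propagates[OF F u zero])
        have "\<bar>t - u\<bar> < 1 / (8 * R) + 1 / (8 * R)" using that uv by (auto simp: dist_real_def)
        then show "2 * R * \<bar>t - u\<bar> < 1" using R by (simp add: field_simps)
      qed
      moreover have "eventually (\<lambda>t. t \<in> ball a (1 / (8 * R))) (nhds v)"
        by (rule eventually_nhds_in_open) (use uv in auto)
      ultimately show "eventually (\<lambda>t. ?d t = 0) (nhds v)" by (auto elim!: eventually_mono)
    qed (use \<open>a \<in> S\<close> R in auto)
  qed
  then show ?thesis by (auto dest: eventually_nhds_x_imp_x)
qed

text \<open>The constants could degenerate from centre to centre. Near \<open>x0\<close> the
  expansion at \<open>x\<close> is the re-expansion of the one at \<open>x0\<close>, with constants
  \<open>2 * M x0\<close> and \<open>2 * R x0\<close>; finitely many such neighbourhoods cover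
  \<open>K\<close>.\<close>

lemma real_analytic_uniform_expansion:
  assumes g: "real_analytic_on g K" and K: "compact K"
  obtains Z M R where "\<And>x. x \<in> K \<Longrightarrow> geom_bounded M R (Z x)"
    "\<And>x h. x \<in> K \<Longrightarrow> R * \<bar>h\<bar> < 1 \<Longrightarrow> (\<lambda>n. Z x $ n * h ^ n) sums g (x + h)"
    "\<And>n. continuous_on K (\<lambda>x. Z x $ n)"
proof -
  have "\<forall>x\<in>K. \<exists>F M R. geom_bounded M R F \<and> (\<forall>h. R * \<bar>h\<bar> < 1 \<longrightarrow> (\<lambda>n. F $ n * h ^ n) sums g (x + h))"
    using real_analytic_onD[OF g] by metis
  then obtain F M R where F: "\<And>x. x \<in> K \<Longrightarrow> geom_bounded (M x) (R x) (F x)"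
    "\<And>x h. x \<in> K \<Longrightarrow> R x * \<bar>h\<bar> < 1 \<Longrightarrow> (\<lambda>n. F x $ n * h ^ n) sums g (x + h)"
    by metis
  have R: "0 < R x" if "x \<in> K" for x using geom_boundedD[OF F(1)[OF that]] by auto
  have loc: "R x0 * \<bar>x - x0\<bar> \<le> 1 / 4" if "x0 \<in> K" "x \<in> ball x0 (1 / (4 * R x0))" for x x0
    using that R by (auto simp: dist_real_def field_simps abs_minus_commute)
  have re: "F x = recenter (F x0) (x - x0)"
    "geom_bounded (2 * M x0) (2 * R x0) (F x)"
    "2 * R x0 * \<bar>h\<bar> < 1 \<Longrightarrow> (\<lambda>n. F x $ n * h ^ n) sums g (x + h)"
    if x: "x0 \<in> K" "x \<in> K" "x \<in> ball x0 (1 / (4 * R x0))" for x x0 h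
  proof -
    have s: "(\<lambda>n. recenter (F x0) (x - x0) $ n * h ^ n) sums g (x + h)" if h: "2 * R x0 * \<bar>h\<bar> < 1" for h
    proof -
      have "R x0 * \<bar>x - x0 + h\<bar> \<le> R x0 * \<bar>x - x0\<bar> + R x0 * \<bar>h\<bar>" using R[OF x(1)] by (simp flip: distrib_left)
      then have "R x0 * \<bar>x - x0 + h\<bar> < 1" using loc[OF x(1,3)] h by linarith
      from sums_unique2[OF geom_bounded_sums[OF F(1)[OF x(1)] this] F(2)[OF x(1) this]]
      show ?thesis using sums_recenter[OF F(1)[OF x(1)] loc[OF x(1,3)] h] by simp
    qed
    \<comment> \<open>Both series represent \<open>g\<close> near \<open>x\<close>, so the
      arbitrarily chosen expansion at \<open>x\<close> is forced; this is what makes the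
      coefficients of a pointwise choice continuous in \<open>x\<close>.\<close>
    show eq: "F x = recenter (F x0) (x - x0)"
    proof (rule real_fps_unique)
      show "0 < min (1 / R x) (1 / (2 * R x0))" using R x by auto
    qed (use R x s F(2)[OF x(2)] in \<open>auto simp: field_simps\<close>)
    show "geom_bounded (2 * M x0) (2 * R x0) (F x)"
      unfolding eq by (rule recenter_coeff(3)[OF F(1)[OF x(1)] loc[OF x(1,3)]])
    show "2 * R x0 * \<bar>h\<bar> < 1 \<Longrightarrow> (\<lambda>n. F x $ n * h ^ n) sums g (x + h)" unfolding eq by (rule s)
  qed
  have cont: "continuous_on K (\<lambda>x. F x $ n)" for n
    unfolding continuous_on_eq_continuous_within
  proof
    fix x0 assume x0: "x0 \<in> K"
    have "continuous_on (ball x0 (1 / (4 * R x0))) (\<lambda>x. recenter (F x0) (x - x0) $ n)"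
      by (rule continuous_on_compose2[OF recenter_continuous[OF F(1)[OF x0]]])
        (use loc[OF x0] in \<open>auto intro!: continuous_intros\<close>)
    then have "continuous (at x0 within K) (\<lambda>x. recenter (F x0) (x - x0) $ n)"
      using R[OF x0] by (auto simp: continuous_on_eq_continuous_at intro: continuous_at_imp_continuous_at_within)
    then show "continuous (at x0 within K) (\<lambda>x. F x $ n)"
    proof (rule continuous_transform_within[where \<delta> = "1 / (4 * R x0)"])
      fix x assume "x \<in> K" "dist x x0 < 1 / (4 * R x0)"
      then show "recenter (F x0) (x - x0) $ n = F x $ n"
        using re(1)[OF x0, of x] by (simp add: dist_commute)
    qed (use R x0 in auto)
  qed
  obtain C where C: "C \<subseteq> K" "finite C" "K \<subseteq> (\<Union>c\<in>C. ball c (1 / (4 * R c)))"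
    by (rule compactE_image[OF K, of K "\<lambda>c. ball c (1 / (4 * R c))"]) (use R in auto)
  define N where "N = 1 + (\<Sum>c\<in>C. 2 * M c + 2 * R c)"
  have N: "2 * M c \<le> N" "2 * R c \<le> N" if "c \<in> C" for c
  proof -
    have pos: "0 \<le> M c'" "0 \<le> R c'" if "c' \<in> C" for c' using that C geom_boundedD[OF F(1), of c'] by force+
    have "2 * M c + 2 * R c \<le> (\<Sum>c\<in>C. 2 * M c + 2 * R c)"
      by (rule member_le_sum[OF that]) (use pos C in auto)
    then show "2 * M c \<le> N" "2 * R c \<le> N" using pos[OF that] by (auto simp: N_def)
  qed
  show ?thesis
  proof (rule that[of N N F])
    fix x assume x: "x \<in> K"
    then obtain c where c: "c \<in> C" "x \<in> ball c (1 / (4 * R c))" using C by blast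
    show "geom_bounded N N (F x)" by (rule geom_bounded_mono[OF re(2)[OF _ x c(2)]]) (use c C N in auto)
    fix h assume "N * \<bar>h\<bar> < 1"
    then have "2 * R c * \<bar>h\<bar> < 1" using mult_right_mono[OF N(2)[OF c(1)], of "\<bar>h\<bar>"] by simp
    then show "(\<lambda>n. F x $ n * h ^ n) sums g (x + h)" using re(3)[OF _ x c(2)] c C by blast
  qed (rule cont)
qed

section \<open>Families of power series on the unit interval\<close>

lemma geom_bounded_add:
  assumes "geom_bounded M R F" "geom_bounded M' R G"
  shows "geom_bounded (M + M') R (F + G)"
  unfolding geom_bounded_def
proof (intro conjI allI)
  fix n
  show "\<bar>(F + G) $ n\<bar> \<le> (M + M') * R ^ n"
    using geom_boundedD(3)[OF assms(1), of n] geom_boundedD(3)[OF assms(2), of n] by (simp add: algebra_simps)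
qed (use geom_boundedD[OF assms(1)] geom_boundedD[OF assms(2)] in auto)

text \<open>The Cauchy product has \<open>n + 1\<close> terms of size \<open>M * M' * R ^ n\<close>,
  and \<open>n + 1 \<le> 2 ^ n\<close> is paid for by doubling \<open>R\<close>.\<close>

lemma geom_bounded_mult:
  assumes "geom_bounded M R F" "geom_bounded M' R G"
  shows "geom_bounded (M * M') (2 * R) (F * G)"
  unfolding geom_bounded_def
proof (intro conjI allI)
  fix n
  have R: "0 < R" "0 \<le> M" "0 \<le> M'" using geom_boundedD[OF assms(1)] geom_boundedD[OF assms(2)] by auto
  have "\<bar>(F * G) $ n\<bar> \<le> (\<Sum>i=0..n. \<bar>F $ i * G $ (n - i)\<bar>)"
    by (simp add: fps_mult_nth sum_abs)
  also have "\<dots> \<le> (\<Sum>i=0..n. M * M' * R ^ n)"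
  proof (rule sum_mono)
    fix i assume i: "i \<in> {0..n}"
    have "\<bar>F $ i * G $ (n - i)\<bar> \<le> (M * R ^ i) * (M' * R ^ (n - i))"
      unfolding abs_mult using R geom_boundedD(3)[OF assms(1)] geom_boundedD(3)[OF assms(2)] by (intro mult_mono) auto
    also have "\<dots> = M * M' * R ^ n" using i power_add[of R i "n - i"] by simp
    finally show "\<bar>F $ i * G $ (n - i)\<bar> \<le> M * M' * R ^ n" .
  qed
  also have "\<dots> = real (n + 1) * (M * M' * R ^ n)" by simp
  also have "\<dots> \<le> 2 ^ n * (M * M' * R ^ n)"
  proof -
    have "real (n + 1) \<le> real (2 ^ n)" using less_exp[of n] by (intro of_nat_mono) linarith
    then show ?thesis using R by (intro mult_right_mono) auto
  qed
  finally show "\<bar>(F * G) $ n\<bar> \<le> M * M' * (2 * R) ^ n"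
    by (simp add: power_mult_distrib algebra_simps)
qed (use geom_boundedD[OF assms(1)] geom_boundedD[OF assms(2)] in auto)

lemma continuous_on_01_bounded:
  fixes f :: "real \<Rightarrow> real"
  assumes "continuous_on {0..1} f"
  obtains B where "0 \<le> B" "\<And>y. y \<in> {0..1} \<Longrightarrow> \<bar>f y\<bar> \<le> B"
proof -
  have "compact (f ` {0..1})" using assms by (intro compact_continuous_image) auto
  then obtain B where B: "\<And>y. y \<in> {0..1} \<Longrightarrow> \<bar>f y\<bar> \<le> B" by (force dest!: compact_imp_bounded simp: bounded_iff)
  have "\<bar>f 0\<bar> \<le> B" by (rule B) simp
  then have "0 \<le> B" by linarith
  then show ?thesis using that B by blast
qed

definition analytic_family :: "(real \<Rightarrow> real fps) \<Rightarrow> bool" where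
  "analytic_family F \<longleftrightarrow> (\<forall>n. continuous_on {0..1} (\<lambda>y. F y $ n)) \<and>
     (\<exists>M R. \<forall>y\<in>{0..1}. geom_bounded M R (F y))"

lemma analytic_family_common:
  assumes "analytic_family F" "analytic_family G"
  obtains M R where "\<And>y. y \<in> {0..1} \<Longrightarrow> geom_bounded M R (F y)" "\<And>y. y \<in> {0..1} \<Longrightarrow> geom_bounded M R (G y)"
proof -
  obtain M R M' R' where "\<forall>y\<in>{0..1}. geom_bounded M R (F y)" "\<forall>y\<in>{0..1}. geom_bounded M' R' (G y)"
    using assms unfolding analytic_family_def by blast
  then show ?thesis
    using that[of "max M M'" "max R R'"] geom_bounded_mono[of M R _ "max M M'" "max R R'"]
      geom_bounded_mono[of M' R' _ "max M M'" "max R R'"] by auto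
qed

lemma analytic_family_const:
  assumes "continuous_on {0..1} f"
  shows "analytic_family (\<lambda>y. fps_const (f y))"
  unfolding analytic_family_def
proof
  obtain B where B: "0 \<le> B" "\<And>y. y \<in> {0..1} \<Longrightarrow> \<bar>f y\<bar> \<le> B"
    using continuous_on_01_bounded[OF assms] by blast
  have "\<forall>y\<in>{0..1}. geom_bounded B 1 (fps_const (f y))"
    using B by (auto simp: geom_bounded_def)
  then show "\<exists>M R. \<forall>y\<in>{0..1}. geom_bounded M R (fps_const (f y))" by blast
  have "continuous_on {0..1} (\<lambda>y. fps_const (f y) $ n)" for n
    by (cases "n = 0") (use assms in auto)
  then show "\<forall>n. continuous_on {0..1} (\<lambda>y. fps_const (f y) $ n)" by blast
qed

lemma analytic_family_X: "analytic_family (\<lambda>y. fps_X)"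
  unfolding analytic_family_def
proof
  have "\<forall>y\<in>{0..1 :: real}. geom_bounded 1 1 fps_X" by (auto simp: geom_bounded_def fps_X_def)
  then show "\<exists>M R. \<forall>y\<in>{0..1 :: real}. geom_bounded M R fps_X" by blast
qed auto

lemma analytic_family_add:
  assumes "analytic_family F" "analytic_family G"
  shows "analytic_family (\<lambda>y. F y + G y)"
proof -
  obtain M R where "\<And>y. y \<in> {0..1} \<Longrightarrow> geom_bounded M R (F y)" "\<And>y. y \<in> {0..1} \<Longrightarrow> geom_bounded M R (G y)"
    using analytic_family_common[OF assms] by blast
  then have "\<forall>y\<in>{0..1}. geom_bounded (M + M) R (F y + G y)" using geom_bounded_add by blast
  moreover have "continuous_on {0..1} (\<lambda>y. F y $ n + G y $ n)" for n
    using assms by (intro continuous_on_add) (auto simp: analytic_family_def)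
  ultimately show ?thesis unfolding analytic_family_def fps_add_nth by blast
qed

lemma analytic_family_mult:
  assumes "analytic_family F" "analytic_family G"
  shows "analytic_family (\<lambda>y. F y * G y)"
proof -
  obtain M R where "\<And>y. y \<in> {0..1} \<Longrightarrow> geom_bounded M R (F y)" "\<And>y. y \<in> {0..1} \<Longrightarrow> geom_bounded M R (G y)"
    using analytic_family_common[OF assms] by blast
  then have "\<forall>y\<in>{0..1}. geom_bounded (M * M) (2 * R) (F y * G y)" using geom_bounded_mult by blast
  moreover have "continuous_on {0..1} (\<lambda>y. \<Sum>i=0..n. F y $ i * G y $ (n - i))" for n
    using assms by (intro continuous_on_sum continuous_on_mult) (auto simp: analytic_family_def)
  ultimately show ?thesis unfolding analytic_family_def fps_mult_nth by blast
qed

lemma analytic_family_power: "analytic_family F \<Longrightarrow> analytic_family (\<lambda>y. F y ^ n)"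
proof (induction n)
  case 0
  then show ?case using analytic_family_const[of "\<lambda>_. 1"] by simp
qed (auto intro: analytic_family_mult)

lemmas analytic_family_intros = analytic_family_const analytic_family_X analytic_family_add
  analytic_family_mult analytic_family_power

text \<open>Common constants make the series of derivatives converge uniformly on
  \<open>[0,1]\<close> by the Weierstrass test with majorant
  \<open>M * (R * |h|) ^ n\<close>.\<close>

lemma eval_family_has_derivative:
  assumes F: "\<And>y. y \<in> {0..1} \<Longrightarrow> geom_bounded M R (F y)" and F': "\<And>y. y \<in> {0..1} \<Longrightarrow> geom_bounded M R (F' y)"
    and d: "\<And>n y. y \<in> {0..1} \<Longrightarrow> ((\<lambda>y. F y $ n) has_real_derivative F' y $ n) (at y within {0..1})"
    and h: "R * \<bar>h\<bar> < 1" and y: "y \<in> {0..1}"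
  shows "((\<lambda>y. eval_fps (F y) h) has_real_derivative eval_fps (F' y) h) (at y within {0..1})"
proof -
  have R: "0 < R" "0 \<le> M" using geom_boundedD[OF F[OF y]] by auto
  have "uniform_limit {0..1} (\<lambda>n x. \<Sum>i<n. F' x $ i * h ^ i) (\<lambda>x. \<Sum>i. F' x $ i * h ^ i) sequentially"
    by (rule Weierstrass_m_test[where M = "\<lambda>n. M * (R * \<bar>h\<bar>) ^ n"])
      (use geom_bounded_summable(3)[OF F' h] R h in \<open>auto intro!: summable_mult summable_geometric simp: abs_mult\<close>)
  then have lim: "uniform_limit {0..1} (\<lambda>n x. \<Sum>i<n. F' x $ i * h ^ i) (\<lambda>x. eval_fps (F' x) h) sequentially"
    by (simp add: eval_fps_def)
  have "\<exists>g. \<forall>x\<in>{0..1}. (\<lambda>n. F x $ n * h ^ n) sums g x \<and>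
      (g has_field_derivative eval_fps (F' x) h) (at x within {0..1})"
    by (rule has_field_derivative_series[OF _ _ lim y])
      (auto intro!: DERIV_cmult_right d geom_bounded_summable(1)[OF F[OF y] h])
  then obtain g where g: "\<And>x. x \<in> {0..1} \<Longrightarrow> (\<lambda>n. F x $ n * h ^ n) sums g x"
    "\<And>x. x \<in> {0..1} \<Longrightarrow> (g has_real_derivative eval_fps (F' x) h) (at x within {0..1})" by blast
  have "g x = eval_fps (F x) h" if "x \<in> {0..1}" for x
    using g(1)[OF that] geom_bounded_sums[OF F[OF that] h] sums_unique2 by blast
  then show ?thesis
    using has_field_derivative_transform_within[OF g(2)[OF y] zero_less_one y] by auto
qed

lemma eval_family_continuous:
  fixes F :: "real \<Rightarrow> real fps"
  assumes F: "\<And>y. y \<in> {0..1} \<Longrightarrow> geom_bounded M R (F y)" and cont: "\<And>n. continuous_on {0..1} (\<lambda>y. F y $ n)"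
    and h: "R * \<bar>h\<bar> < 1"
  shows "continuous_on {0..1} (\<lambda>y. eval_fps (F y) h)"
proof (rule uniform_limit_theorem[OF always_eventually])
  have "geom_bounded M R (F 0)" by (rule F) simp
  then have R: "0 < R" "0 \<le> M" by (auto dest: geom_boundedD)
  have "uniform_limit {0..1} (\<lambda>n x. \<Sum>i<n. F x $ i * h ^ i) (\<lambda>x. \<Sum>i. F x $ i * h ^ i) sequentially"
    by (rule Weierstrass_m_test[where M = "\<lambda>n. M * (R * \<bar>h\<bar>) ^ n"])
      (use geom_bounded_summable(3)[OF F h] R h in \<open>auto intro!: summable_mult summable_geometric simp: abs_mult\<close>)
  then show "uniform_limit {0..1} (\<lambda>n x. \<Sum>i<n. F x $ i * h ^ i) (\<lambda>x. eval_fps (F x) h) sequentially"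
    by (simp add: eval_fps_def)
  show "\<forall>n. continuous_on {0..1} (\<lambda>x. \<Sum>i<n. F x $ i * h ^ i)"
    by (intro allI continuous_on_sum continuous_on_mult_right cont)
qed simp

lemma recenter_family_continuous:
  fixes F :: "real \<Rightarrow> real fps"
  assumes F: "\<And>y. y \<in> {0..1} \<Longrightarrow> geom_bounded M R (F y)" and cont: "\<And>n. continuous_on {0..1} (\<lambda>y. F y $ n)"
    and k: "R * \<bar>k\<bar> \<le> 1 / 4"
  shows "continuous_on {0..1} (\<lambda>y. recenter (F y) k $ n)"
proof -
  have "continuous_on {0..1} (\<lambda>y. eval_fps (Abs_fps (\<lambda>m. real ((m + n) choose n) * F y $ (m + n))) k)"
    by (rule eval_family_continuous[where F = "\<lambda>y. Abs_fps (\<lambda>m. real ((m + n) choose n) * F y $ (m + n))",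
          OF recenter_coeff_eval(1)[OF F]])
      (use k in \<open>auto intro!: continuous_on_mult_left cont\<close>)
  then show ?thesis by (rule continuous_on_eq) (simp add: recenter_coeff_eval(2)[OF F])
qed

lemma recenter_has_derivative:
  assumes F: "\<And>y. y \<in> {0..1} \<Longrightarrow> geom_bounded M R (F y)" "\<And>y. y \<in> {0..1} \<Longrightarrow> geom_bounded M R (F' y)"
    and d: "\<And>n y. y \<in> {0..1} \<Longrightarrow> ((\<lambda>y. F y $ n) has_real_derivative F' y $ n) (at y within {0..1})"
    and k: "R * \<bar>k\<bar> \<le> 1 / 4" and y: "y \<in> {0..1}"
  shows "((\<lambda>y. recenter (F y) k $ n) has_real_derivative recenter (F' y) k $ n) (at y within {0..1})"
proof -
  let ?G = "\<lambda>F. Abs_fps (\<lambda>m. real ((m + n) choose n) * F $ (m + n))"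
  have "((\<lambda>y. eval_fps (?G (F y)) k) has_real_derivative eval_fps (?G (F' y)) k) (at y within {0..1})"
    by (rule eval_family_has_derivative[OF recenter_coeff_eval(1)[OF F(1)] recenter_coeff_eval(1)[OF F(2)] _ _ y])
      (use k in \<open>auto intro!: DERIV_cmult d\<close>)
  then have "((\<lambda>y. recenter (F y) k $ n) has_real_derivative eval_fps (?G (F' y)) k) (at y within {0..1})"
    by (rule has_field_derivative_transform_within[OF _ zero_less_one y]) (simp add: recenter_coeff_eval(2)[OF F(1)])
  then show ?thesis by (simp add: recenter_coeff_eval(2)[OF F(2)[OF y]])
qed

section \<open>Linear equations of second order\<close>

text \<open>Integration against the weight \<open>exp (c * y)\<close> gains a factor
  \<open>1 / c\<close>; a large \<open>c\<close> therefore beats any bound on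
  \<open>q\<close>.\<close>

lemma integral_exp_bound:
  fixes f :: "real \<Rightarrow> real"
  assumes f: "continuous_on {0..1} f" and le: "\<And>y. y \<in> {0..1} \<Longrightarrow> \<bar>f y\<bar> \<le> B * exp (c * y)"
    and c: "1 \<le> c" "0 \<le> B" and y: "y \<in> {0..1}"
  shows "\<bar>integral {0..y} f\<bar> \<le> B / c * exp (c * y)"
proof -
  have int: "((\<lambda>s. B * exp (c * s)) has_integral B / c * exp (c * y) - B / c * exp (c * 0)) {0..y}"
    by (rule fundamental_theorem_of_calculus)
      (use y c in \<open>auto intro!: derivative_eq_intros simp flip: has_real_derivative_iff_has_vector_derivative\<close>)
  have "f integrable_on {0..y}"
    by (rule integrable_continuous_real, rule continuous_on_subset[OF f]) (use y in auto)
  then have "norm (integral {0..y} f) \<le> integral {0..y} (\<lambda>s. B * exp (c * s))"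
    by (rule integral_norm_bound_integral) (use int y le in auto)
  also have "\<dots> = B / c * exp (c * y) - B / c" using integral_unique[OF int] by simp
  also have "\<dots> \<le> B / c * exp (c * y)" using c by simp
  finally show ?thesis by simp
qed

lemma integral_abs_le:
  fixes f :: "real \<Rightarrow> real"
  assumes "continuous_on {0..1} f" "\<And>y. y \<in> {0..1} \<Longrightarrow> \<bar>f y\<bar> \<le> B" "y \<in> {0..1}"
  shows "\<bar>integral {0..y} f\<bar> \<le> B"
proof -
  have "norm (integral {0..y} f) \<le> B * (y - 0)"
    by (rule integral_bound) (use assms in \<open>auto intro: continuous_on_subset\<close>)
  also have "\<dots> \<le> B * 1" using assms(3) assms(2)[OF assms(3)] by (intro mult_left_mono) auto
  finally show ?thesis by simp
qed

text \<open>The solution of \<open>u'' = f\<close> with \<open>u(0) = u'(0) = 0\<close> when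
  \<open>f\<close> is continuous on \<open>[0,1]\<close>.\<close>

definition double_integral :: "(real \<Rightarrow> real) \<Rightarrow> real \<Rightarrow> real" where
  "double_integral f y = integral {0..y} (\<lambda>s. integral {0..s} f)"

lemma double_integral_has_derivative:
  assumes "continuous_on {0..1} f" "y \<in> {0..1}"
  shows "((\<lambda>y. integral {0..y} f) has_real_derivative f y) (at y within {0..1})"
    "(double_integral f has_real_derivative integral {0..y} f) (at y within {0..1})"
proof -
  have 1: "((\<lambda>y. integral {0..y} f) has_real_derivative f y) (at y within {0..1})" if "y \<in> {0..1}" for y
    by (rule integral_has_real_derivative) (use assms that in auto)
  then show "((\<lambda>y. integral {0..y} f) has_real_derivative f y) (at y within {0..1})" using assms by auto
  have "continuous_on {0..1} (\<lambda>y. integral {0..y} f)"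
    using 1 by (rule DERIV_continuous_on)
  then show "(double_integral f has_real_derivative integral {0..y} f) (at y within {0..1})"
    unfolding double_integral_def[abs_def] by (rule integral_has_real_derivative) (use assms in auto)
qed

lemma double_integral_continuous:
  assumes "continuous_on {0..1} f"
  shows "continuous_on {0..1} (\<lambda>y. integral {0..y} f)" "continuous_on {0..1} (double_integral f)"
  by (rule DERIV_continuous_on, erule double_integral_has_derivative[OF assms])+

text \<open>The unknown is \<open>f = w''\<close>: zero initial data give
  \<open>w = double_integral f\<close>, and the equation becomes
  \<open>f = g + q * double_integral f\<close>. The series of iterates \<open>s n\<close> solves
  it.\<close>

lemma linear_ivp_exists:
  assumes q: "continuous_on {0..1} q" and g: "continuous_on {0..1} g"
  obtains w w' where "\<And>y. y \<in> {0..1} \<Longrightarrow> (w has_real_derivative w' y) (at y within {0..1})"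
    "\<And>y. y \<in> {0..1} \<Longrightarrow> (w' has_real_derivative q y * w y + g y) (at y within {0..1})" "w 0 = 0" "w' 0 = (0 :: real)"
proof -
  obtain Q where Q: "0 \<le> Q" "\<And>y. y \<in> {0..1} \<Longrightarrow> \<bar>q y\<bar> \<le> Q"
    using continuous_on_01_bounded[OF q] by blast
  obtain B where B: "0 \<le> B" "\<And>y. y \<in> {0..1} \<Longrightarrow> \<bar>g y\<bar> \<le> B"
    using continuous_on_01_bounded[OF g] by blast
  note Q0 = Q(1) B(1)
  \<comment> \<open>In the norm weighted by \<open>exp (- c y)\<close> the map \<open>f \<mapsto> q * double_integral f\<close> is a contraction by \<open>1 / 2\<close>;
    its Neumann series is summed as a power series at \<open>1\<close>.\<close>
  define c where "c = 1 + 2 * Q"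
  have c: "1 \<le> c" "Q / c \<le> 1 / 2" "c > 0" using Q0 by (auto simp: c_def field_simps)
  define s where "s = rec_nat g (\<lambda>_ f y. q y * double_integral f y)"
  have s_simps: "s 0 = g" "s (Suc n) = (\<lambda>y. q y * double_integral (s n) y)" for n
    by (auto simp: s_def)
  have s: "continuous_on {0..1} (s n) \<and> (\<forall>y\<in>{0..1}. \<bar>s n y\<bar> \<le> B * (1 / 2) ^ n * exp (c * y))" for n
  proof (induction n)
    case 0
    have "B * 1 \<le> B * exp (c * y)" if "y \<in> {0..1}" for y
      using c Q0 that by (intro mult_left_mono) auto
    then have "\<bar>g y\<bar> \<le> B * exp (c * y)" if "y \<in> {0..1}" for y
      using B(2)[OF that] that by fastforce
    then show ?case using g by (simp add: s_simps)
  next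
    case (Suc n)
    have cont: "continuous_on {0..1} (\<lambda>y. integral {0..y} (s n))" "continuous_on {0..1} (double_integral (s n))"
      using double_integral_continuous Suc.IH by auto
    have 1: "\<bar>integral {0..y} (s n)\<bar> \<le> (B * (1 / 2) ^ n / c) * exp (c * y)" if "y \<in> {0..1}" for y
      by (rule integral_exp_bound) (use Suc Q0 c that in auto)
    have 2: "\<bar>double_integral (s n) y\<bar> \<le> (B * (1 / 2) ^ n / c / c) * exp (c * y)" if "y \<in> {0..1}" for y
      unfolding double_integral_def
      by (rule integral_exp_bound[OF cont(1) 1]) (use Q0 c that in auto)
    have "\<bar>s (Suc n) y\<bar> \<le> B * (1 / 2) ^ Suc n * exp (c * y)" if y: "y \<in> {0..1}" for y
    proof -
      have "\<bar>s (Suc n) y\<bar> \<le> Q * ((B * (1 / 2) ^ n / c / c) * exp (c * y))"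
        unfolding s_simps abs_mult using 2[OF y] Q(2)[OF y] Q0 by (intro mult_mono) auto
      also have "\<dots> = (Q / c) * ((1 / c) * (B * (1 / 2) ^ n * exp (c * y)))" by simp
      also have "\<dots> \<le> (1 / 2) * (1 * (B * (1 / 2) ^ n * exp (c * y)))"
        using c Q0 by (intro mult_mono mult_right_mono) auto
      finally show ?thesis by simp
    qed
    then show ?case using cont q by (auto simp: s_simps intro!: continuous_intros)
  qed
  \<comment> \<open>Dropping the weight costs the factor \<open>exp c\<close> and leaves the plain
    ratio \<open>1 / 2\<close>, so that \<open>R = 1 / 2\<close> and \<open>h = 1\<close> meet the
    convergence condition.\<close>
  define M where "M = B * exp c"
  have s_le: "\<bar>s n y\<bar> \<le> M * (1 / 2) ^ n" if y: "y \<in> {0..1}" for n y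
  proof -
    have "B * (1 / 2) ^ n * exp (c * y) \<le> B * (1 / 2) ^ n * exp c"
      using y c Q0 by (intro mult_left_mono) (auto simp: mult_left_le)
    moreover have "\<bar>s n y\<bar> \<le> B * (1 / 2) ^ n * exp (c * y)" using s y by blast
    ultimately show ?thesis unfolding M_def by (simp add: mult.commute mult.left_commute)
  qed
  have le1: "\<bar>integral {0..y} (s n)\<bar> \<le> M * (1 / 2) ^ n" if y: "y \<in> {0..1}" for n y
    by (rule integral_abs_le) (use s s_le y in auto)
  have "continuous_on {0..1} (\<lambda>y. integral {0..y} (s n))" for n
    using double_integral_continuous s by auto
  then have le2: "\<bar>double_integral (s n) y\<bar> \<le> M * (1 / 2) ^ n" if y: "y \<in> {0..1}" for n y
    unfolding double_integral_def by (rule integral_abs_le) (use le1 y in auto)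
  have M0: "0 \<le> M" using Q0 by (simp add: M_def)
  define W W' W'' where "W = (\<lambda>y. Abs_fps (\<lambda>n. double_integral (s n) y))"
    and "W' = (\<lambda>y. Abs_fps (\<lambda>n. integral {0..y} (s n)))" and "W'' = (\<lambda>y. Abs_fps (\<lambda>n. s n y))"
  note W_defs = W_def W'_def W''_def
  have bd: "geom_bounded M (1 / 2) (W y)" "geom_bounded M (1 / 2) (W' y)" "geom_bounded M (1 / 2) (W'' y)" if "y \<in> {0..1}" for y
    using that le1 le2 s_le M0 by (auto simp: geom_bounded_def W_defs)
  have 1: "((\<lambda>y. eval_fps (W y) 1) has_real_derivative eval_fps (W' y) 1) (at y within {0..1})" if "y \<in> {0..1}" for y
    by (rule eval_family_has_derivative[where R = "1 / 2", OF bd(1,2)])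
      (use that double_integral_has_derivative s in \<open>auto simp: W_defs\<close>)
  have 2: "((\<lambda>y. eval_fps (W' y) 1) has_real_derivative eval_fps (W'' y) 1) (at y within {0..1})" if "y \<in> {0..1}" for y
    by (rule eval_family_has_derivative[where R = "1 / 2", OF bd(2,3)])
      (use that double_integral_has_derivative s in \<open>auto simp: W_defs\<close>)
  have 3: "eval_fps (W'' y) 1 = q y * eval_fps (W y) 1 + g y" if y: "y \<in> {0..1}" for y
  proof -
    have "(\<lambda>n. W y $ n * 1 ^ n) sums eval_fps (W y) 1"
      by (rule geom_bounded_sums[OF bd(1)[OF y]]) simp
    then have "(\<lambda>n. q y * double_integral (s n) y) sums (q y * eval_fps (W y) 1)"
      by (auto simp: W_defs intro: sums_mult)
    then have "(\<lambda>n. s (Suc n) y) sums (q y * eval_fps (W y) 1)" by (simp add: s_simps)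
    then have "(\<lambda>n. s n y) sums (q y * eval_fps (W y) 1 + g y)"
      by (subst (asm) sums_Suc_iff) (simp add: s_simps)
    moreover have "(\<lambda>n. W'' y $ n * 1 ^ n) sums eval_fps (W'' y) 1"
      by (rule geom_bounded_sums[OF bd(3)[OF y]]) simp
    ultimately show ?thesis using sums_unique2 by (auto simp: W_defs)
  qed
  show ?thesis
  proof (rule that[of "\<lambda>y. eval_fps (W y) 1" "\<lambda>y. eval_fps (W' y) 1"])
    show "((\<lambda>y. eval_fps (W' y) 1) has_real_derivative q y * eval_fps (W y) 1 + g y) (at y within {0..1})"
      if "y \<in> {0..1}" for y using 2 3 that by metis
  qed (use 1 in \<open>auto simp: W_defs eval_fps_def double_integral_def\<close>)
qed

text \<open>The energy \<open>d^2 + d'^2 + \<eta>^2\<close> satisfies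
  \<open>E' \<le> (K + 2) * E\<close>; including \<open>\<eta>^2\<close> makes this inequality
  homogeneous. The end point \<open>b\<close> may lie inside \<open>[0,1]\<close> because the
  continuation argument has the differential inequality only up to a first exit point.\<close>

lemma gronwall_second_order:
  fixes d d' d'' :: "real \<Rightarrow> real"
  assumes b: "0 \<le> b" "b \<le> 1" and K: "0 \<le> K" "0 \<le> \<eta>"
    and cont: "continuous_on {0..b} d" "continuous_on {0..b} d'"
    and d: "\<And>y. 0 < y \<Longrightarrow> y < b \<Longrightarrow> (d has_real_derivative d' y) (at y)"
      "\<And>y. 0 < y \<Longrightarrow> y < b \<Longrightarrow> (d' has_real_derivative d'' y) (at y)"
    and le: "\<And>y. 0 < y \<Longrightarrow> y < b \<Longrightarrow> \<bar>d'' y\<bar> \<le> K * \<bar>d y\<bar> + \<eta>"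
    and y: "y \<in> {0..b}"
  shows "\<bar>d y\<bar> \<le> exp (K + 2) * (\<bar>d 0\<bar> + \<bar>d' 0\<bar> + \<eta>)" "\<bar>d' y\<bar> \<le> exp (K + 2) * (\<bar>d 0\<bar> + \<bar>d' 0\<bar> + \<eta>)"
proof -
  define E where "E = (\<lambda>y. (d y)\<^sup>2 + (d' y)\<^sup>2 + \<eta>\<^sup>2)"
  have dE: "(E has_real_derivative 2 * d y * d' y + 2 * d' y * d'' y) (at y)" if "0 < y" "y < b" for y
    unfolding E_def using that by (auto intro!: derivative_eq_intros d)
  have E'_le: "2 * d y * d' y + 2 * d' y * d'' y \<le> (K + 2) * E y" if t: "0 < y" "y < b" for y
  proof -
    define a p where "a = \<bar>d y\<bar>" and "p = \<bar>d' y\<bar>"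
    have sq: "(d y)\<^sup>2 = a\<^sup>2" "(d' y)\<^sup>2 = p\<^sup>2" by (auto simp: a_def p_def)
    have 1: "2 * d y * d' y \<le> 2 * (p * a)"
      using abs_ge_self[of "d y * d' y"] by (simp add: a_def p_def abs_mult mult.commute)
    have "d' y * d'' y \<le> p * \<bar>d'' y\<bar>"
      using abs_ge_self[of "d' y * d'' y"] by (simp add: p_def abs_mult)
    also have "\<dots> \<le> p * (K * a + \<eta>)"
      using le[OF t] by (intro mult_left_mono) (auto simp: a_def p_def)
    finally have 2: "2 * d' y * d'' y \<le> K * (2 * (p * a)) + 2 * (p * \<eta>)"
      by (simp add: algebra_simps)
    have 3: "2 * (p * a) \<le> a\<^sup>2 + p\<^sup>2" using sum_squares_bound[of p a] by simp
    have 4: "2 * (p * \<eta>) \<le> p\<^sup>2 + \<eta>\<^sup>2" using sum_squares_bound[of p \<eta>] by simp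
    have 5: "K * (2 * (p * a)) \<le> K * (a\<^sup>2 + p\<^sup>2)" using 3 K by (intro mult_left_mono)
    have "(K + 2) * E y = K * (a\<^sup>2 + p\<^sup>2) + K * \<eta>\<^sup>2 + 2 * a\<^sup>2 + 2 * p\<^sup>2 + 2 * \<eta>\<^sup>2"
      unfolding E_def sq by (simp add: algebra_simps)
    moreover have "0 \<le> K * \<eta>\<^sup>2" "0 \<le> a\<^sup>2" "0 \<le> \<eta>\<^sup>2" using K by auto
    ultimately show ?thesis using 1 2 3 4 5 by linarith
  qed
  have "E y * exp (- (K + 2) * y) \<le> E 0 * exp (- (K + 2) * 0)"
  proof (rule DERIV_nonpos_imp_decreasing_open[of 0 y])
    show "continuous_on {0..y} (\<lambda>y. E y * exp (- (K + 2) * y))"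
      unfolding E_def using y by (auto intro!: continuous_intros continuous_on_subset[OF cont(1)] continuous_on_subset[OF cont(2)])
    fix t assume "0 < t" "t < y"
    then have t: "0 < t" "t < b" using y by auto
    have "((\<lambda>y. E y * exp (- (K + 2) * y)) has_real_derivative
        (2 * d t * d' t + 2 * d' t * d'' t - (K + 2) * E t) * exp (- (K + 2) * t)) (at t)"
      by (rule derivative_eq_intros dE[OF t] refl)+ (simp add: algebra_simps)
    moreover have "(2 * d t * d' t + 2 * d' t * d'' t - (K + 2) * E t) * exp (- (K + 2) * t) \<le> 0"
      using E'_le[OF t] by (intro mult_nonpos_nonneg) auto
    ultimately show "\<exists>z. ((\<lambda>y. E y * exp (- (K + 2) * y)) has_real_derivative z) (at t) \<and> z \<le> 0" by blast
  qed (use y in auto)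
  then have "E y \<le> E 0 * exp ((K + 2) * y)"
    using mult_right_mono[of "E y * exp (- (K + 2) * y)" "E 0" "exp ((K + 2) * y)"]
    by (simp add: mult.assoc algebra_simps flip: exp_add)
  \<comment> \<open>Doubling the exponent is generous, but its square root is then exactly
    \<open>exp (K + 2)\<close>.\<close>
  also have "\<dots> \<le> E 0 * exp (2 * (K + 2))"
  proof (intro mult_left_mono)
    have "(K + 2) * y \<le> (K + 2) * 1" using y b K by (intro mult_left_mono) auto
    also have "\<dots> \<le> 2 * (K + 2)" using K by simp
    finally have "(K + 2) * y \<le> 2 * (K + 2)" .
    then show "exp ((K + 2) * y) \<le> exp (2 * (K + 2))" unfolding exp_le_cancel_iff .
  qed (simp add: E_def)
  also have "\<dots> \<le> (\<bar>d 0\<bar> + \<bar>d' 0\<bar> + \<eta>)\<^sup>2 * exp (2 * (K + 2))"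
  proof (intro mult_right_mono)
    show "E 0 \<le> (\<bar>d 0\<bar> + \<bar>d' 0\<bar> + \<eta>)\<^sup>2"
      unfolding E_def using K by (simp add: power2_eq_square algebra_simps)
  qed auto
  also have "\<dots> = (exp (K + 2) * (\<bar>d 0\<bar> + \<bar>d' 0\<bar> + \<eta>))\<^sup>2"
    unfolding exp_double by (simp add: power_mult_distrib)
  finally have *: "E y \<le> (exp (K + 2) * (\<bar>d 0\<bar> + \<bar>d' 0\<bar> + \<eta>))\<^sup>2" .
  have nn: "0 \<le> exp (K + 2) * (\<bar>d 0\<bar> + \<bar>d' 0\<bar> + \<eta>)" using K by simp
  have "\<bar>d y\<bar>\<^sup>2 \<le> E y" "\<bar>d' y\<bar>\<^sup>2 \<le> E y" by (auto simp: E_def)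
  then show "\<bar>d y\<bar> \<le> exp (K + 2) * (\<bar>d 0\<bar> + \<bar>d' 0\<bar> + \<eta>)" "\<bar>d' y\<bar> \<le> exp (K + 2) * (\<bar>d 0\<bar> + \<bar>d' 0\<bar> + \<eta>)"
    using * nn power2_le_imp_le order_trans by meson+
qed

section \<open>Bounded solution operators for the linear problem\<close>

definition linear_sol :: "(real \<Rightarrow> real) \<Rightarrow> (real \<Rightarrow> real) \<Rightarrow> (real \<Rightarrow> real) \<Rightarrow> (real \<Rightarrow> real) \<Rightarrow> bool" where
  "linear_sol q g w w' \<longleftrightarrow> (\<forall>y\<in>{0..1}. (w has_real_derivative w' y) (at y within {0..1}) \<and>
     (w' has_real_derivative q y * w y + g y) (at y within {0..1}))"

text \<open>The end point \<open>e\<close> selects the side condition: \<open>e = 0\<close> is the initial value problem,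
  \<open>e = 1\<close> the boundary value problem.\<close>

definition linear_solver :: "(real \<Rightarrow> real) \<Rightarrow> real \<Rightarrow> real \<Rightarrow> bool" where
  "linear_solver q e C \<longleftrightarrow> 0 \<le> C \<and> (\<forall>g. continuous_on {0..1} g \<longrightarrow>
     (\<exists>w w'. linear_sol q g w w' \<and> w 0 = 0 \<and> w' e = 0 \<and>
        (\<forall>B. (\<forall>y\<in>{0..1}. \<bar>g y\<bar> \<le> B) \<longrightarrow> (\<forall>y\<in>{0..1}. \<bar>w y\<bar> \<le> C * B \<and> \<bar>w' y\<bar> \<le> C * B))))"

lemma linear_sol_continuous:
  assumes "linear_sol q g w w'"
  shows "continuous_on {0..1} w" "continuous_on {0..1} w'"
proof -
  show "continuous_on {0..1} w" by (rule DERIV_continuous_on[where D = w']) (use assms in \<open>auto simp: linear_sol_def\<close>)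
  show "continuous_on {0..1} w'"
    by (rule DERIV_continuous_on[where D = "\<lambda>y. q y * w y + g y"]) (use assms in \<open>auto simp: linear_sol_def\<close>)
qed

lemma linear_sol_bound:
  assumes w: "linear_sol q g w w'" and Q: "0 \<le> Q" "\<And>y. y \<in> {0..1} \<Longrightarrow> \<bar>q y\<bar> \<le> Q"
    and B: "0 \<le> B" "\<And>y. y \<in> {0..1} \<Longrightarrow> \<bar>g y\<bar> \<le> B" and y: "y \<in> {0..1}"
  shows "\<bar>w y\<bar> \<le> exp (Q + 2) * (\<bar>w 0\<bar> + \<bar>w' 0\<bar> + B)" "\<bar>w' y\<bar> \<le> exp (Q + 2) * (\<bar>w 0\<bar> + \<bar>w' 0\<bar> + B)"
proof -
  have at: "(w has_real_derivative w' y) (at y)" "(w' has_real_derivative q y * w y + g y) (at y)" if "0 < y" "y < 1" for y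
    using w that at_within_Icc_at[of 0 y 1] unfolding linear_sol_def by (metis atLeastAtMost_iff less_imp_le)+
  have le: "\<bar>q y * w y + g y\<bar> \<le> Q * \<bar>w y\<bar> + B" if "0 < y" "y < 1" for y
  proof -
    have "\<bar>q y * w y + g y\<bar> \<le> \<bar>q y\<bar> * \<bar>w y\<bar> + \<bar>g y\<bar>" by (metis abs_mult abs_triangle_ineq)
    also have "\<dots> \<le> Q * \<bar>w y\<bar> + B" using that Q B by (intro add_mono mult_right_mono) auto
    finally show ?thesis .
  qed
  note gronwall_second_order[OF zero_le_one order_refl Q(1) B(1) linear_sol_continuous[OF w] at le y]
  then show "\<bar>w y\<bar> \<le> exp (Q + 2) * (\<bar>w 0\<bar> + \<bar>w' 0\<bar> + B)" "\<bar>w' y\<bar> \<le> exp (Q + 2) * (\<bar>w 0\<bar> + \<bar>w' 0\<bar> + B)" by auto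
qed

lemma linear_solver_ivp:
  assumes q: "continuous_on {0..1} q"
  obtains C where "linear_solver q 0 C"
proof -
  obtain Q where Q: "0 \<le> Q" "\<And>y. y \<in> {0..1} \<Longrightarrow> \<bar>q y\<bar> \<le> Q"
    using continuous_on_01_bounded[OF q] by blast
  have "\<exists>w w'. linear_sol q g w w' \<and> w 0 = 0 \<and> w' 0 = 0 \<and>
        (\<forall>B. (\<forall>y\<in>{0..1}. \<bar>g y\<bar> \<le> B) \<longrightarrow> (\<forall>y\<in>{0..1}. \<bar>w y\<bar> \<le> exp (Q + 2) * B \<and> \<bar>w' y\<bar> \<le> exp (Q + 2) * B))"
    if g: "continuous_on {0..1} g" for g
  proof -
    obtain w w' where w: "linear_sol q g w w'" "w 0 = 0" "w' 0 = 0"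
      using linear_ivp_exists[OF q g] unfolding linear_sol_def by metis
    have "\<bar>w y\<bar> \<le> exp (Q + 2) * B \<and> \<bar>w' y\<bar> \<le> exp (Q + 2) * B" if B: "\<forall>y\<in>{0..1}. \<bar>g y\<bar> \<le> B" and y: "y \<in> {0..1}" for B y
    proof -
      have "0 \<le> B" using B y abs_ge_zero order_trans by blast
      then show ?thesis using linear_sol_bound[OF w(1) Q _ _ y, of B] B w(2,3) by auto
    qed
    then show ?thesis using w by blast
  qed
  then show ?thesis using that[of "exp (Q + 2)"] unfolding linear_solver_def by auto
qed

text \<open>Linear shooting: subtracting a multiple \<open>k\<close> of \<open>\<phi>\<close>
  cancels \<open>w' 1\<close>, which is possible because \<open>\<phi>' 1 \<noteq> 0\<close>. Since
  \<open>|k| \<le> C * B / |\<phi>' 1|\<close>, the corrected solution is still bounded by a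
  constant times \<open>B\<close>.\<close>

lemma linear_solver_bvp:
  assumes q: "continuous_on {0..1} q" and \<phi>: "linear_sol q (\<lambda>_. 0) \<phi> \<phi>'" "\<phi> 0 = 0" "\<phi>' 1 \<noteq> 0"
  obtains C where "linear_solver q 1 C"
proof -
  obtain C where C: "linear_solver q 0 C" by (rule linear_solver_ivp[OF q])
  obtain A where A: "0 \<le> A" "\<And>y. y \<in> {0..1} \<Longrightarrow> \<bar>\<phi> y\<bar> \<le> A"
    using continuous_on_01_bounded[OF linear_sol_continuous(1)[OF \<phi>(1)]] by blast
  obtain A' where A': "0 \<le> A'" "\<And>y. y \<in> {0..1} \<Longrightarrow> \<bar>\<phi>' y\<bar> \<le> A'"
    using continuous_on_01_bounded[OF linear_sol_continuous(2)[OF \<phi>(1)]] by blast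
  define C' where "C' = C + C / \<bar>\<phi>' 1\<bar> * (A + A')"
  have C0: "0 \<le> C" using C by (simp add: linear_solver_def)
  have "\<exists>w w'. linear_sol q g w w' \<and> w 0 = 0 \<and> w' 1 = 0 \<and>
        (\<forall>B. (\<forall>y\<in>{0..1}. \<bar>g y\<bar> \<le> B) \<longrightarrow> (\<forall>y\<in>{0..1}. \<bar>w y\<bar> \<le> C' * B \<and> \<bar>w' y\<bar> \<le> C' * B))"
    if g: "continuous_on {0..1} g" for g
  proof -
    obtain w w' where w: "linear_sol q g w w'" "w 0 = 0" "w' 0 = 0"
      "\<And>B. (\<forall>y\<in>{0..1}. \<bar>g y\<bar> \<le> B) \<Longrightarrow> (\<forall>y\<in>{0..1}. \<bar>w y\<bar> \<le> C * B \<and> \<bar>w' y\<bar> \<le> C * B)"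
      using C g unfolding linear_solver_def by metis
    define k where "k = w' 1 / \<phi>' 1"
    have 1: "linear_sol q g (\<lambda>y. w y - k * \<phi> y) (\<lambda>y. w' y - k * \<phi>' y)"
      unfolding linear_sol_def
    proof (intro ballI conjI)
      fix y :: real assume y: "y \<in> {0..1}"
      show "((\<lambda>y. w y - k * \<phi> y) has_real_derivative w' y - k * \<phi>' y) (at y within {0..1})"
        by (intro DERIV_diff DERIV_cmult) (use w(1) \<phi>(1) y in \<open>auto simp: linear_sol_def\<close>)
      have "((\<lambda>y. w' y - k * \<phi>' y) has_real_derivative (q y * w y + g y) - k * (q y * \<phi> y + 0)) (at y within {0..1})"
        by (intro DERIV_diff DERIV_cmult) (use w(1) \<phi>(1) y in \<open>auto simp: linear_sol_def\<close>)
      then show "((\<lambda>y. w' y - k * \<phi>' y) has_real_derivative q y * (w y - k * \<phi> y) + g y) (at y within {0..1})"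
        by (simp add: algebra_simps)
    qed
    have 2: "\<bar>w y - k * \<phi> y\<bar> \<le> C' * B \<and> \<bar>w' y - k * \<phi>' y\<bar> \<le> C' * B"
      if B: "\<forall>y\<in>{0..1}. \<bar>g y\<bar> \<le> B" and y: "y \<in> {0..1}" for B y
    proof -
      have B0: "0 \<le> B" using B y abs_ge_zero order_trans by blast
      have k: "\<bar>k\<bar> \<le> C * B / \<bar>\<phi>' 1\<bar>" using w(4)[OF B] by (simp add: k_def divide_right_mono)
      have "\<bar>k\<bar> * t \<le> C / \<bar>\<phi>' 1\<bar> * (A + A') * B" if "0 \<le> t" "t \<le> A + A'" for t
        using mult_mono[OF k that(2)] that B0 C0 by (simp add: mult_ac)
      moreover have "\<bar>\<phi> y\<bar> \<le> A + A'" "\<bar>\<phi>' y\<bar> \<le> A + A'" using A A' y by (smt (verit))+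
      ultimately have "\<bar>k * \<phi> y\<bar> \<le> C / \<bar>\<phi>' 1\<bar> * (A + A') * B" "\<bar>k * \<phi>' y\<bar> \<le> C / \<bar>\<phi>' 1\<bar> * (A + A') * B"
        by (auto simp: abs_mult)
      moreover have "\<bar>w y\<bar> \<le> C * B" "\<bar>w' y\<bar> \<le> C * B" using w(4)[OF B] y by auto
      ultimately show ?thesis unfolding C'_def distrib_right by linarith
    qed
    show ?thesis
      by (rule exI[of _ "\<lambda>y. w y - k * \<phi> y"], rule exI[of _ "\<lambda>y. w' y - k * \<phi>' y"])
        (use 1 2 w(2) \<phi>(2,3) in \<open>auto simp: k_def\<close>)
  qed
  moreover have "0 \<le> C'" using C0 A A' by (simp add: C'_def)
  ultimately show ?thesis using that[of C'] unfolding linear_solver_def by blast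
qed

text \<open>Writing \<open>\<phi> = y + w\<close> moves the initial slope into the forcing
  \<open>q y * y\<close> and leaves zero initial data for \<open>w\<close>.\<close>

lemma fundamental_solution_exists:
  assumes q: "continuous_on {0..1} q"
  obtains \<phi> \<phi>' where "linear_sol q (\<lambda>_. 0) \<phi> \<phi>'" "\<phi> 0 = 0" "\<phi>' 0 = 1"
proof -
  obtain w w' where w: "\<And>y. y \<in> {0..1} \<Longrightarrow> (w has_real_derivative w' y) (at y within {0..1})"
    "\<And>y. y \<in> {0..1} \<Longrightarrow> (w' has_real_derivative q y * w y + q y * y) (at y within {0..1})" "w 0 = 0" "w' 0 = 0"
    by (rule linear_ivp_exists[OF q, of "\<lambda>y. q y * y"]) (auto intro!: continuous_intros q)
  have "linear_sol q (\<lambda>_. 0) (\<lambda>y. y + w y) (\<lambda>y. 1 + w' y)"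
    unfolding linear_sol_def
  proof (intro ballI conjI)
    fix y :: real assume y: "y \<in> {0..1}"
    show "((\<lambda>y. y + w y) has_real_derivative 1 + w' y) (at y within {0..1})"
      by (intro DERIV_add DERIV_ident w(1) y)
    have "((\<lambda>y. 1 + w' y) has_real_derivative 0 + (q y * w y + q y * y)) (at y within {0..1})"
      by (intro DERIV_add DERIV_const w(2) y)
    then show "((\<lambda>y. 1 + w' y) has_real_derivative q y * (y + w y) + 0) (at y within {0..1})"
      by (simp add: algebra_simps)
  qed
  then show ?thesis by (rule that) (use w in auto)
qed

text \<open>The difference \<open>D - \<phi>\<close> has zero initial data and solves the equation
  with potential \<open>q\<close> and forcing \<open>(p - q) * D\<close>, which is at most
  \<open>\<epsilon> * B\<close>; Gronwall then keeps \<open>D' 1\<close> closer to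
  \<open>\<phi>' 1\<close> than \<open>0\<close> is.\<close>

lemma linear_ode_perturbation:
  assumes q: "continuous_on {0..1} q" and \<phi>: "linear_sol q (\<lambda>_. 0) \<phi> \<phi>'" "\<phi>' 1 \<noteq> 0"
  obtains \<epsilon> where "0 < \<epsilon>"
    "\<And>p D D'. continuous_on {0..1} D \<Longrightarrow> continuous_on {0..1} D' \<Longrightarrow>
       (\<And>y. 0 < y \<Longrightarrow> y < 1 \<Longrightarrow> (D has_real_derivative D' y) (at y)) \<Longrightarrow>
       (\<And>y. 0 < y \<Longrightarrow> y < 1 \<Longrightarrow> (D' has_real_derivative p y * D y) (at y)) \<Longrightarrow>
       (\<And>y. 0 < y \<Longrightarrow> y < 1 \<Longrightarrow> \<bar>p y - q y\<bar> \<le> \<epsilon>) \<Longrightarrow>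
       D 0 = \<phi> 0 \<Longrightarrow> D' 0 = \<phi>' 0 \<Longrightarrow> D' 1 \<noteq> 0"
proof -
  obtain Q where Q: "0 \<le> Q" "\<And>y. y \<in> {0..1} \<Longrightarrow> \<bar>q y\<bar> \<le> Q"
    using continuous_on_01_bounded[OF q] by blast
  \<comment> \<open>As \<open>\<epsilon> \<le> 1\<close>, the number \<open>Q + 1\<close> bounds
    \<open>p\<close>, so \<open>B\<close> controls every admissible \<open>D\<close> and is fixed
    before \<open>\<epsilon>\<close> is chosen.\<close>
  define B where "B = exp (Q + 1 + 2) * (\<bar>\<phi> 0\<bar> + \<bar>\<phi>' 0\<bar>)"
  have B: "0 \<le> B" by (simp add: B_def)
  define \<epsilon> where "\<epsilon> = min 1 (\<bar>\<phi>' 1\<bar> / (2 * exp (Q + 2) * (B + 1)))"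
  have "0 < \<epsilon>" using B \<phi>(2) by (simp add: \<epsilon>_def)
  have "\<epsilon> * (2 * exp (Q + 2) * (B + 1)) \<le> (\<bar>\<phi>' 1\<bar> / (2 * exp (Q + 2) * (B + 1))) * (2 * exp (Q + 2) * (B + 1))"
    using B by (intro mult_right_mono) (auto simp: \<epsilon>_def)
  also have "\<dots> = \<bar>\<phi>' 1\<bar>" using B by simp
  finally have \<epsilon>B: "2 * (exp (Q + 2) * (\<epsilon> * B)) + 2 * exp (Q + 2) * \<epsilon> \<le> \<bar>\<phi>' 1\<bar>"
    by (simp add: algebra_simps)
  show ?thesis
  proof (rule that[OF \<open>0 < \<epsilon>\<close>])
    fix p D D' :: "real \<Rightarrow> real"
    assume cont: "continuous_on {0..1} D" "continuous_on {0..1} D'"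
      and D: "\<And>y. 0 < y \<Longrightarrow> y < 1 \<Longrightarrow> (D has_real_derivative D' y) (at y)"
        "\<And>y. 0 < y \<Longrightarrow> y < 1 \<Longrightarrow> (D' has_real_derivative p y * D y) (at y)"
      and p: "\<And>y. 0 < y \<Longrightarrow> y < 1 \<Longrightarrow> \<bar>p y - q y\<bar> \<le> \<epsilon>"
      and init: "D 0 = \<phi> 0" "D' 0 = \<phi>' 0"
    have "\<bar>p y * D y\<bar> \<le> (Q + 1) * \<bar>D y\<bar> + 0" if y: "0 < y" "y < 1" for y
    proof -
      have "\<bar>p y\<bar> \<le> Q + 1" using p[OF y] Q(2)[of y] y by (auto simp: \<epsilon>_def)
      then show ?thesis by (simp add: abs_mult mult_right_mono)
    qed
    from gronwall_second_order(1)[OF zero_le_one order_refl _ _ cont D this]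
    have D_le: "\<bar>D y\<bar> \<le> B" if "y \<in> {0..1}" for y using that Q init by (simp add: B_def)
    have at: "(\<phi> has_real_derivative \<phi>' y) (at y)" "(\<phi>' has_real_derivative q y * \<phi> y + 0) (at y)" if "0 < y" "y < 1" for y
      using \<phi>(1) that at_within_Icc_at[of 0 y 1] unfolding linear_sol_def by (metis atLeastAtMost_iff less_imp_le)+
    have "\<bar>p y * D y - (q y * \<phi> y + 0)\<bar> \<le> Q * \<bar>D y - \<phi> y\<bar> + \<epsilon> * B" if y: "0 < y" "y < 1" for y
    proof -
      have "p y * D y - (q y * \<phi> y + 0) = q y * (D y - \<phi> y) + (p y - q y) * D y" by (simp add: algebra_simps)
      also have "\<bar>\<dots>\<bar> \<le> \<bar>q y\<bar> * \<bar>D y - \<phi> y\<bar> + \<bar>p y - q y\<bar> * \<bar>D y\<bar>" by (metis abs_mult abs_triangle_ineq)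
      also have "\<dots> \<le> Q * \<bar>D y - \<phi> y\<bar> + \<epsilon> * B"
        using p[OF y] Q(2)[of y] D_le[of y] y \<open>0 < \<epsilon>\<close> by (intro add_mono mult_mono) auto
      finally show ?thesis .
    qed
    then have "\<bar>D' 1 - \<phi>' 1\<bar> \<le> exp (Q + 2) * (\<bar>D 0 - \<phi> 0\<bar> + \<bar>D' 0 - \<phi>' 0\<bar> + \<epsilon> * B)"
      by (intro gronwall_second_order(2)[of 1, where d = "\<lambda>y. D y - \<phi> y" and d' = "\<lambda>y. D' y - \<phi>' y"
            and d'' = "\<lambda>y. p y * D y - (q y * \<phi> y + 0)"])
        (use Q B \<open>0 < \<epsilon>\<close> linear_sol_continuous[OF \<phi>(1)] cont in \<open>auto intro!: continuous_on_diff DERIV_diff D at[simplified]\<close>)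
    then have "\<bar>D' 1 - \<phi>' 1\<bar> \<le> exp (Q + 2) * (\<epsilon> * B)" using init by simp
    moreover have "0 < 2 * exp (Q + 2) * \<epsilon>" "0 \<le> exp (Q + 2) * (\<epsilon> * B)" using \<open>0 < \<epsilon>\<close> B by auto
    ultimately show "D' 1 \<noteq> 0" using \<epsilon>B by linarith
  qed
qed

section \<open>Analytic solutions of cubic perturbations\<close>

definition cubic :: "real fps \<Rightarrow> real fps \<Rightarrow> real fps \<Rightarrow> real fps \<Rightarrow> real fps \<Rightarrow> real fps" where
  "cubic G0 G1 G2 G3 V = G0 + G1 * V + G2 * V ^ 2 + G3 * V ^ 3"

text \<open>The difference of the two series is \<open>(V - T) * E\<close> with \<open>T\<close> the
  truncation: \<open>V - T\<close> has no coefficient below \<open>n\<close>, and \<open>E\<close>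
  has constant coefficient \<open>0\<close>, so nothing is left at index \<open>n\<close>.\<close>

lemma cubic_cutoff:
  assumes "G1 $ 0 = 0" "V $ 0 = 0"
  shows "cubic G0 G1 G2 G3 V $ n = cubic G0 G1 G2 G3 (fps_cutoff n V) $ n"
proof -
  let ?T = "fps_cutoff n V"
  let ?E = "G1 + G2 * (V + ?T) + G3 * (V ^ 2 + V * ?T + ?T ^ 2)"
  have "cubic G0 G1 G2 G3 V - cubic G0 G1 G2 G3 ?T = (V - ?T) * ?E"
    by (simp add: cubic_def algebra_simps power2_eq_square power3_eq_cube)
  moreover have "((V - ?T) * ?E) $ n = 0"
    unfolding fps_mult_nth
  proof (rule sum.neutral, rule ballI)
    fix i assume "i \<in> {0..n}"
    then show "(V - ?T) $ i * ?E $ (n - i) = 0"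
      using assms by (cases "i = n") (auto simp: power2_eq_square)
  qed
  ultimately show ?thesis by (metis eq_iff_diff_eq_0 fps_sub_nth)
qed

text \<open>The coefficients of \<open>w = S (P w)\<close>, with \<open>S\<close> acting coefficientwise. Coefficient \<open>n\<close> of \<open>P w\<close>
  only sees the truncation of \<open>w\<close> below \<open>n\<close> (lemma \<open>cubic_cutoff\<close>). The same recursion with
  \<open>S g = C * g\<close> and constant coefficient bounds gives the majorant series.\<close>

fun sol_coeff :: "((real \<Rightarrow> real) \<Rightarrow> real \<Rightarrow> real) \<Rightarrow> (real \<Rightarrow> real fps \<Rightarrow> real fps) \<Rightarrow> nat \<Rightarrow> real \<Rightarrow> real" where
  "sol_coeff S P n = S (\<lambda>y. P y (Abs_fps (\<lambda>k. if k < n then sol_coeff S P k y else 0)) $ n)"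

declare sol_coeff.simps [simp del]

lemma sol_coeff_cutoff:
  "sol_coeff S P n = S (\<lambda>y. P y (fps_cutoff n (Abs_fps (\<lambda>k. sol_coeff S P k y))) $ n)"
proof -
  have "Abs_fps (\<lambda>k. if k < n then sol_coeff S P k y else 0) = fps_cutoff n (Abs_fps (\<lambda>k. sol_coeff S P k y))" for y
    by (rule fps_ext) simp
  then show ?thesis by (subst sol_coeff.simps) simp
qed

section \<open>Majorant series\<close>

definition dominated :: "real fps \<Rightarrow> real fps \<Rightarrow> bool" where
  "dominated F A \<longleftrightarrow> (\<forall>n. \<bar>F $ n\<bar> \<le> A $ n)"

text \<open>Domination forces a nonnegative majorant; \<open>dominated A A\<close> is accordingly
  the form in which nonnegativity of coefficients is stated below.\<close>

lemma dominated_nonneg: "dominated F A \<Longrightarrow> 0 \<le> A $ n"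
  unfolding dominated_def using abs_ge_zero order_trans by blast

lemma dominated_add: "dominated F A \<Longrightarrow> dominated G B \<Longrightarrow> dominated (F + G) (A + B)"
  unfolding dominated_def fps_add_nth by (meson abs_triangle_ineq add_mono order_trans)

lemma dominated_mult:
  assumes "dominated F A" "dominated G B"
  shows "dominated (F * G) (A * B)"
  unfolding dominated_def fps_mult_nth
proof
  fix n
  have "\<bar>\<Sum>i=0..n. F $ i * G $ (n - i)\<bar> \<le> (\<Sum>i=0..n. \<bar>F $ i * G $ (n - i)\<bar>)" by (rule sum_abs)
  also have "\<dots> \<le> (\<Sum>i=0..n. A $ i * B $ (n - i))"
    unfolding abs_mult using assms dominated_nonneg[OF assms(1)] by (intro sum_mono mult_mono) (auto simp: dominated_def)
  finally show "\<bar>\<Sum>i=0..n. F $ i * G $ (n - i)\<bar> \<le> (\<Sum>i=0..n. A $ i * B $ (n - i))" .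
qed

lemma dominated_power: "dominated F A \<Longrightarrow> dominated (F ^ n) (A ^ n)"
proof (induction n)
  case 0
  then show ?case by (simp add: dominated_def)
qed (auto intro: dominated_mult)

lemma dominated_cubic:
  assumes "dominated G0 A0" "dominated G1 A1" "dominated G2 A2" "dominated G3 A3" "dominated V A"
  shows "dominated (cubic G0 G1 G2 G3 V) (cubic A0 A1 A2 A3 A)"
  unfolding cubic_def by (intro dominated_add dominated_mult dominated_power assms)

text \<open>Truncation keeps the sum finite before any convergence is known; a bound independent of
  \<open>N\<close> then yields a positive radius.\<close>

definition psum :: "nat \<Rightarrow> real \<Rightarrow> real fps \<Rightarrow> real" where
  "psum N r F = (\<Sum>n\<le>N. F $ n * r ^ n)"

lemma psum_add: "psum N r (F + G) = psum N r F + psum N r G"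
  by (simp add: psum_def sum.distrib algebra_simps)

lemma psum_nonneg: "0 \<le> r \<Longrightarrow> dominated A A \<Longrightarrow> 0 \<le> psum N r A"
  unfolding psum_def using dominated_nonneg by (intro sum_nonneg mult_nonneg_nonneg) auto

text \<open>After reindexing, the product contributes the triangle \<open>i + j \<le> N\<close>, a
  part of the square \<open>i, j \<le> N\<close>, and all terms are nonnegative.\<close>

lemma psum_mult_le:
  assumes r: "0 \<le> r" and F: "dominated F F" and G: "dominated G G"
  shows "psum N r (F * G) \<le> psum N r F * psum N r G"
proof -
  let ?f = "\<lambda>i. F $ i * r ^ i" and ?g = "\<lambda>i. G $ i * r ^ i"
  have nn: "0 \<le> ?f i" "0 \<le> ?g i" for i
    using dominated_nonneg[OF F] dominated_nonneg[OF G] r by auto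
  have "psum N r (F * G) = (\<Sum>n\<le>N. \<Sum>i\<le>n. ?f i * ?g (n - i))"
    unfolding psum_def fps_mult_nth sum_distrib_right
  proof (intro sum.cong refl)
    fix n :: nat
    show "{0..n} = {..n}" by auto
    fix i assume "i \<in> {..n}"
    then have "r ^ n = r ^ i * r ^ (n - i)" using power_add[of r i "n - i"] by simp
    then show "F $ i * G $ (n - i) * r ^ n = ?f i * ?g (n - i)" by simp
  qed
  also have "\<dots> = (\<Sum>(i, j)\<in>{(i, j). i + j \<le> N}. ?f i * ?g j)"
    by (rule sum.triangle_reindex_eq[symmetric])
  also have "\<dots> \<le> (\<Sum>(i, j)\<in>{..N} \<times> {..N}. ?f i * ?g j)"
    by (rule sum_mono2) (auto intro!: mult_nonneg_nonneg[OF nn])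
  also have "\<dots> = psum N r F * psum N r G"
    by (simp add: psum_def sum_product sum.cartesian_product)
  finally show ?thesis .
qed

definition geom_fps :: "real \<Rightarrow> real \<Rightarrow> real fps" where
  "geom_fps M R = Abs_fps (\<lambda>n. M * R ^ n)"

lemma sum_half_le: "(\<Sum>n\<le>N. (1 / 2 :: real) ^ n) \<le> 2"
proof -
  have "(\<Sum>n\<in>{..N}. (1 / 2 :: real) ^ n) \<le> (\<Sum>n. (1 / 2) ^ n)"
    by (intro sum_le_suminf summable_geometric) auto
  then show ?thesis by (simp add: suminf_geometric)
qed

lemma psum_geom_le:
  assumes "0 \<le> M" "0 \<le> R" "0 \<le> r" "R * r \<le> 1 / 2"
  shows "psum N r (geom_fps M R) \<le> 2 * M"
proof -
  have "psum N r (geom_fps M R) = (\<Sum>n\<le>N. M * (R * r) ^ n)"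
    by (simp add: psum_def geom_fps_def power_mult_distrib mult.assoc)
  also have "\<dots> \<le> (\<Sum>n\<le>N. M * (1 / 2) ^ n)"
    using assms by (intro sum_mono mult_left_mono power_mono) auto
  also have "\<dots> \<le> M * 2"
    unfolding sum_distrib_left[symmetric] using assms(1) sum_half_le by (intro mult_left_mono) auto
  finally show ?thesis by simp
qed

lemma psum_X_mult_le:
  assumes "0 \<le> r" "dominated F F"
  shows "psum N r (fps_X * F) \<le> r * psum N r F"
proof -
  have "psum N r fps_X \<le> r"
  proof (cases N)
    case (Suc m)
    have "psum N r fps_X = (\<Sum>n\<in>{1}. fps_X $ n * r ^ n)"
      unfolding psum_def Suc by (rule sum.mono_neutral_right) (auto simp: fps_X_def)
    then show ?thesis by simp
  qed (use assms in \<open>simp add: psum_def\<close>)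
  then show ?thesis
    using psum_mult_le[OF assms(1) _ assms(2), of fps_X N] psum_nonneg[OF assms, of N]
    by (force simp: dominated_def fps_X_def intro: order_trans mult_right_mono)
qed

lemma dominated_geom_fps: "geom_bounded M R F \<Longrightarrow> dominated F (geom_fps M R)"
  by (auto simp: dominated_def geom_bounded_def geom_fps_def)

text \<open>A vanishing constant coefficient allows a factor \<open>fps_X\<close> to be split off.
  This factor later contributes the small number \<open>r\<close>.\<close>

lemma dominated_X_geom_fps:
  assumes "geom_bounded M R F" "F $ 0 = 0"
  shows "dominated F (fps_X * geom_fps (M * R) R)"
  unfolding dominated_def
proof
  fix n
  show "\<bar>F $ n\<bar> \<le> (fps_X * geom_fps (M * R) R) $ n"
    using geom_boundedD(3)[OF assms(1), of n] assms(2)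
    by (cases n) (auto simp: geom_fps_def mult.assoc)
qed

text \<open>The worst case of the right-hand side: the first two coefficient series carry a factor
  \<open>fps_X\<close> because \<open>G0\<close> and \<open>G1\<close> vanish at
  \<open>h = 0\<close>; the other two need not vanish there.\<close>

definition majorant :: "real \<Rightarrow> real \<Rightarrow> real fps \<Rightarrow> real fps" where
  "majorant M R = cubic (fps_X * geom_fps (M * R) R) (fps_X * geom_fps (M * R) R) (geom_fps M R) (geom_fps M R)"

lemma dominated_geom_self: "0 \<le> M \<Longrightarrow> 0 \<le> R \<Longrightarrow> dominated (geom_fps M R) (geom_fps M R)"
  by (auto simp: dominated_def geom_fps_def)

lemma dominated_X_geom_self: "0 \<le> M \<Longrightarrow> 0 \<le> R \<Longrightarrow> dominated (fps_X * geom_fps M R) (fps_X * geom_fps M R)"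
  by (intro dominated_mult dominated_geom_self) (auto simp: dominated_def fps_X_def)

text \<open>Each term with a factor \<open>fps_X\<close> costs at most \<open>2 * M * R * r\<close>,
  made small by \<open>r\<close>; the square and the cube cost at most
  \<open>2 * M * \<sigma>\<^sup>2\<close> each, since \<open>\<sigma> \<le> 1\<close>.\<close>

lemma psum_majorant_le:
  assumes MR: "0 \<le> M" "0 \<le> R" and r: "0 \<le> r" "R * r \<le> 1 / 2" and A: "dominated A A" "psum N r A \<le> \<sigma>" "\<sigma> \<le> 1"
  shows "psum N r (majorant M R A) \<le> 4 * M * R * r + 4 * M * \<sigma>\<^sup>2"
proof -
  let ?H = "geom_fps M R" and ?K = "fps_X * geom_fps (M * R) R" and ?s = "psum N r A"
  have s: "0 \<le> ?s" by (rule psum_nonneg[OF r(1) A(1)])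
  have dom: "dominated ?H ?H" "dominated ?K ?K"
    using MR by (auto intro: dominated_geom_self dominated_X_geom_self)
  have H: "psum N r ?H \<le> 2 * M" by (rule psum_geom_le[OF MR r])
  have "psum N r ?K \<le> r * psum N r (geom_fps (M * R) R)"
    using MR by (intro psum_X_mult_le r dominated_geom_self) auto
  also have "\<dots> \<le> r * (2 * (M * R))"
    using MR r by (intro mult_left_mono psum_geom_le) auto
  finally have H0: "psum N r ?K \<le> 2 * M * R * r" by (simp add: mult_ac)
  have nnH: "0 \<le> psum N r ?H" "0 \<le> psum N r ?K" by (auto intro: psum_nonneg[OF r(1)] dom)
  have A2: "psum N r (A ^ 2) \<le> \<sigma>\<^sup>2"
  proof -
    have "psum N r (A ^ 2) \<le> ?s * ?s" unfolding power2_eq_square by (rule psum_mult_le[OF r(1) A(1) A(1)])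
    also have "\<dots> \<le> \<sigma>\<^sup>2" unfolding power2_eq_square using s A by (intro mult_mono) auto
    finally show ?thesis .
  qed
  have \<sigma>: "0 \<le> \<sigma>" using s A by simp
  have A3: "psum N r (A ^ 3) \<le> \<sigma>\<^sup>2"
  proof -
    have "psum N r (A ^ 3) \<le> ?s * psum N r (A ^ 2)"
      using psum_mult_le[OF r(1) A(1) dominated_power[OF A(1), of 2]] by (simp add: power2_eq_square power3_eq_cube mult.assoc)
    also have "\<dots> \<le> 1 * \<sigma>\<^sup>2"
      using s A A2 psum_nonneg[OF r(1) dominated_power[OF A(1)]] by (intro mult_mono) auto
    finally show ?thesis by simp
  qed
  have "psum N r (majorant M R A) \<le> psum N r ?K + psum N r ?K * ?s + psum N r ?H * psum N r (A ^ 2) + psum N r ?H * psum N r (A ^ 3)"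
    unfolding majorant_def cubic_def psum_add
    by (intro add_mono order_refl psum_mult_le r dom A(1) dominated_power)
  also have "\<dots> \<le> 2 * M * R * r + 2 * M * R * r * 1 + 2 * M * \<sigma>\<^sup>2 + 2 * M * \<sigma>\<^sup>2"
    using MR r s A A2 A3 H H0 nnH psum_nonneg[OF r(1) dominated_power[OF A(1)]]
    by (intro add_mono mult_mono) auto
  finally show ?thesis by simp
qed

text \<open>A bootstrap on partial sums: coefficients up to \<open>Suc N\<close> depend only on the
  truncation below \<open>Suc N\<close>, whose sum is at most \<open>\<sigma>\<close>, and the
  choice of \<open>\<sigma>\<close> and \<open>r\<close> returns the bound \<open>\<sigma>\<close>
  for the longer sum. Nonnegative terms with bounded sums give
  \<open>\<alpha> $ n \<le> \<sigma> * (1 / r) ^ n\<close>.\<close>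

lemma majorant_coeff_bound:
  assumes MR: "0 \<le> M" "0 < R" and C: "0 \<le> C"
  obtains \<sigma> \<rho> where "\<And>n. \<bar>sol_coeff (\<lambda>g y. C * g y) (\<lambda>_. majorant M R) n y\<bar> \<le> \<sigma> * \<rho> ^ n" "0 < \<rho>" "0 \<le> \<sigma>"
proof -
  define \<alpha> where "\<alpha> = Abs_fps (\<lambda>n. sol_coeff (\<lambda>g y. C * g y) (\<lambda>_. majorant M R) n y)"
  have \<alpha>: "\<alpha> $ n = C * majorant M R (fps_cutoff n \<alpha>) $ n" for n
    unfolding \<alpha>_def fps_nth_Abs_fps by (subst sol_coeff_cutoff) simp
  have dom_maj: "dominated (majorant M R F) (majorant M R G)" if "dominated F G" for F G
    unfolding majorant_def using that MR
    by (intro dominated_cubic dominated_geom_self dominated_X_geom_self) auto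
  have nn: "0 \<le> \<alpha> $ n" for n
  proof (induction n rule: less_induct)
    case (less n)
    then have "dominated (fps_cutoff n \<alpha>) (fps_cutoff n \<alpha>)" by (auto simp: dominated_def)
    then show ?case using \<alpha>[of n] C dominated_nonneg[OF dom_maj] by (simp add: mult_nonneg_nonneg)
  qed
  have dom_cut: "dominated (fps_cutoff n \<alpha>) (fps_cutoff m \<alpha>)" if "n \<le> m" for n m
    using nn that by (auto simp: dominated_def)
  \<comment> \<open>Chosen so that \<open>4 * C * M * \<sigma>\<^sup>2 \<le> \<sigma> / 2\<close>:
    the quadratic terms use up half of the allowed bound.\<close>
  define \<sigma> where "\<sigma> = 1 / (1 + 8 * C * M)"
  have \<sigma>: "0 < \<sigma>" "\<sigma> \<le> 1" "8 * C * M * \<sigma> \<le> 1"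
  proof -
    have cm: "0 \<le> 8 * C * M" using C MR by simp
    then have "0 < 1 + 8 * C * M" by linarith
    with cm show "0 < \<sigma>" "\<sigma> \<le> 1" "8 * C * M * \<sigma> \<le> 1"
      by (simp_all add: \<sigma>_def del: mult_le_cancel_right1 zero_le_mult_iff)
  qed
  \<comment> \<open>The second bound gives \<open>4 * C * M * R * r \<le> \<sigma> / 2\<close>, the
    other half; the first gives the ratio \<open>R * r \<le> 1 / 2\<close>.\<close>
  define r where "r = min (1 / (2 * R)) (\<sigma> / (8 * (C * M * R + 1)))"
  have cmr: "0 < C * M * R + 1" using C MR by (intro add_nonneg_pos) auto
  have r: "0 < r" using \<sigma> MR cmr by (auto simp: r_def)
  have "R * r \<le> R * (1 / (2 * R))" using MR by (intro mult_left_mono) (auto simp: r_def)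
  then have r2: "R * r \<le> 1 / 2" using MR by simp
  have "8 * (C * M * R + 1) * r \<le> 8 * (C * M * R + 1) * (\<sigma> / (8 * (C * M * R + 1)))"
    using cmr by (intro mult_left_mono) (auto simp: r_def)
  also have "\<dots> = \<sigma>" using cmr by simp
  finally have "8 * (C * M * R) * r + 8 * r \<le> \<sigma>" by (simp add: algebra_simps)
  then have r3: "C * (4 * M * R * r) \<le> \<sigma> / 2" using r by (simp add: algebra_simps)
  have "(8 * C * M * \<sigma>) * \<sigma> \<le> 1 * \<sigma>" using \<sigma> by (intro mult_right_mono) auto
  then have r4: "C * (4 * M * \<sigma>\<^sup>2) \<le> \<sigma> / 2" by (simp add: power2_eq_square algebra_simps)
  have main: "psum N r \<alpha> \<le> \<sigma>" for N
  proof (induction N)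
    case 0
    have "\<alpha> $ 0 = 0" unfolding \<alpha>[of 0] by (simp add: majorant_def cubic_def power2_eq_square power3_eq_cube)
    then show ?case using \<sigma> by (simp add: psum_def)
  next
    case (Suc N)
    let ?T = "fps_cutoff (Suc N) \<alpha>"
    have "psum (Suc N) r ?T = psum N r \<alpha>"
      by (simp add: psum_def)
    then have T: "psum (Suc N) r ?T \<le> \<sigma>" using Suc by simp
    have "psum (Suc N) r \<alpha> \<le> (\<Sum>n\<le>Suc N. C * majorant M R ?T $ n * r ^ n)"
      unfolding psum_def
    proof (intro sum_mono mult_right_mono)
      fix n assume "n \<in> {..Suc N}"
      then have "dominated (majorant M R (fps_cutoff n \<alpha>)) (majorant M R ?T)" by (intro dom_maj dom_cut) auto
      then have "majorant M R (fps_cutoff n \<alpha>) $ n \<le> majorant M R ?T $ n"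
        unfolding dominated_def using abs_le_D1 by blast
      then show "\<alpha> $ n \<le> C * majorant M R ?T $ n" using \<alpha>[of n] C by (simp add: mult_left_mono)
    qed (use r in auto)
    also have "\<dots> = C * psum (Suc N) r (majorant M R ?T)"
      by (simp add: psum_def sum_distrib_left mult.assoc del: sum.atMost_Suc)
    also have "\<dots> \<le> C * (4 * M * R * r + 4 * M * \<sigma>\<^sup>2)"
      using MR r r2 C T \<sigma> by (intro mult_left_mono psum_majorant_le dom_cut) auto
    also have "\<dots> \<le> \<sigma>" unfolding distrib_left using r3 r4 by simp
    finally show ?case .
  qed
  have "\<bar>\<alpha> $ n\<bar> \<le> \<sigma> * (1 / r) ^ n" for n
  proof -
    have "\<alpha> $ n * r ^ n \<le> psum n r \<alpha>"
      unfolding psum_def by (rule member_le_sum) (use nn r in auto)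
    then have "\<alpha> $ n * r ^ n \<le> \<sigma>" using main order_trans by blast
    then show ?thesis using r nn[of n] by (simp add: field_simps)
  qed
  then show ?thesis using that[of \<sigma> "1 / r"] \<sigma> r by (simp add: \<alpha>_def)
qed

section \<open>Existence of analytic solutions\<close>

lemma eval_fps_cubic:
  assumes "ereal (norm h) < fps_conv_radius G0" "ereal (norm h) < fps_conv_radius G1"
    "ereal (norm h) < fps_conv_radius G2" "ereal (norm h) < fps_conv_radius G3" "ereal (norm h) < fps_conv_radius V"
  shows "eval_fps (cubic G0 G1 G2 G3 V) h = eval_fps G0 h + eval_fps G1 h * eval_fps V h
      + eval_fps G2 h * eval_fps V h ^ 2 + eval_fps G3 h * eval_fps V h ^ 3"
proof -
  have p: "ereal (norm h) < fps_conv_radius (V ^ k)" for k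
    using assms(5) fps_conv_radius_power less_le_trans by blast
  have m: "ereal (norm h) < fps_conv_radius (F * G)" if "ereal (norm h) < fps_conv_radius F" "ereal (norm h) < fps_conv_radius G" for F G
    using that fps_conv_radius_mult[of F G] by (meson less_le_trans min_less_iff_conj)
  have a: "ereal (norm h) < fps_conv_radius (F + G)" if "ereal (norm h) < fps_conv_radius F" "ereal (norm h) < fps_conv_radius G" for F G
    using that fps_conv_radius_add[of F G] by (meson less_le_trans min_less_iff_conj)
  show ?thesis unfolding cubic_def
    by (simp only: eval_fps_add eval_fps_mult eval_fps_power assms p m a)
qed

text \<open>In order \<open>n\<close> the equation reads \<open>W_n'' = q W_n + g_n\<close> with
  \<open>g_n\<close> built from lower coefficients, a linear problem for the solver. The solver
  controls \<open>w\<close> and \<open>w'\<close> with the same constant \<open>C\<close>, so one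
  induction bounds the coefficients of \<open>W\<close> and of \<open>W'\<close> by the same
  majorant.\<close>

theorem analytic_solution:
  fixes q :: "real \<Rightarrow> real"
  assumes q: "continuous_on {0..1} q" and solver: "linear_solver q e C"
    and fam: "analytic_family G0" "analytic_family G1" "analytic_family G2" "analytic_family G3"
    and zero: "\<And>y. y \<in> {0..1} \<Longrightarrow> G0 y $ 0 = 0" "\<And>y. y \<in> {0..1} \<Longrightarrow> G1 y $ 0 = 0"
  obtains W W' r where "0 < r" "analytic_family W" "analytic_family W'"
    "\<And>n y. y \<in> {0..1} \<Longrightarrow> ((\<lambda>y. W y $ n) has_real_derivative W' y $ n) (at y within {0..1})"
    "W 0 = 0" "W' e = 0" "\<And>y. y \<in> {0..1} \<Longrightarrow> W y $ 0 = 0 \<and> W' y $ 0 = 0"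
    "\<And>h. \<bar>h\<bar> < r \<Longrightarrow> linear_sol q (\<lambda>y. eval_fps (G0 y) h + eval_fps (G1 y) h * eval_fps (W y) h
        + eval_fps (G2 y) h * eval_fps (W y) h ^ 2 + eval_fps (G3 y) h * eval_fps (W y) h ^ 3)
      (\<lambda>y. eval_fps (W y) h) (\<lambda>y. eval_fps (W' y) h)"
proof -
  have C0: "0 \<le> C" using solver by (simp add: linear_solver_def)
  \<comment> \<open>The solver is made into operators \<open>S\<close>, \<open>S'\<close> by choice;
    they are meaningful only on continuous functions, so continuity of \<open>g n\<close> has to be
    carried through the induction below.\<close>
  obtain S S' where S: "\<And>g. continuous_on {0..1} g \<Longrightarrow> linear_sol q g (S g) (S' g) \<and> S g 0 = 0 \<and> S' g e = 0"
    "\<And>g B y. continuous_on {0..1} g \<Longrightarrow> \<forall>y\<in>{0..1}. \<bar>g y\<bar> \<le> B \<Longrightarrow> y \<in> {0..1} \<Longrightarrow> \<bar>S g y\<bar> \<le> C * B \<and> \<bar>S' g y\<bar> \<le> C * B"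
  proof -
    have "\<forall>g. \<exists>w w'. continuous_on {0..1} g \<longrightarrow> linear_sol q g w w' \<and> w 0 = 0 \<and> w' e = 0 \<and>
        (\<forall>B. (\<forall>y\<in>{0..1}. \<bar>g y\<bar> \<le> B) \<longrightarrow> (\<forall>y\<in>{0..1}. \<bar>w y\<bar> \<le> C * B \<and> \<bar>w' y\<bar> \<le> C * B))"
      using solver unfolding linear_solver_def by blast
    then obtain S S' where "\<forall>g. continuous_on {0..1} g \<longrightarrow> linear_sol q g (S g) (S' g) \<and> S g 0 = 0 \<and> S' g e = 0 \<and>
        (\<forall>B. (\<forall>y\<in>{0..1}. \<bar>g y\<bar> \<le> B) \<longrightarrow> (\<forall>y\<in>{0..1}. \<bar>S g y\<bar> \<le> C * B \<and> \<bar>S' g y\<bar> \<le> C * B))"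
      by metis
    then show ?thesis using that[of S S'] by blast
  qed
  define P where "P = (\<lambda>y. cubic (G0 y) (G1 y) (G2 y) (G3 y))"
  define W where "W = (\<lambda>y. Abs_fps (\<lambda>n. sol_coeff S P n y))"
  define g where "g = (\<lambda>n y. P y (fps_cutoff n (W y)) $ n)"
  define W' where "W' = (\<lambda>y. Abs_fps (\<lambda>n. S' (g n) y))"
  have W_nth: "W y $ n = S (g n) y" for n y
    unfolding W_def fps_nth_Abs_fps g_def by (subst sol_coeff_cutoff) simp
  have W'_nth: "W' y $ n = S' (g n) y" for n y by (simp add: W'_def)
  obtain M1 R1 where MR1: "\<And>y. y \<in> {0..1} \<Longrightarrow> geom_bounded M1 R1 (G0 y)" "\<And>y. y \<in> {0..1} \<Longrightarrow> geom_bounded M1 R1 (G1 y)"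
    using analytic_family_common[OF fam(1,2)] by blast
  obtain M2 R2 where MR2: "\<And>y. y \<in> {0..1} \<Longrightarrow> geom_bounded M2 R2 (G2 y)" "\<And>y. y \<in> {0..1} \<Longrightarrow> geom_bounded M2 R2 (G3 y)"
    using analytic_family_common[OF fam(3,4)] by blast
  define M R where "M = max M1 M2" and "R = max R1 R2"
  have G: "geom_bounded M R (G0 y)" "geom_bounded M R (G1 y)" "geom_bounded M R (G2 y)" "geom_bounded M R (G3 y)"
    if "y \<in> {0..1}" for y
    using MR1[OF that] MR2[OF that] by (auto simp: M_def R_def elim: geom_bounded_mono)
  have MR: "0 \<le> M" "0 < R" using geom_boundedD[OF G(1)[of 0]] by auto
  \<comment> \<open>Nothing in this recursion depends on \<open>y\<close>; the argument
    \<open>0\<close> is a dummy.\<close>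
  define \<alpha> where "\<alpha> = Abs_fps (\<lambda>n. sol_coeff (\<lambda>g y. C * g y) (\<lambda>_. majorant M R) n 0)"
  have \<alpha>: "\<alpha> $ n = C * majorant M R (fps_cutoff n \<alpha>) $ n" for n
    unfolding \<alpha>_def fps_nth_Abs_fps by (subst sol_coeff_cutoff) simp
  have P_dom: "dominated (P y F) (majorant M R A)" if "y \<in> {0..1}" "dominated F A" for y F A
    unfolding P_def majorant_def using that G[OF that(1)] zero
    by (intro dominated_cubic dominated_X_geom_fps dominated_geom_fps) auto
  have step: "continuous_on {0..1} (g n) \<and> (\<forall>y\<in>{0..1}. \<bar>S (g n) y\<bar> \<le> \<alpha> $ n \<and> \<bar>S' (g n) y\<bar> \<le> \<alpha> $ n)" for n
  proof (induction n rule: less_induct)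
    case (less n)
    have contW: "continuous_on {0..1} (\<lambda>y. W y $ k)" if "k < n" for k
      unfolding W_nth using S(1) less[OF that] linear_sol_continuous by blast
    have dom: "dominated (fps_cutoff n (W y)) (fps_cutoff n \<alpha>)" if "y \<in> {0..1}" for y
      using less that by (auto simp: dominated_def W_nth)
    \<comment> \<open>A truncation has finitely many coefficients, so the crude rate
      \<open>1\<close> suffices: it is used only to obtain continuity of \<open>g n\<close>.\<close>
    have "geom_bounded (\<Sum>k<n. \<bar>\<alpha> $ k\<bar>) 1 (fps_cutoff n (W y))" if "y \<in> {0..1}" for y
      unfolding geom_bounded_def
    proof (intro conjI allI)
      fix k
      have "\<bar>fps_cutoff n (W y) $ k\<bar> \<le> \<bar>\<alpha> $ k\<bar>" if "k < n"
        using less[OF that] \<open>y \<in> {0..1}\<close> that by (auto simp: W_nth intro: order_trans[OF _ abs_ge_self])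
      moreover have "\<bar>\<alpha> $ k\<bar> \<le> (\<Sum>k<n. \<bar>\<alpha> $ k\<bar>)" if "k < n"
        using that by (intro member_le_sum) auto
      ultimately show "\<bar>fps_cutoff n (W y) $ k\<bar> \<le> (\<Sum>k<n. \<bar>\<alpha> $ k\<bar>) * 1 ^ k"
        by (cases "k < n") (fastforce intro: order_trans, simp add: sum_nonneg)
    qed (auto intro: sum_nonneg)
    moreover have "continuous_on {0..1} (\<lambda>y. fps_cutoff n (W y) $ k)" for k
      using contW[of k] by (cases "k < n") auto
    ultimately have "analytic_family (\<lambda>y. fps_cutoff n (W y))"
      unfolding analytic_family_def by blast
    then have "analytic_family (\<lambda>y. P y (fps_cutoff n (W y)))"
      unfolding P_def cubic_def by (intro analytic_family_intros fam)
    then have cont: "continuous_on {0..1} (g n)" by (simp add: analytic_family_def g_def)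
    have "\<forall>y\<in>{0..1}. \<bar>g n y\<bar> \<le> majorant M R (fps_cutoff n \<alpha>) $ n"
      using P_dom[OF _ dom] by (auto simp: g_def dominated_def)
    then show ?case using S(2)[OF cont] cont \<alpha>[of n] by auto
  qed
  obtain \<sigma> \<rho> where \<sigma>\<rho>: "\<And>n. \<bar>\<alpha> $ n\<bar> \<le> \<sigma> * \<rho> ^ n" "0 < \<rho>" "0 \<le> \<sigma>"
    using majorant_coeff_bound[OF MR C0, of 0] unfolding \<alpha>_def by auto
  have bd: "geom_bounded \<sigma> \<rho> (W y)" "geom_bounded \<sigma> \<rho> (W' y)" if "y \<in> {0..1}" for y
    unfolding geom_bounded_def W_nth W'_nth using step \<sigma>\<rho> that abs_ge_self order_trans by meson+
  have sol: "linear_sol q (g n) (S (g n)) (S' (g n))" "S (g n) 0 = 0" "S' (g n) e = 0" for n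
    using S(1) step by auto
  have famW: "analytic_family W" "analytic_family W'"
    unfolding analytic_family_def W_nth W'_nth using bd linear_sol_continuous[OF sol(1)] by blast+
  have W0: "W y $ 0 = 0" "W' y $ 0 = 0" if y: "y \<in> {0..1}" for y
  proof -
    have "\<alpha> $ 0 = 0" unfolding \<alpha>[of 0] by (simp add: majorant_def cubic_def power2_eq_square power3_eq_cube)
    then show "W y $ 0 = 0" "W' y $ 0 = 0" using step[of 0] y by (auto simp: W_nth W'_nth)
  qed
  have g_eq: "g n y = P y (W y) $ n" if "y \<in> {0..1}" for n y
    unfolding g_def P_def by (rule cubic_cutoff[symmetric]) (use zero W0 that in auto)
  \<comment> \<open>The right-hand side as one power series per \<open>y\<close>: being an analytic
    family it has geometric bounds of its own, which the termwise differentiation of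
    \<open>W'\<close> requires.\<close>
  define W'' where "W'' = (\<lambda>y. fps_const (q y) * W y + P y (W y))"
  have W''_nth: "W'' y $ n = q y * S (g n) y + g n y" if "y \<in> {0..1}" for n y
    using g_eq[OF that] by (simp add: W''_def W_nth)
  have famP: "analytic_family (\<lambda>y. P y (W y))"
    unfolding P_def cubic_def by (intro analytic_family_intros fam famW)
  have "analytic_family W''"
    unfolding W''_def by (intro analytic_family_intros famP famW q)
  then obtain M' R' where MR': "\<And>y. y \<in> {0..1} \<Longrightarrow> geom_bounded M' R' (W'' y)" unfolding analytic_family_def by blast
  obtain M3 R3 where MR3: "\<And>y. y \<in> {0..1} \<Longrightarrow> geom_bounded M3 R3 (P y (W y))" using famP unfolding analytic_family_def by blast
  define M\<^sub>0 R\<^sub>0 where "M\<^sub>0 = max M (max M' (max M3 \<sigma>))" and "R\<^sub>0 = max R (max R' (max R3 \<rho>))"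
  have all: "geom_bounded M\<^sub>0 R\<^sub>0 F" if "geom_bounded M R F \<or> geom_bounded M' R' F \<or> geom_bounded M3 R3 F \<or> geom_bounded \<sigma> \<rho> F" for F
    using that by (auto simp: M\<^sub>0_def R\<^sub>0_def elim!: geom_bounded_mono)
  have R0: "0 < R\<^sub>0" using \<sigma>\<rho> by (auto simp: R\<^sub>0_def)
  show ?thesis
  proof (rule that[of "1 / R\<^sub>0" W W'])
    show "0 < 1 / R\<^sub>0" using R0 by simp
    show d: "((\<lambda>y. W y $ n) has_real_derivative W' y $ n) (at y within {0..1})" if "y \<in> {0..1}" for n y
      using sol(1)[of n] that by (auto simp: W_nth W'_nth linear_sol_def)
    have d': "((\<lambda>y. W' y $ n) has_real_derivative W'' y $ n) (at y within {0..1})" if "y \<in> {0..1}" for n y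
      using sol(1)[of n] that by (auto simp: W''_nth W'_nth linear_sol_def)
    show "W 0 = 0" "W' e = 0" by (auto intro!: fps_ext simp: W_nth W'_nth sol)
    show "W y $ 0 = 0 \<and> W' y $ 0 = 0" if "y \<in> {0..1}" for y using W0 that by blast
    fix h :: real assume "\<bar>h\<bar> < 1 / R\<^sub>0"
    then have h: "R\<^sub>0 * \<bar>h\<bar> < 1" using R0 by (simp add: field_simps)
    have rad: "ereal (norm h) < fps_conv_radius F" if "geom_bounded M R F \<or> geom_bounded M' R' F \<or> geom_bounded M3 R3 F \<or> geom_bounded \<sigma> \<rho> F" for F
      using geom_bounded_in_conv_radius[OF all[OF that] h] .
    have ev: "eval_fps (W'' y) h = q y * eval_fps (W y) h + (eval_fps (G0 y) h + eval_fps (G1 y) h * eval_fps (W y) h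
        + eval_fps (G2 y) h * eval_fps (W y) h ^ 2 + eval_fps (G3 y) h * eval_fps (W y) h ^ 3)" if y: "y \<in> {0..1}" for y
    proof -
      have "eval_fps (W'' y) h = eval_fps (fps_const (q y) * W y) h + eval_fps (P y (W y)) h"
        unfolding W''_def
      proof (rule eval_fps_add)
        show "ereal (norm h) < fps_conv_radius (fps_const (q y) * W y)"
          using rad[of "W y"] bd(1)[OF y] by (cases "q y = 0") (auto simp: fps_conv_radius_cmult_left)
      qed (use rad MR3 y in auto)
      also have "eval_fps (fps_const (q y) * W y) h = q y * eval_fps (W y) h"
        by (subst eval_fps_mult) (use rad bd(1)[OF y] in auto)
      also have "eval_fps (P y (W y)) h = eval_fps (G0 y) h + eval_fps (G1 y) h * eval_fps (W y) h
        + eval_fps (G2 y) h * eval_fps (W y) h ^ 2 + eval_fps (G3 y) h * eval_fps (W y) h ^ 3"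
        unfolding P_def by (rule eval_fps_cubic) (use rad G[OF y] bd(1)[OF y] in auto)
      finally show ?thesis .
    qed
    show "linear_sol q (\<lambda>y. eval_fps (G0 y) h + eval_fps (G1 y) h * eval_fps (W y) h
        + eval_fps (G2 y) h * eval_fps (W y) h ^ 2 + eval_fps (G3 y) h * eval_fps (W y) h ^ 3)
      (\<lambda>y. eval_fps (W y) h) (\<lambda>y. eval_fps (W' y) h)"
      unfolding linear_sol_def
    proof (intro ballI conjI)
      fix y :: real assume y: "y \<in> {0..1}"
      show "((\<lambda>y. eval_fps (W y) h) has_real_derivative eval_fps (W' y) h) (at y within {0..1})"
        by (rule eval_family_has_derivative[OF _ _ d h y]) (use all bd in auto)
      have "((\<lambda>y. eval_fps (W' y) h) has_real_derivative eval_fps (W'' y) h) (at y within {0..1})"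
        by (rule eval_family_has_derivative[OF _ _ d' h y]) (use all bd MR' in auto)
      then show "((\<lambda>y. eval_fps (W' y) h) has_real_derivative q y * eval_fps (W y) h + (eval_fps (G0 y) h + eval_fps (G1 y) h * eval_fps (W y) h
        + eval_fps (G2 y) h * eval_fps (W y) h ^ 2 + eval_fps (G3 y) h * eval_fps (W y) h ^ 3)) (at y within {0..1})"
        unfolding ev[OF y] .
    qed
  qed (use famW in auto)
qed

section \<open>The initial value problem\<close>

lemma D01_eq:
  assumes "(u has_real_derivative d) (at y within {0..1})" "y \<in> {0..1}"
  shows "D01 u y = d"
  unfolding D01_def using assms
  by (intro vector_derivative_within_closed_interval) (auto simp: has_real_derivative_iff_has_vector_derivative)

lemma C1_01_has_derivative:
  assumes "u \<in> C1_01" "y \<in> {0..1}"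
  shows "(u has_real_derivative D01 u y) (at y within {0..1})"
proof -
  have "u differentiable (at y within {0..1})" using assms by (auto simp: C1_01_def)
  then obtain d where "(u has_real_derivative d) (at y within {0..1})" using real_differentiable_def by blast
  then show ?thesis using D01_eq assms(2) by metis
qed

lemma C1_01I:
  assumes "\<And>y. y \<in> {0..1} \<Longrightarrow> (u has_real_derivative u' y) (at y within {0..1})" "continuous_on {0..1} u'"
  shows "u \<in> C1_01"
proof -
  have "continuous_on {0..1} (D01 u)"
    using assms(2) by (rule continuous_on_eq) (simp add: D01_eq[OF assms(1)])
  moreover have "u differentiable (at y within {0..1})" if "y \<in> {0..1}" for y
    using assms(1)[OF that] real_differentiable_def by blast
  ultimately show ?thesis by (simp add: C1_01_def)
qed

lemma C1_01_continuous:
  assumes "u \<in> C1_01"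
  shows "continuous_on {0..1} u" "continuous_on {0..1} (D01 u)"
proof -
  show "continuous_on {0..1} u"
    by (rule DERIV_continuous_on[where D = "D01 u"]) (rule C1_01_has_derivative[OF assms])
  show "continuous_on {0..1} (D01 u)" using assms by (simp add: C1_01_def)
qed

lemma solves_odeI:
  assumes v: "\<And>y. y \<in> {0..1} \<Longrightarrow> (v has_real_derivative v' y) (at y within {0..1})" "continuous_on {0..1} v'"
    and v': "\<And>y. 0 < y \<Longrightarrow> y < 1 \<Longrightarrow> (v' has_real_derivative L\<^sup>2 * ((v y) ^ 3 - v y + \<zeta> (L * y))) (at y)"
  shows "solves_ode \<zeta> L v" "\<And>y. y \<in> {0..1} \<Longrightarrow> D01 v y = v' y"
proof -
  show eq: "\<And>y. y \<in> {0..1} \<Longrightarrow> D01 v y = v' y" by (rule D01_eq[OF v(1)])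
  have "(D01 v has_real_derivative L\<^sup>2 * ((v y) ^ 3 - v y + \<zeta> (L * y))) (at y)" if "0 < y" "y < 1" for y
    by (rule has_field_derivative_transform_within_open[OF v'[OF that], of "{0<..<1}"]) (use that eq in auto)
  then show "solves_ode \<zeta> L v" unfolding solves_ode_def using C1_01I[OF v] by fastforce
qed

lemma solves_odeD:
  assumes "solves_ode \<zeta> L v" "0 < y" "y < 1"
  shows "(v has_real_derivative D01 v y) (at y)"
    "(D01 v has_real_derivative L\<^sup>2 * ((v y) ^ 3 - v y + \<zeta> (L * y))) (at y)"
proof -
  show "(v has_real_derivative D01 v y) (at y)"
    using C1_01_has_derivative[of v y] assms at_within_Icc_at[of 0 y 1] by (simp add: solves_ode_def)
  obtain a where "(D01 v has_real_derivative a) (at y)" "- a + L\<^sup>2 * ((v y) ^ 3 - v y + \<zeta> (L * y)) = 0"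
    using assms unfolding solves_ode_def by (meson greaterThanLessThan_iff)
  moreover from this have "a = L\<^sup>2 * ((v y) ^ 3 - v y + \<zeta> (L * y))" by linarith
  ultimately show "(D01 v has_real_derivative L\<^sup>2 * ((v y) ^ 3 - v y + \<zeta> (L * y))) (at y)" by simp
qed

text \<open>The expression is the divided difference of \<open>x^3 - x\<close> at \<open>a\<close>
  and \<open>b\<close>, the potential (up to \<open>L^2\<close>) in the linear equation for a
  difference of two solutions.\<close>

lemma cube_diff_le:
  fixes a b A :: real
  assumes "\<bar>a\<bar> \<le> A" "\<bar>b\<bar> \<le> A"
  shows "\<bar>a\<^sup>2 + a * b + b\<^sup>2 - 1\<bar> \<le> 3 * A\<^sup>2 + 1"
proof -
  have "\<bar>a * a\<bar> \<le> A * A" "\<bar>a * b\<bar> \<le> A * A" "\<bar>b * b\<bar> \<le> A * A"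
    unfolding abs_mult using assms by (intro mult_mono; simp)+
  then show ?thesis unfolding power2_eq_square by linarith
qed

text \<open>For equal \<open>L\<close> the inhomogeneity cancels and \<open>x^3 - x\<close> factors
  through the difference, which leaves a linear equation whose potential is determined by the two
  solutions.\<close>

lemma solves_ode_difference:
  fixes u v :: "real \<Rightarrow> real"
  assumes "solves_ode \<zeta> L v" "solves_ode \<zeta> L u" "0 < y" "y < 1"
  shows "((\<lambda>y. D01 v y - D01 u y) has_real_derivative
    L\<^sup>2 * ((v y)\<^sup>2 + v y * u y + (u y)\<^sup>2 - 1) * (v y - u y)) (at y)"
proof -
  have "((\<lambda>y. D01 v y - D01 u y) has_real_derivative
      L\<^sup>2 * ((v y) ^ 3 - v y + \<zeta> (L * y)) - L\<^sup>2 * ((u y) ^ 3 - u y + \<zeta> (L * y))) (at y)"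
    by (intro DERIV_diff solves_odeD assms)
  also have "L\<^sup>2 * ((v y) ^ 3 - v y + \<zeta> (L * y)) - L\<^sup>2 * ((u y) ^ 3 - u y + \<zeta> (L * y))
      = L\<^sup>2 * ((v y)\<^sup>2 + v y * u y + (u y)\<^sup>2 - 1) * (v y - u y)"
    by (simp add: algebra_simps power2_eq_square power3_eq_cube)
  finally show ?thesis .
qed

lemma solves_ivp_unique:
  assumes "solves_ivp \<zeta> c0 L z v" "solves_ivp \<zeta> c0 L z u" "y \<in> {0..1}"
  shows "v y = u y" "D01 v y = D01 u y"
proof -
  have ode: "solves_ode \<zeta> L v" "solves_ode \<zeta> L u" and C1: "v \<in> C1_01" "u \<in> C1_01"
    using assms by (auto simp: solves_ivp_def solves_ode_def)
  obtain A where A: "\<And>y. y \<in> {0..1} \<Longrightarrow> \<bar>v y\<bar> \<le> A" using continuous_on_01_bounded[OF C1_01_continuous(1)[OF C1(1)]] by metis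
  obtain B where B: "\<And>y. y \<in> {0..1} \<Longrightarrow> \<bar>u y\<bar> \<le> B" using continuous_on_01_bounded[OF C1_01_continuous(1)[OF C1(2)]] by metis
  define K where "K = L\<^sup>2 * (3 * (max A B)\<^sup>2 + 1)"
  have le: "\<bar>L\<^sup>2 * ((v y)\<^sup>2 + v y * u y + (u y)\<^sup>2 - 1) * (v y - u y)\<bar> \<le> K * \<bar>v y - u y\<bar> + 0" if "0 < y" "y < 1" for y
  proof -
    have "\<bar>v y\<bar> \<le> max A B" "\<bar>u y\<bar> \<le> max A B" using A[of y] B[of y] that by auto
    then show ?thesis unfolding K_def abs_mult using cube_diff_le by (auto intro!: mult_right_mono mult_left_mono)
  qed
  have z: "v 0 - u 0 = 0" "D01 v 0 - D01 u 0 = 0" using assms by (auto simp: solves_ivp_def)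
  have "\<bar>v y - u y\<bar> \<le> exp (K + 2) * (\<bar>v 0 - u 0\<bar> + \<bar>D01 v 0 - D01 u 0\<bar> + 0)"
    "\<bar>D01 v y - D01 u y\<bar> \<le> exp (K + 2) * (\<bar>v 0 - u 0\<bar> + \<bar>D01 v 0 - D01 u 0\<bar> + 0)"
    by (rule gronwall_second_order[of 1, where d = "\<lambda>y. v y - u y" and d' = "\<lambda>y. D01 v y - D01 u y", OF _ _ _ _ _ _ _ solves_ode_difference[OF ode] le];
        use assms C1_01_continuous C1 in \<open>auto simp: K_def intro!: continuous_on_diff DERIV_diff solves_odeD(1)[OF ode(1)] solves_odeD(1)[OF ode(2)]\<close>)+
  then show "v y = u y" "D01 v y = D01 u y" using z by auto
qed

lemma ivp_sol_solves:
  assumes "solves_ivp \<zeta> c0 L z v"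
  shows "solves_ivp \<zeta> c0 L z (ivp_sol \<zeta> c0 L z)"
  using someI[of "solves_ivp \<zeta> c0 L z", OF assms] by (simp add: ivp_sol_def)

lemma ivp_domain_solves: "(L, z) \<in> ivp_domain \<zeta> c0 \<Longrightarrow> solves_ivp \<zeta> c0 L z (ivp_sol \<zeta> c0 L z)"
  by (auto simp: ivp_domain_def intro: ivp_sol_solves)

lemma ivp_sol_eq:
  assumes "solves_ivp \<zeta> c0 L z v" "y \<in> {0..1}"
  shows "ivp_sol \<zeta> c0 L z y = v y" "D01 (ivp_sol \<zeta> c0 L z) y = D01 v y"
  using solves_ivp_unique[OF ivp_sol_solves[OF assms(1)] assms] by auto

lemma shoot_eq: "solves_ivp \<zeta> c0 L z v \<Longrightarrow> shoot \<zeta> c0 L z = D01 v 1"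
  unfolding shoot_def by (rule ivp_sol_eq) auto

text \<open>Continuation argument: at the first point where \<open>v\<close> is at distance \<open>1\<close> from \<open>v0\<close>, Gronwall's
  inequality would already give distance at most \<open>1 / 2\<close>.\<close>

lemma ivp_continuous_dependence:
  assumes \<zeta>: "continuous_on {0..} \<zeta>" and L0: "0 < L0" and v0: "solves_ivp \<zeta> c0 L0 z0 v0" and \<eta>: "0 < \<eta>"
  obtains \<delta> where "0 < \<delta>" "\<delta> \<le> L0"
    "\<And>L z v y. \<bar>L - L0\<bar> < \<delta> \<Longrightarrow> \<bar>z - z0\<bar> < \<delta> \<Longrightarrow> solves_ivp \<zeta> c0 L z v \<Longrightarrow> y \<in> {0..1} \<Longrightarrow> \<bar>v y - v0 y\<bar> \<le> \<eta>"
proof -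
  have ode0: "solves_ode \<zeta> L0 v0" and C10: "v0 \<in> C1_01" using v0 by (auto simp: solves_ivp_def solves_ode_def)
  obtain A where A: "0 \<le> A" "\<And>y. y \<in> {0..1} \<Longrightarrow> \<bar>v0 y\<bar> \<le> A"
    using continuous_on_01_bounded[OF C1_01_continuous(1)[OF C10]] by metis
  \<comment> \<open>Bounds the potential as long as \<open>L \<le> 2 * L0\<close> and
    \<open>v\<close> stays within distance \<open>1\<close> of \<open>v0\<close>.\<close>
  define K where "K = (2 * L0)\<^sup>2 * (3 * (A + 1)\<^sup>2 + 1)"
  have K: "0 \<le> K" by (simp add: K_def)
  \<comment> \<open>Change of slope and forcing are each allowed \<open>\<rho>\<close>, and Gronwall
    multiplies their sum by \<open>exp (K + 2)\<close>.\<close>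
  define \<rho> where "\<rho> = min \<eta> (1 / 2) / (2 * exp (K + 2))"
  have \<rho>: "0 < \<rho>" using \<eta> by (simp add: \<rho>_def)
  \<comment> \<open>The right-hand side along the fixed function \<open>v0\<close>:
    \<open>F (L, y) - F (L0, y)\<close> is the forcing caused by changing \<open>L\<close>, and
    uniform continuity makes it small for all \<open>y\<close> at once.\<close>
  define F where "F = (\<lambda>(L :: real, y). L\<^sup>2 * ((v0 y) ^ 3 - v0 y + \<zeta> (L * y)))"
  have "continuous_on ({0..2 * L0} \<times> {0..1}) F"
    unfolding F_def case_prod_unfold
    by (intro continuous_intros continuous_on_compose2[OF C1_01_continuous(1)[OF C10]] continuous_on_compose2[OF \<zeta>]) auto
  then have "uniformly_continuous_on ({0..2 * L0} \<times> {0..1}) F"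
    by (rule compact_uniformly_continuous) (intro compact_Times compact_Icc)
  then obtain d where d: "0 < d" "\<And>p p'. p \<in> {0..2 * L0} \<times> {0..1} \<Longrightarrow> p' \<in> {0..2 * L0} \<times> {0..1} \<Longrightarrow> dist p' p < d \<Longrightarrow> dist (F p') (F p) < \<rho>"
    unfolding uniformly_continuous_on_def using \<rho> by metis
  define \<delta> where "\<delta> = min d (min L0 \<rho>)"
  show ?thesis
  proof (rule that[of \<delta>])
    show "0 < \<delta>" "\<delta> \<le> L0" using d L0 \<rho> by (auto simp: \<delta>_def)
    fix L z v y assume L: "\<bar>L - L0\<bar> < \<delta>" and z: "\<bar>z - z0\<bar> < \<delta>" and v: "solves_ivp \<zeta> c0 L z v" and y: "y \<in> {0..1 :: real}"
    have ode: "solves_ode \<zeta> L v" and C1: "v \<in> C1_01" using v by (auto simp: solves_ivp_def solves_ode_def)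
    have Lr: "0 < L" "L \<le> 2 * L0" using L by (auto simp: \<delta>_def)
    have R: "\<bar>F (L, y) - F (L0, y)\<bar> \<le> \<rho>" if "y \<in> {0..1}" for y
    proof -
      have "dist (F (L, y)) (F (L0, y)) < \<rho>"
        by (rule d(2)) (use Lr L0 L that in \<open>auto simp: dist_Pair_Pair dist_real_def \<delta>_def\<close>)
      then show ?thesis by (simp add: dist_real_def)
    qed
    let ?d = "\<lambda>y. v y - v0 y" and ?d' = "\<lambda>y. D01 v y - D01 v0 y"
      and ?d'' = "\<lambda>y. L\<^sup>2 * ((v y)\<^sup>2 + v y * v0 y + (v0 y)\<^sup>2 - 1) * (v y - v0 y) + (F (L, y) - F (L0, y))"
    have der: "(?d has_real_derivative ?d' y) (at y)" "(?d' has_real_derivative ?d'' y) (at y)" if "0 < y" "y < 1" for y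
    proof -
      show "(?d has_real_derivative ?d' y) (at y)"
        by (intro DERIV_diff solves_odeD(1)[OF ode] solves_odeD(1)[OF ode0] that)
      have "(?d' has_real_derivative L\<^sup>2 * ((v y) ^ 3 - v y + \<zeta> (L * y)) - L0\<^sup>2 * ((v0 y) ^ 3 - v0 y + \<zeta> (L0 * y))) (at y)"
        by (intro DERIV_diff solves_odeD(2)[OF ode] solves_odeD(2)[OF ode0] that)
      also have "L\<^sup>2 * ((v y) ^ 3 - v y + \<zeta> (L * y)) - L0\<^sup>2 * ((v0 y) ^ 3 - v0 y + \<zeta> (L0 * y)) = ?d'' y"
        by (simp add: F_def algebra_simps power2_eq_square power3_eq_cube)
      finally show "(?d' has_real_derivative ?d'' y) (at y)" .
    qed
    have cont: "continuous_on {0..1} ?d" "continuous_on {0..1} ?d'"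
      by (intro continuous_on_diff C1_01_continuous C1 C10)+
    \<comment> \<open>Closeness is assumed strictly before \<open>b\<close> only, so the estimate
      applies at the first exit point itself.\<close>
    have est: "\<bar>?d b\<bar> \<le> min \<eta> (1 / 2)" if b: "0 \<le> b" "b \<le> 1" and small: "\<And>y. 0 \<le> y \<Longrightarrow> y < b \<Longrightarrow> \<bar>?d y\<bar> \<le> 1" for b
    proof -
      have "\<bar>?d'' t\<bar> \<le> K * \<bar>?d t\<bar> + \<rho>" if t: "0 < t" "t < b" for t
      proof -
        have v0t: "\<bar>v0 t\<bar> \<le> A" using A(2)[of t] t b by auto
        then have "\<bar>v t\<bar> \<le> A + 1" "\<bar>v0 t\<bar> \<le> A + 1" using small[of t] t by linarith+
        then have "\<bar>(v t)\<^sup>2 + v t * v0 t + (v0 t)\<^sup>2 - 1\<bar> \<le> 3 * (A + 1)\<^sup>2 + 1" by (rule cube_diff_le)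
        moreover have "\<bar>L\<^sup>2\<bar> \<le> (2 * L0)\<^sup>2" using power_mono[of L "2 * L0" 2] Lr by simp
        ultimately have "\<bar>L\<^sup>2 * ((v t)\<^sup>2 + v t * v0 t + (v0 t)\<^sup>2 - 1) * (v t - v0 t)\<bar> \<le> K * \<bar>?d t\<bar>"
          unfolding K_def abs_mult by (intro mult_right_mono mult_mono) auto
        then show ?thesis using R[of t] t b by auto
      qed
      then have "\<bar>?d b\<bar> \<le> exp (K + 2) * (\<bar>?d 0\<bar> + \<bar>?d' 0\<bar> + \<rho>)"
        using b \<rho> K der
        by (intro gronwall_second_order(1)[where b = b and d' = ?d' and d'' = ?d''])
          (auto intro: continuous_on_subset[OF cont(1)] continuous_on_subset[OF cont(2)])
      also have "\<dots> \<le> exp (K + 2) * (\<rho> + \<rho>)"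
        using v v0 z by (intro mult_left_mono) (auto simp: solves_ivp_def \<delta>_def)
      also have "\<dots> = min \<eta> (1 / 2)" by (simp add: \<rho>_def)
      finally show ?thesis .
    qed
    define S where "S = {y \<in> {0..1}. 1 \<le> \<bar>?d y\<bar>}"
    have "S = {}"
    proof (rule ccontr)
      assume "S \<noteq> {}"
      have "closed ({0..1} \<inter> (\<lambda>y. \<bar>?d y\<bar>) -` {1..})"
        by (intro continuous_closed_preimage continuous_on_rabs cont closed_atLeastAtMost closed_atLeast)
      moreover have "S = {0..1} \<inter> (\<lambda>y. \<bar>?d y\<bar>) -` {1..}" by (auto simp: S_def)
      ultimately have "closed S" by simp
      define b where "b = Inf S"
      have bdd: "bdd_below S" by (auto simp: S_def bdd_below_def)
      have "b \<in> S" unfolding b_def by (rule closed_contains_Inf) (use \<open>S \<noteq> {}\<close> bdd \<open>closed S\<close> in auto)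
      moreover have "\<bar>?d y\<bar> \<le> 1" if "0 \<le> y" "y < b" for y
      proof (rule ccontr)
        assume "\<not> \<bar>?d y\<bar> \<le> 1"
        then have "y \<in> S" using that \<open>b \<in> S\<close> by (auto simp: S_def)
        then show False using cInf_lower[OF _ bdd] that by (force simp: b_def)
      qed
      ultimately show False using est[of b] by (auto simp: S_def)
    qed
    then have "\<bar>?d y\<bar> \<le> 1" if "y \<in> {0..1}" for y using that by (force simp: S_def)
    then have "\<bar>?d y\<bar> \<le> min \<eta> (1 / 2)" using y by (intro est) auto
    then show "\<bar>v y - v0 y\<bar> \<le> \<eta>" by simp
  qed
qed

text \<open>At \<open>a = b = c\<close> the divided difference becomes the derivative
  \<open>3 c^2 - 1\<close>, so both potentials agree there when \<open>L = L0\<close>. The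
  deviations in \<open>a\<close>, \<open>b\<close> and in \<open>L\<close> are separated, and
  \<open>\<kappa> \<le> 1\<close> makes the quadratic terms linear in
  \<open>\<kappa>\<close>.\<close>

lemma potential_diff_le:
  fixes a b c A L L0 \<kappa> :: real
  assumes "\<bar>a - c\<bar> \<le> \<kappa>" "\<bar>b - c\<bar> \<le> \<kappa>" "\<bar>c\<bar> \<le> A" "\<bar>L - L0\<bar> \<le> \<kappa>" "\<kappa> \<le> 1" "0 < L" "L \<le> 2 * L0"
  shows "\<bar>L\<^sup>2 * (a\<^sup>2 + a * b + b\<^sup>2 - 1) - L0\<^sup>2 * (3 * c\<^sup>2 - 1)\<bar>
    \<le> ((2 * L0)\<^sup>2 * (6 * A + 3) + 3 * L0 * (3 * A\<^sup>2 + 1)) * \<kappa>"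
proof -
  define s t where "s = a - c" and "t = b - c"
  have ab: "a = c + s" "b = c + t" by (auto simp: s_def t_def)
  have st: "\<bar>s\<bar> \<le> \<kappa>" "\<bar>t\<bar> \<le> \<kappa>" using assms by (auto simp: s_def t_def)
  have \<kappa>: "0 \<le> \<kappa>" and A: "0 \<le> A" using assms by linarith+
  have small: "\<bar>x * y\<bar> \<le> \<kappa>" if "\<bar>x\<bar> \<le> \<kappa>" "\<bar>y\<bar> \<le> \<kappa>" for x y
    using mult_mono[OF that(1) order_trans[OF that(2) assms(5)]] \<kappa> by (simp add: abs_mult)
  have c: "\<bar>c * x\<bar> \<le> A * \<kappa>" if "\<bar>x\<bar> \<le> \<kappa>" for x
    unfolding abs_mult using assms(3) that A by (intro mult_mono) auto
  have "a\<^sup>2 + a * b + b\<^sup>2 - 3 * c\<^sup>2 = 3 * (c * s) + 3 * (c * t) + s * s + s * t + t * t"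
    unfolding ab by (simp add: power2_eq_square algebra_simps)
  then have 1: "\<bar>a\<^sup>2 + a * b + b\<^sup>2 - 3 * c\<^sup>2\<bar> \<le> (6 * A + 3) * \<kappa>"
    using c[OF st(1)] c[OF st(2)] small[OF st(1) st(1)] small[OF st(1) st(2)] small[OF st(2) st(2)]
    unfolding distrib_right mult.assoc by linarith
  have "\<bar>L\<^sup>2\<bar> \<le> (2 * L0)\<^sup>2" using power_mono[of L "2 * L0" 2] assms by simp
  then have 2: "\<bar>L\<^sup>2 * (a\<^sup>2 + a * b + b\<^sup>2 - 3 * c\<^sup>2)\<bar> \<le> (2 * L0)\<^sup>2 * ((6 * A + 3) * \<kappa>)"
    unfolding abs_mult[of "L\<^sup>2"] using 1 by (intro mult_mono) auto
  have "L\<^sup>2 - L0\<^sup>2 = (L + L0) * (L - L0)" by (simp add: power2_eq_square algebra_simps)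
  then have "\<bar>L\<^sup>2 - L0\<^sup>2\<bar> \<le> (3 * L0) * \<kappa>"
    unfolding abs_mult using assms by (auto simp: abs_mult intro!: mult_mono)
  moreover have "\<bar>3 * c\<^sup>2 - 1\<bar> \<le> 3 * A\<^sup>2 + 1"
    using power_mono[OF assms(3), of 2] by (simp add: abs_le_iff)
  ultimately have 3: "\<bar>(L\<^sup>2 - L0\<^sup>2) * (3 * c\<^sup>2 - 1)\<bar> \<le> (3 * L0 * \<kappa>) * (3 * A\<^sup>2 + 1)"
    unfolding abs_mult using \<kappa> by (intro mult_mono) auto
  have "L\<^sup>2 * (a\<^sup>2 + a * b + b\<^sup>2 - 1) - L0\<^sup>2 * (3 * c\<^sup>2 - 1)
      = L\<^sup>2 * (a\<^sup>2 + a * b + b\<^sup>2 - 3 * c\<^sup>2) + (L\<^sup>2 - L0\<^sup>2) * (3 * c\<^sup>2 - 1)"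
    by (simp add: algebra_simps)
  then have "\<bar>L\<^sup>2 * (a\<^sup>2 + a * b + b\<^sup>2 - 1) - L0\<^sup>2 * (3 * c\<^sup>2 - 1)\<bar>
      \<le> (2 * L0)\<^sup>2 * ((6 * A + 3) * \<kappa>) + (3 * L0 * \<kappa>) * (3 * A\<^sup>2 + 1)"
    using 2 3 by linarith
  also have "\<dots> = ((2 * L0)\<^sup>2 * (6 * A + 3) + 3 * L0 * (3 * A\<^sup>2 + 1)) * \<kappa>" by (simp add: algebra_simps)
  finally show ?thesis .
qed

text \<open>Dividing the difference by \<open>z1 - z2\<close> normalises its initial slope to that
  of \<open>\<phi>\<close>, so the comparison does not deteriorate as \<open>z1\<close> and
  \<open>z2\<close> approach each other.\<close>

lemma steady_state_locally_unique:
  assumes \<zeta>: "continuous_on {0..} \<zeta>" and L0: "0 < L0" and v0: "solves_ivp \<zeta> c0 L0 z0 v0"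
    and \<phi>: "linear_sol (\<lambda>y. L0\<^sup>2 * (3 * (v0 y)\<^sup>2 - 1)) (\<lambda>_. 0) \<phi> \<phi>'" "\<phi> 0 = 0" "\<phi>' 0 = 1" "\<phi>' 1 \<noteq> 0"
  obtains \<delta> where "0 < \<delta>"
    "\<And>L z1 z2 v u. \<bar>L - L0\<bar> < \<delta> \<Longrightarrow> \<bar>z1 - z0\<bar> < \<delta> \<Longrightarrow> \<bar>z2 - z0\<bar> < \<delta> \<Longrightarrow>
       solves_ivp \<zeta> c0 L z1 v \<Longrightarrow> solves_ivp \<zeta> c0 L z2 u \<Longrightarrow> D01 v 1 = 0 \<Longrightarrow> D01 u 1 = 0 \<Longrightarrow> z1 = z2"
proof -
  have C10: "v0 \<in> C1_01" using v0 by (auto simp: solves_ivp_def solves_ode_def)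
  obtain A where A: "0 \<le> A" "\<And>y. y \<in> {0..1} \<Longrightarrow> \<bar>v0 y\<bar> \<le> A"
    using continuous_on_01_bounded[OF C1_01_continuous(1)[OF C10]] by metis
  have q: "continuous_on {0..1} (\<lambda>y. L0\<^sup>2 * (3 * (v0 y)\<^sup>2 - 1))"
    by (intro continuous_intros C1_01_continuous(1)[OF C10])
  obtain \<epsilon> where \<epsilon>: "0 < \<epsilon>"
    "\<And>p D D'. continuous_on {0..1} D \<Longrightarrow> continuous_on {0..1} D' \<Longrightarrow>
       (\<And>y. 0 < y \<Longrightarrow> y < 1 \<Longrightarrow> (D has_real_derivative D' y) (at y)) \<Longrightarrow>
       (\<And>y. 0 < y \<Longrightarrow> y < 1 \<Longrightarrow> (D' has_real_derivative p y * D y) (at y)) \<Longrightarrow>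
       (\<And>y. 0 < y \<Longrightarrow> y < 1 \<Longrightarrow> \<bar>p y - L0\<^sup>2 * (3 * (v0 y)\<^sup>2 - 1)\<bar> \<le> \<epsilon>) \<Longrightarrow>
       D 0 = \<phi> 0 \<Longrightarrow> D' 0 = \<phi>' 0 \<Longrightarrow> D' 1 \<noteq> 0"
    using linear_ode_perturbation[OF q \<phi>(1,4)] by metis
  define T where "T = (2 * L0)\<^sup>2 * (6 * A + 3) + 3 * L0 * (3 * A\<^sup>2 + 1)"
  have T: "0 < T" unfolding T_def using L0 A by (intro add_pos_pos mult_pos_pos add_nonneg_pos) auto
  define \<kappa> where "\<kappa> = min 1 (\<epsilon> / T)"
  have \<kappa>: "0 < \<kappa>" "\<kappa> \<le> 1" using \<epsilon> T by (auto simp: \<kappa>_def)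
  have "T * \<kappa> \<le> T * (\<epsilon> / T)" using T by (intro mult_left_mono) (auto simp: \<kappa>_def)
  then have T\<kappa>: "T * \<kappa> \<le> \<epsilon>" using T by simp
  obtain \<delta> where \<delta>: "0 < \<delta>" "\<delta> \<le> L0"
    "\<And>L z v y. \<bar>L - L0\<bar> < \<delta> \<Longrightarrow> \<bar>z - z0\<bar> < \<delta> \<Longrightarrow> solves_ivp \<zeta> c0 L z v \<Longrightarrow> y \<in> {0..1} \<Longrightarrow> \<bar>v y - v0 y\<bar> \<le> \<kappa>"
    using ivp_continuous_dependence[OF \<zeta> L0 v0 \<kappa>(1)] by metis
  show ?thesis
  proof (rule that[of "min \<delta> \<kappa>"])
    fix L z1 z2 v u
    assume L: "\<bar>L - L0\<bar> < min \<delta> \<kappa>" and z: "\<bar>z1 - z0\<bar> < min \<delta> \<kappa>" "\<bar>z2 - z0\<bar> < min \<delta> \<kappa>"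
      and v: "solves_ivp \<zeta> c0 L z1 v" and u: "solves_ivp \<zeta> c0 L z2 u" and "D01 v 1 = 0" "D01 u 1 = 0"
    have ode: "solves_ode \<zeta> L v" "solves_ode \<zeta> L u" and C1: "v \<in> C1_01" "u \<in> C1_01"
      using v u by (auto simp: solves_ivp_def solves_ode_def)
    show "z1 = z2"
    proof (rule ccontr)
      assume ne: "z1 \<noteq> z2"
      let ?p = "\<lambda>y. L\<^sup>2 * ((v y)\<^sup>2 + v y * u y + (u y)\<^sup>2 - 1)"
      let ?D = "\<lambda>y. (v y - u y) / (z1 - z2)" and ?D' = "\<lambda>y. (D01 v y - D01 u y) / (z1 - z2)"
      have "?D' 1 \<noteq> 0"
      proof (rule \<epsilon>(2)[of ?D ?D' ?p])
        show "continuous_on {0..1} ?D" "continuous_on {0..1} ?D'"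
          using ne by (intro continuous_intros C1_01_continuous C1; simp)+
        fix y :: real assume y: "0 < y" "y < 1"
        show "(?D has_real_derivative ?D' y) (at y)"
          by (intro DERIV_cdivide DERIV_diff solves_odeD(1)[OF ode(1)] solves_odeD(1)[OF ode(2)] y)
        have "(?D' has_real_derivative ?p y * (v y - u y) / (z1 - z2)) (at y)"
          by (intro DERIV_cdivide solves_ode_difference[OF ode] y)
        then show "(?D' has_real_derivative ?p y * ?D y) (at y)" by simp
        have "\<bar>?p y - L0\<^sup>2 * (3 * (v0 y)\<^sup>2 - 1)\<bar> \<le> T * \<kappa>"
          unfolding T_def
          by (rule potential_diff_le)
            (use \<delta>(3)[OF _ _ v, of y] \<delta>(3)[OF _ _ u, of y] A(2)[of y] y L z \<delta>(2) \<kappa> in auto)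
        then show "\<bar>?p y - L0\<^sup>2 * (3 * (v0 y)\<^sup>2 - 1)\<bar> \<le> \<epsilon>" using T\<kappa> by linarith
      qed (use v u ne \<phi> in \<open>auto simp: solves_ivp_def\<close>)
      then show False using \<open>D01 v 1 = 0\<close> \<open>D01 u 1 = 0\<close> by simp
    qed
  qed (use \<delta> \<kappa> in auto)
qed

text \<open>In both applications the coefficients, apart from the term with \<open>\<zeta>\<close>,
  are polynomials of degree at most two in \<open>h\<close>: from \<open>(L0 + h)^2\<close> for the
  branch, from dividing the cubic expansion by \<open>h\<close> for the derivative of the shooting
  function.\<close>

definition fps_quadratic :: "real \<Rightarrow> real \<Rightarrow> real \<Rightarrow> real fps" where
  "fps_quadratic a b c = fps_const a + fps_const b * fps_X + fps_const c * fps_X ^ 2"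

lemma fps_quadratic_nth_0: "fps_quadratic a b c $ 0 = a"
  by (simp add: fps_quadratic_def)

lemma fps_conv_radius_quadratic: "fps_conv_radius (fps_quadratic a b c) = \<infinity>"
proof -
  have m: "fps_conv_radius (F * G) = \<infinity>" if "fps_conv_radius F = \<infinity>" "fps_conv_radius G = \<infinity>" for F G :: "real fps"
    using fps_conv_radius_mult[of F G] that by simp
  have a: "fps_conv_radius (F + G) = \<infinity>" if "fps_conv_radius F = \<infinity>" "fps_conv_radius G = \<infinity>" for F G :: "real fps"
    using fps_conv_radius_add[of F G] that by simp
  show ?thesis unfolding fps_quadratic_def by (intro a m) simp_all
qed

lemma eval_fps_quadratic: "eval_fps (fps_quadratic a b c) h = a + b * h + c * h\<^sup>2"
proof -
  have "(\<lambda>n. fps_quadratic a b c $ n * h ^ n) sums (\<Sum>n<3. fps_quadratic a b c $ n * h ^ n)"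
    by (rule sums_finite) (auto simp: fps_quadratic_def fps_X_power_nth)
  also have "(\<Sum>n<3. fps_quadratic a b c $ n * h ^ n) = a + b * h + c * h\<^sup>2"
    by (simp add: fps_quadratic_def fps_X_power_nth eval_nat_numeral)
  finally show ?thesis by (simp add: eval_fps_def sums_iff)
qed

lemma analytic_family_quadratic:
  assumes "continuous_on {0..1} a" "continuous_on {0..1} b" "continuous_on {0..1} c"
  shows "analytic_family (\<lambda>y. fps_quadratic (a y) (b y) (c y))"
  unfolding fps_quadratic_def by (intro analytic_family_intros assms)

text \<open>The solution with slope \<open>z0 + h\<close> is sought as \<open>v0 + h (\<phi> + w)\<close>; after division by \<open>h\<close> the equation
  for \<open>w\<close> is again a cubic perturbation whose coefficients vanish at \<open>h = 0\<close>.\<close>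

lemma shoot_has_derivative:
  assumes v0: "solves_ivp \<zeta> c0 L0 z0 v0"
    and \<phi>: "linear_sol (\<lambda>y. L0\<^sup>2 * (3 * (v0 y)\<^sup>2 - 1)) (\<lambda>_. 0) \<phi> \<phi>'" "\<phi> 0 = 0" "\<phi>' 0 = 1"
  shows "(shoot \<zeta> c0 L0 has_real_derivative \<phi>' 1) (at z0)"
proof -
  have ode0: "solves_ode \<zeta> L0 v0" and C10: "v0 \<in> C1_01" using v0 by (auto simp: solves_ivp_def solves_ode_def)
  note cont = C1_01_continuous(1)[OF C10] linear_sol_continuous[OF \<phi>(1)]
  define q where "q = (\<lambda>y. L0\<^sup>2 * (3 * (v0 y)\<^sup>2 - 1))"
  have q: "continuous_on {0..1} q" unfolding q_def by (intro continuous_intros cont)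
  obtain C where C: "linear_solver q 0 C" by (rule linear_solver_ivp[OF q])
  \<comment> \<open>Collected by powers of \<open>w\<close> from
    \<open>L0^2 * (3 v0 h \<psi>^2 + h^2 \<psi>^3)\<close> with \<open>\<psi> = \<phi> + w\<close>;
    the part \<open>q * \<psi>\<close> is treated as linear.\<close>
  let ?G0 = "\<lambda>y. fps_quadratic 0 (3 * L0\<^sup>2 * v0 y * \<phi> y ^ 2) (L0\<^sup>2 * \<phi> y ^ 3)"
  let ?G1 = "\<lambda>y. fps_quadratic 0 (6 * L0\<^sup>2 * v0 y * \<phi> y) (3 * L0\<^sup>2 * \<phi> y ^ 2)"
  let ?G2 = "\<lambda>y. fps_quadratic 0 (3 * L0\<^sup>2 * v0 y) (3 * L0\<^sup>2 * \<phi> y)"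
  let ?G3 = "\<lambda>y. fps_quadratic 0 0 (L0\<^sup>2)"
  have fam: "analytic_family ?G0" "analytic_family ?G1" "analytic_family ?G2" "analytic_family ?G3"
    by (intro analytic_family_quadratic continuous_intros cont)+
  obtain W W' r where r: "0 < r" and W: "analytic_family W" "analytic_family W'" "W 0 = 0" "W' 0 = 0"
      "\<And>y. y \<in> {0..1} \<Longrightarrow> W y $ 0 = 0 \<and> W' y $ 0 = 0"
    and sol: "\<And>h. \<bar>h\<bar> < r \<Longrightarrow> linear_sol q (\<lambda>y. eval_fps (?G0 y) h + eval_fps (?G1 y) h * eval_fps (W y) h
        + eval_fps (?G2 y) h * eval_fps (W y) h ^ 2 + eval_fps (?G3 y) h * eval_fps (W y) h ^ 3)
      (\<lambda>y. eval_fps (W y) h) (\<lambda>y. eval_fps (W' y) h)"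
    by (rule analytic_solution[OF q C fam]) (auto simp: fps_quadratic_nth_0)
  \<comment> \<open>An exact formula for the shooting function near \<open>z0\<close>; its
    derivative is read off because the series \<open>W' 1\<close> has constant coefficient
    \<open>0\<close>.\<close>
  have shoot: "shoot \<zeta> c0 L0 (z0 + h) = D01 v0 1 + h * (\<phi>' 1 + eval_fps (W' 1) h)" if h: "\<bar>h\<bar> < r" for h
  proof -
    let ?w = "\<lambda>y. eval_fps (W y) h" and ?w' = "\<lambda>y. eval_fps (W' y) h"
    let ?v = "\<lambda>y. v0 y + h * (\<phi> y + ?w y)" and ?v' = "\<lambda>y. D01 v0 y + h * (\<phi>' y + ?w' y)"
    have 1: "(?v has_real_derivative ?v' y) (at y within {0..1})" if "y \<in> {0..1}" for y
      by (intro DERIV_add DERIV_cmult C1_01_has_derivative[OF C10])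
        (use \<phi>(1) sol[OF h] that in \<open>auto simp: linear_sol_def\<close>)
    have 2: "continuous_on {0..1} ?v'"
      by (intro continuous_intros cont C1_01_continuous(2)[OF C10] linear_sol_continuous(2)[OF sol[OF h]])
    have 3: "(?v' has_real_derivative L0\<^sup>2 * ((?v y) ^ 3 - ?v y + \<zeta> (L0 * y))) (at y)" if y: "0 < y" "y < 1" for y
    proof -
      have at: "at y within {0..1} = at y" using at_within_Icc_at y by blast
      have "(\<phi>' has_real_derivative q y * \<phi> y + 0) (at y)"
        using \<phi>(1) y unfolding linear_sol_def q_def by (metis at atLeastAtMost_iff less_imp_le)
      moreover have "(?w' has_real_derivative q y * ?w y + (eval_fps (?G0 y) h + eval_fps (?G1 y) h * ?w y
          + eval_fps (?G2 y) h * ?w y ^ 2 + eval_fps (?G3 y) h * ?w y ^ 3)) (at y)"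
        using sol[OF h] y unfolding linear_sol_def by (metis at atLeastAtMost_iff less_imp_le)
      ultimately have "(?v' has_real_derivative L0\<^sup>2 * ((v0 y) ^ 3 - v0 y + \<zeta> (L0 * y)) +
          h * ((q y * \<phi> y + 0) + (q y * ?w y + (eval_fps (?G0 y) h + eval_fps (?G1 y) h * ?w y
          + eval_fps (?G2 y) h * ?w y ^ 2 + eval_fps (?G3 y) h * ?w y ^ 3)))) (at y)"
        by (intro DERIV_add DERIV_cmult solves_odeD(2)[OF ode0] y)
      then show ?thesis
        by (rule DERIV_cong)
          (simp add: eval_fps_quadratic q_def algebra_simps power2_eq_square power3_eq_cube)
    qed
    have "?v 0 = c0" using v0 W \<phi> by (simp add: solves_ivp_def)
    moreover have "?v' 0 = z0 + h" using v0 W \<phi> by (simp add: solves_ivp_def)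
    ultimately have "solves_ivp \<zeta> c0 L0 (z0 + h) ?v"
      unfolding solves_ivp_def using solves_odeI[OF 1 2 3] by auto
    then have "shoot \<zeta> c0 L0 (z0 + h) = D01 ?v 1" by (rule shoot_eq)
    then show ?thesis using solves_odeI(2)[OF 1 2 3, of 1] by simp
  qed
  obtain M R where "geom_bounded M R (W' 1)" using W(2) unfolding analytic_family_def by fastforce
  then have "isCont (eval_fps (W' 1)) 0"
    by (intro continuous_eval_fps geom_bounded_in_conv_radius) auto
  then have "((\<lambda>h. \<phi>' 1 + eval_fps (W' 1) h) \<longlongrightarrow> \<phi>' 1 + eval_fps (W' 1) 0) (at 0)"
    by (intro tendsto_intros) (simp add: isCont_def)
  then have lim: "((\<lambda>h. \<phi>' 1 + eval_fps (W' 1) h) \<longlongrightarrow> \<phi>' 1) (at 0)"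
    using W(5)[of 1] by (simp add: eval_fps_at_0)
  have "eventually (\<lambda>h. \<bar>h\<bar> < r \<and> h \<noteq> 0) (at 0)"
    using r by (auto simp: eventually_at intro!: exI[of _ r])
  then have "eventually (\<lambda>h. \<phi>' 1 + eval_fps (W' 1) h = (shoot \<zeta> c0 L0 (z0 + h) - shoot \<zeta> c0 L0 z0) / h) (at 0)"
  proof eventually_elim
    case (elim h)
    then show ?case using shoot[of h] shoot[of 0] r by simp
  qed
  with lim show ?thesis unfolding DERIV_def by (rule Lim_transform_eventually)
qed

theorem steady_state_branch:
  assumes \<zeta>: "real_analytic_on \<zeta> {0..}" and L0: "0 < L0" and v0: "solves_ivp \<zeta> c0 L0 z0 v0" "D01 v0 1 = 0"
    and \<phi>: "linear_sol (\<lambda>y. L0\<^sup>2 * (3 * (v0 y)\<^sup>2 - 1)) (\<lambda>_. 0) \<phi> \<phi>'" "\<phi> 0 = 0" "\<phi>' 1 \<noteq> 0"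
  obtains W W' r where "0 < r" "r \<le> L0" "analytic_family W" "analytic_family W'"
    "\<And>n y. y \<in> {0..1} \<Longrightarrow> ((\<lambda>y. W y $ n) has_real_derivative W' y $ n) (at y within {0..1})"
    "\<And>y. y \<in> {0..1} \<Longrightarrow> W y $ 0 = 0 \<and> W' y $ 0 = 0"
    "\<And>h. \<bar>h\<bar> < r \<Longrightarrow> solves_ivp \<zeta> c0 (L0 + h) (z0 + eval_fps (W' 0) h) (\<lambda>y. v0 y + eval_fps (W y) h)"
    "\<And>h y. \<bar>h\<bar> < r \<Longrightarrow> y \<in> {0..1} \<Longrightarrow> D01 (\<lambda>y. v0 y + eval_fps (W y) h) y = D01 v0 y + eval_fps (W' y) h"
    "W' 1 = 0"
proof -
  have ode0: "solves_ode \<zeta> L0 v0" and C10: "v0 \<in> C1_01" using v0 by (auto simp: solves_ivp_def solves_ode_def)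
  note cont = C1_01_continuous(1)[OF C10]
  define q where "q = (\<lambda>y. L0\<^sup>2 * (3 * (v0 y)\<^sup>2 - 1))"
  have q: "continuous_on {0..1} q" unfolding q_def by (intro continuous_intros cont)
  obtain C where C: "linear_solver q 1 C"
    by (rule linear_solver_bvp[OF q \<phi>(1)[folded q_def] \<phi>(2,3)])
  \<comment> \<open>The centres \<open>L0 * y\<close> fill \<open>[0, L0]\<close>; arguments beyond
    \<open>L0\<close> are reached by the expansions themselves.\<close>
  have "real_analytic_on \<zeta> {0..L0}" by (rule real_analytic_on_subset[OF \<zeta>]) auto
  then obtain c M R where c: "\<And>x. x \<in> {0..L0} \<Longrightarrow> geom_bounded M R (c x)"
    "\<And>x h. x \<in> {0..L0} \<Longrightarrow> R * \<bar>h\<bar> < 1 \<Longrightarrow> (\<lambda>n. c x $ n * h ^ n) sums \<zeta> (x + h)"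
    "\<And>n. continuous_on {0..L0} (\<lambda>x. c x $ n)"
    by (rule real_analytic_uniform_expansion[OF _ compact_Icc]) (rule that)
  have R: "0 < R" "0 \<le> M" using geom_boundedD[OF c(1)[of 0]] L0 by auto
  \<comment> \<open>The series of \<open>\<zeta>\<close> at \<open>L0 * y\<close> in the
    displacement \<open>y * h\<close>; as \<open>0 \<le> y \<le> 1\<close>, the factor
    \<open>y ^ n\<close> leaves the constants unchanged.\<close>
  define Z where "Z = (\<lambda>y. Abs_fps (\<lambda>n. c (L0 * y) $ n * y ^ n))"
  have L0y: "L0 * y \<in> {0..L0}" if "y \<in> {0..1}" for y using that L0 by (auto simp: mult_left_le)
  have Z_bd: "geom_bounded M R (Z y)" if y: "y \<in> {0..1}" for y
    unfolding geom_bounded_def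
  proof (intro conjI allI)
    fix n
    have "\<bar>Z y $ n\<bar> \<le> (M * R ^ n) * 1"
      unfolding Z_def fps_nth_Abs_fps abs_mult using y R
      by (intro mult_mono geom_boundedD(3)[OF c(1)[OF L0y[OF y]]]) (auto simp: power_le_one)
    then show "\<bar>Z y $ n\<bar> \<le> M * R ^ n" by simp
  qed (use R in auto)
  have Z_cont: "continuous_on {0..1} (\<lambda>y. Z y $ n)" for n
    unfolding Z_def fps_nth_Abs_fps
    by (intro continuous_intros continuous_on_compose2[OF c(3)]) (use L0y in auto)
  have Z: "analytic_family Z" unfolding analytic_family_def using Z_bd Z_cont by blast
  have Z_eval: "eval_fps (Z y) h = \<zeta> ((L0 + h) * y)" if y: "y \<in> {0..1}" and h: "R * \<bar>h\<bar> < 1" for y h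
  proof -
    have "R * \<bar>y * h\<bar> \<le> R * \<bar>h\<bar>" using y R by (auto simp: abs_mult intro!: mult_left_mono mult_left_le_one_le)
    then have "(\<lambda>n. c (L0 * y) $ n * (y * h) ^ n) sums \<zeta> (L0 * y + y * h)" using c(2)[OF L0y[OF y]] h by auto
    then show ?thesis by (simp add: eval_fps_def Z_def sums_iff power_mult_distrib mult.assoc algebra_simps)
  qed
  \<comment> \<open>Expansion of \<open>(L0 + h)^2 * (v^3 - v + \<zeta>((L0 + h) y))\<close> in
    powers of \<open>w\<close>, minus the right-hand side for \<open>v0\<close> and the part
    \<open>q * w\<close>. The summand \<open>- L0^2 * \<zeta>(L0 y)\<close> cancels the constant
    coefficient of the product with \<open>Z y\<close>.\<close>
  let ?G0 = "\<lambda>y. fps_quadratic (- L0\<^sup>2 * \<zeta> (L0 * y)) (2 * L0 * (v0 y ^ 3 - v0 y)) (v0 y ^ 3 - v0 y)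
    + fps_quadratic (L0\<^sup>2) (2 * L0) 1 * Z y"
  let ?G1 = "\<lambda>y. fps_quadratic 0 (2 * L0 * (3 * (v0 y)\<^sup>2 - 1)) (3 * (v0 y)\<^sup>2 - 1)"
  let ?G2 = "\<lambda>y. fps_quadratic (3 * L0\<^sup>2 * v0 y) (6 * L0 * v0 y) (3 * v0 y)"
  let ?G3 = "\<lambda>y. fps_quadratic (L0\<^sup>2) (2 * L0) 1"
  have \<zeta>_cont: "continuous_on {0..1} (\<lambda>y. \<zeta> (L0 * y))"
    using L0 by (intro continuous_on_compose2[OF continuous_at_imp_continuous_on[of "{0..}" \<zeta>]] continuous_intros)
      (auto intro: real_analytic_on_isCont[OF \<zeta>])
  have fam: "analytic_family ?G0" "analytic_family ?G1" "analytic_family ?G2" "analytic_family ?G3"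
    by (intro analytic_family_intros Z analytic_family_quadratic continuous_intros cont \<zeta>_cont)+
  have zero: "?G0 y $ 0 = 0" if "y \<in> {0..1}" for y
    using Z_eval[OF that, of 0] by (simp add: fps_quadratic_nth_0 eval_fps_at_0)
  obtain W W' r where r: "0 < r" and W: "analytic_family W" "analytic_family W'"
      "\<And>n y. y \<in> {0..1} \<Longrightarrow> ((\<lambda>y. W y $ n) has_real_derivative W' y $ n) (at y within {0..1})" "W 0 = 0" "W' 1 = 0"
      "\<And>y. y \<in> {0..1} \<Longrightarrow> W y $ 0 = 0 \<and> W' y $ 0 = 0"
    and sol: "\<And>h. \<bar>h\<bar> < r \<Longrightarrow> linear_sol q (\<lambda>y. eval_fps (?G0 y) h + eval_fps (?G1 y) h * eval_fps (W y) h
        + eval_fps (?G2 y) h * eval_fps (W y) h ^ 2 + eval_fps (?G3 y) h * eval_fps (W y) h ^ 3)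
      (\<lambda>y. eval_fps (W y) h) (\<lambda>y. eval_fps (W' y) h)"
    by (rule analytic_solution[OF q C fam zero]) (auto simp: fps_quadratic_nth_0)
  define \<rho> where "\<rho> = min r (min L0 (1 / R))"
  have main: "solves_ivp \<zeta> c0 (L0 + h) (z0 + eval_fps (W' 0) h) (\<lambda>y. v0 y + eval_fps (W y) h) \<and>
      (\<forall>y\<in>{0..1}. D01 (\<lambda>y. v0 y + eval_fps (W y) h) y = D01 v0 y + eval_fps (W' y) h)" if "\<bar>h\<bar> < \<rho>" for h
  proof -
    have h: "\<bar>h\<bar> < r" "R * \<bar>h\<bar> < 1" using that R by (auto simp: \<rho>_def field_simps)
    let ?w = "\<lambda>y. eval_fps (W y) h" and ?w' = "\<lambda>y. eval_fps (W' y) h"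
    let ?v = "\<lambda>y. v0 y + ?w y" and ?v' = "\<lambda>y. D01 v0 y + ?w' y"
    have 1: "(?v has_real_derivative ?v' y) (at y within {0..1})" if "y \<in> {0..1}" for y
      by (intro DERIV_add C1_01_has_derivative[OF C10])
        (use sol[OF h(1)] that in \<open>auto simp: linear_sol_def\<close>)
    have 2: "continuous_on {0..1} ?v'"
      by (intro continuous_intros C1_01_continuous(2)[OF C10] linear_sol_continuous(2)[OF sol[OF h(1)]])
    have 3: "(?v' has_real_derivative (L0 + h)\<^sup>2 * ((?v y) ^ 3 - ?v y + \<zeta> ((L0 + h) * y))) (at y)" if y: "0 < y" "y < 1" for y
    proof -
      have y01: "y \<in> {0..1}" using y by auto
      have at: "at y within {0..1} = at y" using at_within_Icc_at y by blast
      have "ereal (norm h) < fps_conv_radius (fps_quadratic (L0\<^sup>2) (2 * L0) 1 * Z y)"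
        using fps_conv_radius_mult[of "fps_quadratic (L0\<^sup>2) (2 * L0) 1" "Z y"]
          geom_bounded_in_conv_radius[OF Z_bd[OF y01] h(2)] less_le_trans
        by (fastforce simp: fps_conv_radius_quadratic)
      then have G0: "eval_fps (?G0 y) h = - L0\<^sup>2 * \<zeta> (L0 * y) + 2 * L0 * (v0 y ^ 3 - v0 y) * h + (v0 y ^ 3 - v0 y) * h\<^sup>2
          + (L0\<^sup>2 + 2 * L0 * h + h\<^sup>2) * \<zeta> ((L0 + h) * y)"
        by (subst eval_fps_add)
          (auto simp: eval_fps_mult geom_bounded_in_conv_radius[OF Z_bd[OF y01] h(2), simplified]
            fps_conv_radius_quadratic eval_fps_quadratic Z_eval[OF y01 h(2)])
      have "(?w' has_real_derivative q y * ?w y + (eval_fps (?G0 y) h + eval_fps (?G1 y) h * ?w y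
          + eval_fps (?G2 y) h * ?w y ^ 2 + eval_fps (?G3 y) h * ?w y ^ 3)) (at y)"
        using sol[OF h(1)] y unfolding linear_sol_def by (metis at atLeastAtMost_iff less_imp_le)
      then have "(?v' has_real_derivative L0\<^sup>2 * ((v0 y) ^ 3 - v0 y + \<zeta> (L0 * y)) +
          (q y * ?w y + (eval_fps (?G0 y) h + eval_fps (?G1 y) h * ?w y
          + eval_fps (?G2 y) h * ?w y ^ 2 + eval_fps (?G3 y) h * ?w y ^ 3))) (at y)"
        by (intro DERIV_add solves_odeD(2)[OF ode0] y)
      then show ?thesis
        by (rule DERIV_cong)
          (unfold G0, simp add: eval_fps_quadratic q_def, simp add: algebra_simps power2_eq_square power3_eq_cube)
    qed
    have "?v 0 = c0" using v0 W by (simp add: solves_ivp_def)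
    moreover have "?v' 0 = z0 + eval_fps (W' 0) h" using v0 by (simp add: solves_ivp_def)
    ultimately show ?thesis
      unfolding solves_ivp_def using solves_odeI[OF 1 2 3] by auto
  qed
  show ?thesis
    by (rule that[of \<rho> W W']) (use main W r L0 R in \<open>auto simp: \<rho>_def\<close>)
qed

section \<open>Analytic branches of steady states\<close>

text \<open>The tail is a power series with constant \<open>M * (R * |h|) ^ N\<close> in place of
  \<open>M\<close>, so the geometric estimate for a full sum applies to it.\<close>

lemma geom_bounded_tail_le:
  assumes F: "geom_bounded M R F" and h: "R * \<bar>h\<bar> \<le> 1 / 2" and s: "(\<lambda>n. F $ n * h ^ n) sums s"
  shows "\<bar>s - (\<Sum>n<N. F $ n * h ^ n)\<bar> \<le> 2 * M * (1 / 2) ^ N"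
proof -
  have R: "0 < R" "0 \<le> M" using geom_boundedD[OF F] by auto
  define G where "G = Abs_fps (\<lambda>n. F $ (n + N) * h ^ N)"
  have G: "geom_bounded (M * (R * \<bar>h\<bar>) ^ N) R G"
    unfolding geom_bounded_def
  proof (intro conjI allI)
    fix n
    have "\<bar>G $ n\<bar> \<le> (M * R ^ (n + N)) * \<bar>h\<bar> ^ N"
      unfolding G_def fps_nth_Abs_fps abs_mult power_abs by (intro mult_right_mono geom_boundedD(3)[OF F]) auto
    then show "\<bar>G $ n\<bar> \<le> M * (R * \<bar>h\<bar>) ^ N * R ^ n" by (simp add: power_add power_mult_distrib mult_ac)
  qed (use R in auto)
  have "(\<lambda>n. F $ (n + N) * h ^ (n + N)) sums (s - (\<Sum>n<N. F $ n * h ^ n))"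
    using s by (subst sums_iff_shift) simp
  then have "eval_fps G h = s - (\<Sum>n<N. F $ n * h ^ n)"
    by (simp add: eval_fps_def G_def sums_iff power_add mult_ac)
  then have "\<bar>s - (\<Sum>n<N. F $ n * h ^ n)\<bar> \<le> 2 * (M * (R * \<bar>h\<bar>) ^ N)"
    using geom_bounded_eval_le[OF G h] by simp
  also have "\<dots> \<le> 2 * (M * (1 / 2) ^ N)" using R h by (intro mult_left_mono power_mono) auto
  finally show ?thesis by simp
qed

lemma eval_fps_real_analytic:
  assumes F: "geom_bounded M R F" and \<epsilon>: "R * \<epsilon> \<le> 1 / 4"
  shows "real_analytic_on (\<lambda>x. c + eval_fps F (x - x0)) {x0 - \<epsilon><..<x0 + \<epsilon>}"
proof (rule real_analytic_onI)
  have R: "0 < R" using geom_boundedD[OF F] by auto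
  fix x assume x: "x \<in> {x0 - \<epsilon><..<x0 + \<epsilon>}"
  have "R * \<bar>x - x0\<bar> \<le> R * \<epsilon>" using x R by (intro mult_left_mono) auto
  then have k: "R * \<bar>x - x0\<bar> \<le> 1 / 4" using \<epsilon> by simp
  show "\<exists>r>0. \<exists>G. \<forall>h. \<bar>h\<bar> < r \<longrightarrow> (\<lambda>n. G $ n * h ^ n) sums (c + eval_fps F (x + h - x0))"
  proof (intro exI[of _ "1 / (2 * R)"] conjI exI[of _ "fps_const c + recenter F (x - x0)"] allI impI)
    fix h assume "\<bar>h\<bar> < 1 / (2 * R)"
    then have h: "2 * R * \<bar>h\<bar> < 1" using R by (simp add: field_simps)
    have "(\<lambda>n. fps_const c $ n * h ^ n) sums eval_fps (fps_const c) h" by (rule sums_eval_fps) simp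
    from sums_add[OF this sums_recenter[OF F k h]]
    show "(\<lambda>n. (fps_const c + recenter F (x - x0)) $ n * h ^ n) sums (c + eval_fps F (x + h - x0))"
      by (simp add: algebra_simps)
  qed (use R in simp)
qed

section \<open>Convergence in the C^1 norm\<close>

lemma C1_norm_bounds:
  assumes u: "u \<in> C1_01"
  shows "y \<in> {0..1} \<Longrightarrow> \<bar>u y\<bar> \<le> C1_norm u" "y \<in> {0..1} \<Longrightarrow> \<bar>D01 u y\<bar> \<le> C1_norm u" "0 \<le> C1_norm u"
    "(\<And>y. y \<in> {0..1} \<Longrightarrow> \<bar>u y\<bar> \<le> A) \<Longrightarrow> (\<And>y. y \<in> {0..1} \<Longrightarrow> \<bar>D01 u y\<bar> \<le> B) \<Longrightarrow> C1_norm u \<le> A + B"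
proof -
  have le: "\<bar>g y\<bar> \<le> (SUP y\<in>{0..1}. \<bar>g y\<bar>)" if g: "continuous_on {0..1} g" and y: "y \<in> {0..1}" for g :: "real \<Rightarrow> real" and y
  proof -
    obtain B where "\<And>y. y \<in> {0..1} \<Longrightarrow> \<bar>g y\<bar> \<le> B" using continuous_on_01_bounded[OF g] by metis
    then have "bdd_above ((\<lambda>y. \<bar>g y\<bar>) ` {0..1})" by (rule bdd_aboveI2)
    then show ?thesis using y by (rule cSUP_upper[rotated])
  qed
  note cont = C1_01_continuous[OF u]
  have nn: "0 \<le> (SUP y\<in>{0..1}. \<bar>u y\<bar>)" "0 \<le> (SUP y\<in>{0..1}. \<bar>D01 u y\<bar>)"
    using le[OF cont(1), of 0] le[OF cont(2), of 0] by auto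
  show "y \<in> {0..1} \<Longrightarrow> \<bar>u y\<bar> \<le> C1_norm u" using le[OF cont(1), of y] nn unfolding C1_norm_def by linarith
  show "y \<in> {0..1} \<Longrightarrow> \<bar>D01 u y\<bar> \<le> C1_norm u" using le[OF cont(2), of y] nn unfolding C1_norm_def by linarith
  show "0 \<le> C1_norm u" using nn unfolding C1_norm_def by linarith
  show "(\<And>y. y \<in> {0..1} \<Longrightarrow> \<bar>u y\<bar> \<le> A) \<Longrightarrow> (\<And>y. y \<in> {0..1} \<Longrightarrow> \<bar>D01 u y\<bar> \<le> B) \<Longrightarrow> C1_norm u \<le> A + B"
    unfolding C1_norm_def by (intro add_mono cSUP_least) auto
qed

lemma C1_01_diff_sum:
  assumes u: "u \<in> C1_01" and a: "\<And>n. a n \<in> C1_01"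
  shows "(\<lambda>y. u y - (\<Sum>n<N. h ^ n * a n y)) \<in> C1_01"
    "\<And>y. y \<in> {0..1} \<Longrightarrow> D01 (\<lambda>y. u y - (\<Sum>n<N. h ^ n * a n y)) y = D01 u y - (\<Sum>n<N. h ^ n * D01 (a n) y)"
proof -
  have d: "((\<lambda>y. u y - (\<Sum>n<N. h ^ n * a n y)) has_real_derivative D01 u y - (\<Sum>n<N. h ^ n * D01 (a n) y)) (at y within {0..1})"
    if "y \<in> {0..1}" for y
    by (intro DERIV_diff DERIV_sum DERIV_cmult C1_01_has_derivative u a that)
  show "(\<lambda>y. u y - (\<Sum>n<N. h ^ n * a n y)) \<in> C1_01"
    by (rule C1_01I, erule d) (intro continuous_on_diff continuous_on_sum continuous_on_mult_left C1_01_continuous(2) u a)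
  show "\<And>y. y \<in> {0..1} \<Longrightarrow> D01 (\<lambda>y. u y - (\<Sum>n<N. h ^ n * a n y)) y = D01 u y - (\<Sum>n<N. h ^ n * D01 (a n) y)"
    by (rule D01_eq[OF d])
qed

text \<open>Evaluation of the derivative at \<open>0\<close> is a bounded linear functional on C^1,
  so it maps a C^1-convergent expansion to a scalar one. This turns a competing branch into a
  competing slope curve.\<close>

lemma real_analytic_C1_on_initial_slope:
  assumes "real_analytic_C1_on \<Phi> S"
  shows "real_analytic_on (\<lambda>x. D01 (\<Phi> x) 0) S"
proof (rule real_analytic_onI)
  fix x assume "x \<in> S"
  then obtain r a where r: "0 < r" and a: "\<forall>n. a n \<in> C1_01"
    and \<Phi>: "\<forall>h. \<bar>h\<bar> < r \<longrightarrow> \<Phi> (x + h) \<in> C1_01 \<and>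
      (\<lambda>N. C1_norm (\<lambda>y. \<Phi> (x + h) y - (\<Sum>n<N. h ^ n * a n y))) \<longlonglongrightarrow> 0"
    using assms unfolding real_analytic_C1_on_def by blast
  have "(\<lambda>n. D01 (a n) 0 * h ^ n) sums D01 (\<Phi> (x + h)) 0" if h: "\<bar>h\<bar> < r" for h
  proof -
    note C1 = C1_01_diff_sum[OF conjunct1[OF \<Phi>[rule_format, OF h]] a[rule_format]]
    have "(\<lambda>N. D01 (\<Phi> (x + h)) 0 - (\<Sum>n<N. h ^ n * D01 (a n) 0)) \<longlonglongrightarrow> 0"
    proof (rule Lim_null_comparison[OF always_eventually conjunct2[OF \<Phi>[rule_format, OF h]]], intro allI)
      fix N
      show "norm (D01 (\<Phi> (x + h)) 0 - (\<Sum>n<N. h ^ n * D01 (a n) 0))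
          \<le> C1_norm (\<lambda>y. \<Phi> (x + h) y - (\<Sum>n<N. h ^ n * a n y))"
        using C1_norm_bounds(2)[OF C1(1), of 0] C1(2)[of 0] by simp
    qed
    then have "(\<lambda>N. D01 (\<Phi> (x + h)) 0 - (D01 (\<Phi> (x + h)) 0 - (\<Sum>n<N. h ^ n * D01 (a n) 0))) \<longlonglongrightarrow> D01 (\<Phi> (x + h)) 0 - 0"
      by (intro tendsto_diff tendsto_const)
    then show ?thesis by (simp add: sums_def mult.commute)
  qed
  then show "\<exists>r>0. \<exists>F. \<forall>h. \<bar>h\<bar> < r \<longrightarrow> (\<lambda>n. F $ n * h ^ n) sums D01 (\<Phi> (x + h)) 0"
    using r by (intro exI[of _ r] conjI exI[of _ "Abs_fps (\<lambda>n. D01 (a n) 0)"]) auto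
qed

text \<open>The expansion at \<open>x0 + k\<close> is obtained by re-expanding each
  \<open>W y\<close> at \<open>k\<close>; its coefficients are C^1 in \<open>y\<close> because
  re-expansion commutes with the derivative in \<open>y\<close>. Tail bounds uniform in
  \<open>y\<close> for \<open>W\<close> and for \<open>W'\<close> add up to a bound in the C^1
  norm.\<close>

lemma real_analytic_C1_onI:
  assumes W: "\<And>y. y \<in> {0..1} \<Longrightarrow> geom_bounded M R (W y)" "\<And>y. y \<in> {0..1} \<Longrightarrow> geom_bounded M R (W' y)"
    and d: "\<And>n y. y \<in> {0..1} \<Longrightarrow> ((\<lambda>y. W y $ n) has_real_derivative W' y $ n) (at y within {0..1})"
    and cont: "\<And>n. continuous_on {0..1} (\<lambda>y. W' y $ n)"
    and v0: "v0 \<in> C1_01" and \<epsilon>: "0 < \<epsilon>" "R * \<epsilon> \<le> 1 / 4"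
    and \<Phi>: "\<And>h y. \<bar>h\<bar> < \<epsilon> \<Longrightarrow> y \<in> {0..1} \<Longrightarrow> \<Phi> (x0 + h) y = v0 y + eval_fps (W y) h"
  shows "real_analytic_C1_on \<Phi> {x0 - \<epsilon><..<x0 + \<epsilon>}"
  unfolding real_analytic_C1_on_def
proof
  fix x assume x: "x \<in> {x0 - \<epsilon><..<x0 + \<epsilon>}"
  define k where "k = x - x0"
  have R: "0 < R" "0 \<le> M" using geom_boundedD[OF W(1)[of 0]] by auto
  have "R * \<bar>k\<bar> \<le> R * \<epsilon>" using x R by (intro mult_left_mono) (auto simp: k_def)
  then have k: "R * \<bar>k\<bar> \<le> 1 / 4" "\<bar>k\<bar> < \<epsilon>" using \<epsilon> x by (auto simp: k_def)
  define a where "a = (\<lambda>n y. recenter (W y) k $ n + (if n = 0 then v0 y else 0))"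
  define a' where "a' = (\<lambda>n y. recenter (W' y) k $ n + (if n = 0 then D01 v0 y else 0))"
  have rd: "((\<lambda>y. recenter (W y) k $ n) has_real_derivative recenter (W' y) k $ n) (at y within {0..1})" if "y \<in> {0..1}" for n y
    by (rule recenter_has_derivative[OF W d k(1) that])
  have a_der: "(a n has_real_derivative a' n y) (at y within {0..1})" if "y \<in> {0..1}" for n y
    using DERIV_add[OF rd[OF that, of 0] C1_01_has_derivative[OF v0 that]] rd[OF that, of n]
    by (cases "n = 0") (auto simp: a_def a'_def)
  have a': "a n \<in> C1_01" "\<And>y. y \<in> {0..1} \<Longrightarrow> D01 (a n) y = a' n y" for n
  proof -
    have "continuous_on {0..1} (a' n)"
      unfolding a'_def using recenter_family_continuous[OF W(2) cont k(1)] C1_01_continuous(2)[OF v0]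
      by (cases "n = 0") (auto intro!: continuous_on_add)
    then show "a n \<in> C1_01" by (rule C1_01I[rotated]) (erule a_der)
    show "\<And>y. y \<in> {0..1} \<Longrightarrow> D01 (a n) y = a' n y" by (rule D01_eq[OF a_der])
  qed
  \<comment> \<open>The first bound keeps \<open>k + h\<close> where \<open>\<Phi>\<close> is given
    by the series; the second gives \<open>2 * R * |h| \<le> 1 / 2\<close>, as the tail estimate for
    the re-expanded series demands.\<close>
  define r where "r = min (\<epsilon> - \<bar>k\<bar>) (1 / (4 * R))"
  have r: "0 < r" using k R by (simp add: r_def)
  show "\<exists>r>0. \<exists>a. (\<forall>n. a n \<in> C1_01) \<and> (\<forall>h. \<bar>h\<bar> < r \<longrightarrow> \<Phi> (x + h) \<in> C1_01 \<and>
           (\<lambda>N. C1_norm (\<lambda>y. \<Phi> (x + h) y - (\<Sum>n<N. h ^ n * a n y))) \<longlonglongrightarrow> 0)"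
  proof (rule exI[of _ r], intro conjI exI[of _ a] allI impI r a')
    fix h assume h: "\<bar>h\<bar> < r"
    have h1: "\<bar>k + h\<bar> < \<epsilon>" "2 * R * \<bar>h\<bar> \<le> 1 / 2" using h R by (auto simp: r_def field_simps)
    have h2: "R * \<bar>k + h\<bar> < 1"
      using mult_strict_left_mono[OF h1(1) R(1)] \<epsilon> by linarith
    have \<Phi>': "\<Phi> (x + h) y = v0 y + eval_fps (W y) (k + h)" if "y \<in> {0..1}" for y
      using \<Phi>[OF h1(1) that] by (simp add: k_def algebra_simps)
    have der: "(\<Phi> (x + h) has_real_derivative D01 v0 y + eval_fps (W' y) (k + h)) (at y within {0..1})" if y: "y \<in> {0..1}" for y
    proof -
      have "((\<lambda>y. v0 y + eval_fps (W y) (k + h)) has_real_derivative D01 v0 y + eval_fps (W' y) (k + h)) (at y within {0..1})"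
        by (intro DERIV_add C1_01_has_derivative[OF v0 y] eval_family_has_derivative[OF W d h2 y])
      then show ?thesis
        by (rule has_field_derivative_transform_within[OF _ zero_less_one y]) (simp add: \<Phi>')
    qed
    show C1: "\<Phi> (x + h) \<in> C1_01"
      by (rule C1_01I, erule der)
        (intro continuous_on_add C1_01_continuous(2)[OF v0] eval_family_continuous[OF W(2) cont h2])
    \<comment> \<open>The function \<open>v0\<close> sits in coefficient \<open>0\<close>, so the
      partial sum contains it only for \<open>N > 0\<close>.\<close>
    have est: "\<bar>\<Phi> (x + h) y - (\<Sum>n<N. h ^ n * a n y)\<bar> \<le> 4 * M * (1 / 2) ^ N"
      "\<bar>D01 (\<Phi> (x + h)) y - (\<Sum>n<N. h ^ n * D01 (a n) y)\<bar> \<le> 4 * M * (1 / 2) ^ N" if y: "y \<in> {0..1}" and N: "N > 0" for N y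
    proof -
      have split: "(\<Sum>n<N. h ^ n * (c n + (if n = 0 then b else 0))) = b + (\<Sum>n<N. c n * h ^ n)" for c and b :: real
      proof -
        have "(\<Sum>n<N. h ^ n * (if n = 0 then b else 0)) = (\<Sum>n\<in>{0}. h ^ n * (if n = 0 then b else 0))"
          using N by (intro sum.mono_neutral_right) auto
        then show ?thesis by (simp add: distrib_left sum.distrib mult.commute)
      qed
      have h3: "2 * R * \<bar>h\<bar> < 1" using h1 by simp
      show "\<bar>\<Phi> (x + h) y - (\<Sum>n<N. h ^ n * a n y)\<bar> \<le> 4 * M * (1 / 2) ^ N"
        using geom_bounded_tail_le[OF recenter_coeff(3)[OF W(1)[OF y] k(1)] h1(2) sums_recenter[OF W(1)[OF y] k(1) h3], of N]
        by (simp add: \<Phi>'[OF y] a_def split)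
      show "\<bar>D01 (\<Phi> (x + h)) y - (\<Sum>n<N. h ^ n * D01 (a n) y)\<bar> \<le> 4 * M * (1 / 2) ^ N"
        using geom_bounded_tail_le[OF recenter_coeff(3)[OF W(2)[OF y] k(1)] h1(2) sums_recenter[OF W(2)[OF y] k(1) h3], of N]
        by (simp add: D01_eq[OF der[OF y] y] a'(2)[OF y] a'_def split)
    qed
    show "(\<lambda>N. C1_norm (\<lambda>y. \<Phi> (x + h) y - (\<Sum>n<N. h ^ n * a n y))) \<longlonglongrightarrow> 0"
    proof (rule tendsto_sandwich[OF always_eventually eventually_mono[OF eventually_gt_at_top[of 0]] tendsto_const])
      have "(\<lambda>N. 8 * M * (1 / 2 :: real) ^ N) \<longlonglongrightarrow> 8 * M * 0"
        by (intro tendsto_mult tendsto_const LIMSEQ_realpow_zero) auto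
      then show "(\<lambda>N. 8 * M * (1 / 2 :: real) ^ N) \<longlonglongrightarrow> 0" by simp
      show "\<forall>N. 0 \<le> C1_norm (\<lambda>y. \<Phi> (x + h) y - (\<Sum>n<N. h ^ n * a n y))"
        by (intro allI C1_norm_bounds(3) C1_01_diff_sum(1) C1 a'(1))
      fix N :: nat assume "0 < N"
      then have "C1_norm (\<lambda>y. \<Phi> (x + h) y - (\<Sum>n<N. h ^ n * a n y)) \<le> 4 * M * (1 / 2) ^ N + 4 * M * (1 / 2) ^ N"
        by (intro C1_norm_bounds(4) C1_01_diff_sum(1) C1 a'(1) est(1))
          (simp_all only: C1_01_diff_sum(2)[OF C1 a'(1)] est(2))
      then show "C1_norm (\<lambda>y. \<Phi> (x + h) y - (\<Sum>n<N. h ^ n * a n y)) \<le> 8 * M * (1 / 2) ^ N" by simp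
    qed
  qed
qed

theorem proposition2p8:
  fixes c0 L0 z0 :: real and \<zeta> :: "real \<Rightarrow> real" and J :: "real set"
  assumes "open J" and "is_interval J" and "{0..} \<subseteq> J"
    and "real_analytic_on \<zeta> J"
    and "\<forall>x\<in>J. -1 < \<zeta> x \<and> \<zeta> x < 0"
    and "L0 > 0"
    and "(L0, z0) \<in> ivp_domain \<zeta> c0"
    and "shoot \<zeta> c0 L0 z0 = 0"
    and nondegenerate: "deriv (\<lambda>z. shoot \<zeta> c0 L0 z) z0 \<noteq> 0"
  shows "\<exists>\<epsilon>>0. \<exists>z :: real \<Rightarrow> real.
      analytic_zero_curve \<zeta> c0 L0 z0 \<epsilon> z \<and>
      (\<forall>w. analytic_zero_curve \<zeta> c0 L0 z0 \<epsilon> w \<longrightarrow> (\<forall>L\<in>{L0 - \<epsilon><..<L0 + \<epsilon>}. w L = z L)) \<and>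
      analytic_branch \<zeta> c0 L0 \<epsilon> (\<lambda>L. ivp_sol \<zeta> c0 L (z L)) \<and>
      (\<forall>\<delta> \<Phi>. 0 < \<delta> \<and> \<delta> \<le> \<epsilon> \<and> analytic_branch \<zeta> c0 L0 \<delta> \<Phi> \<and>
           (\<forall>y\<in>{0..1}. \<Phi> L0 y = ivp_sol \<zeta> c0 L0 z0 y) \<longrightarrow>
         (\<forall>L\<in>{L0 - \<delta><..<L0 + \<delta>}. \<forall>y\<in>{0..1}. \<Phi> L y = ivp_sol \<zeta> c0 L (z L) y))"
proof -
  note L0 = \<open>L0 > 0\<close>
  have \<zeta>: "real_analytic_on \<zeta> {0..}" by (rule real_analytic_on_subset) fact+
  then have \<zeta>_cont: "continuous_on {0..} \<zeta>"
    by (intro continuous_at_imp_continuous_on ballI real_analytic_on_isCont)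
  define v0 where "v0 = ivp_sol \<zeta> c0 L0 z0"
  have v0: "solves_ivp \<zeta> c0 L0 z0 v0" unfolding v0_def by (rule ivp_domain_solves) fact
  then have C10: "v0 \<in> C1_01" by (simp add: solves_ivp_def solves_ode_def)
  have v0_1: "D01 v0 1 = 0" using shoot_eq[OF v0] \<open>shoot \<zeta> c0 L0 z0 = 0\<close> by simp
  have q: "continuous_on {0..1} (\<lambda>y. L0\<^sup>2 * (3 * (v0 y)\<^sup>2 - 1))"
    by (intro continuous_intros C1_01_continuous(1)[OF C10])
  obtain \<phi> \<phi>' where \<phi>: "linear_sol (\<lambda>y. L0\<^sup>2 * (3 * (v0 y)\<^sup>2 - 1)) (\<lambda>_. 0) \<phi> \<phi>'" "\<phi> 0 = 0" "\<phi>' 0 = 1"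
    by (rule fundamental_solution_exists[OF q])
  have \<phi>1: "\<phi>' 1 \<noteq> 0"
    using nondegenerate DERIV_imp_deriv[OF shoot_has_derivative[OF v0 \<phi>]] by simp
  obtain W W' r where r: "0 < r" "r \<le> L0" and W: "analytic_family W" "analytic_family W'"
      "\<And>n y. y \<in> {0..1} \<Longrightarrow> ((\<lambda>y. W y $ n) has_real_derivative W' y $ n) (at y within {0..1})"
      "\<And>y. y \<in> {0..1} \<Longrightarrow> W y $ 0 = 0 \<and> W' y $ 0 = 0"
    and sol: "\<And>h. \<bar>h\<bar> < r \<Longrightarrow> solves_ivp \<zeta> c0 (L0 + h) (z0 + eval_fps (W' 0) h) (\<lambda>y. v0 y + eval_fps (W y) h)"
      "\<And>h y. \<bar>h\<bar> < r \<Longrightarrow> y \<in> {0..1} \<Longrightarrow> D01 (\<lambda>y. v0 y + eval_fps (W y) h) y = D01 v0 y + eval_fps (W' y) h"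
    and W'1: "W' 1 = 0"
    by (rule steady_state_branch[OF \<zeta> L0 v0 v0_1 \<phi>(1,2) \<phi>1]) (rule that)
  obtain M R where bd: "\<And>y. y \<in> {0..1} \<Longrightarrow> geom_bounded M R (W y)" "\<And>y. y \<in> {0..1} \<Longrightarrow> geom_bounded M R (W' y)"
    by (rule analytic_family_common[OF W(1,2)]) (rule that)
  have "geom_bounded M R (W 0)" by (rule bd) simp
  then have R: "0 < R" by (rule geom_boundedD)
  obtain \<delta>0 where \<delta>0: "0 < \<delta>0"
    "\<And>L z1 z2 v u. \<bar>L - L0\<bar> < \<delta>0 \<Longrightarrow> \<bar>z1 - z0\<bar> < \<delta>0 \<Longrightarrow> \<bar>z2 - z0\<bar> < \<delta>0 \<Longrightarrow>
       solves_ivp \<zeta> c0 L z1 v \<Longrightarrow> solves_ivp \<zeta> c0 L z2 u \<Longrightarrow> D01 v 1 = 0 \<Longrightarrow> D01 u 1 = 0 \<Longrightarrow> z1 = z2"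
    by (rule steady_state_locally_unique[OF \<zeta>_cont L0 v0 \<phi> \<phi>1]) (rule that)
  \<comment> \<open>The bound \<open>1 / (4 * R)\<close> lets the series be re-expanded at every
    point of the interval.\<close>
  define \<epsilon> where "\<epsilon> = min r (1 / (4 * R))"
  have "R * \<epsilon> \<le> R * (1 / (4 * R))" using R by (intro mult_left_mono) (auto simp: \<epsilon>_def)
  then have \<epsilon>: "0 < \<epsilon>" "\<epsilon> \<le> r" "R * \<epsilon> \<le> 1 / 4" using r R by (auto simp: \<epsilon>_def)
  define z where "z = (\<lambda>L. z0 + eval_fps (W' 0) (L - L0))"
  have sol': "solves_ivp \<zeta> c0 L (z L) (\<lambda>y. v0 y + eval_fps (W y) (L - L0))"
      "D01 (\<lambda>y. v0 y + eval_fps (W y) (L - L0)) 1 = 0" if "\<bar>L - L0\<bar> < \<epsilon>" for L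
    using sol(1)[of "L - L0"] sol(2)[of "L - L0" 1] that \<epsilon> v0_1 W'1 by (auto simp: z_def)
  have dom: "L > 0" if "\<bar>L - L0\<bar> < \<epsilon>" for L using that \<epsilon> r by linarith
  have z_curve: "analytic_zero_curve \<zeta> c0 L0 z0 \<epsilon> z"
    unfolding analytic_zero_curve_def
  proof (intro conjI ballI)
    show "real_analytic_on z {L0 - \<epsilon><..<L0 + \<epsilon>}"
      unfolding z_def by (rule eval_fps_real_analytic[OF bd(2) \<epsilon>(3)]) simp
    fix L assume "L \<in> {L0 - \<epsilon><..<L0 + \<epsilon>}"
    then have L: "\<bar>L - L0\<bar> < \<epsilon>" by auto
    show "(L, z L) \<in> ivp_domain \<zeta> c0" using sol'(1)[OF L] dom[OF L] by (auto simp: ivp_domain_def)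
    show "shoot \<zeta> c0 L (z L) = 0" using shoot_eq[OF sol'(1)[OF L]] sol'(2)[OF L] by simp
  next
    show "z L0 = z0" using W(4)[of 0] by (simp add: z_def eval_fps_at_0)
  qed
  \<comment> \<open>Stated for every \<open>\<delta> \<le> \<epsilon>\<close>, as a competing branch
    may be given on a smaller interval.\<close>
  have uniq: "w L = z L" if \<delta>: "0 < \<delta>" "\<delta> \<le> \<epsilon>" and w: "analytic_zero_curve \<zeta> c0 L0 z0 \<delta> w" and L: "L \<in> {L0 - \<delta><..<L0 + \<delta>}" for \<delta> w L
  proof (rule real_analytic_identity[of w "{L0 - \<delta><..<L0 + \<delta>}" z L0 L])
    have "{L0 - \<delta><..<L0 + \<delta>} \<subseteq> {L0 - \<epsilon><..<L0 + \<epsilon>}" using \<delta> by auto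
    then have an: "real_analytic_on w {L0 - \<delta><..<L0 + \<delta>}" "real_analytic_on z {L0 - \<delta><..<L0 + \<delta>}"
      using w z_curve real_analytic_on_subset unfolding analytic_zero_curve_def by blast+
    then show "real_analytic_on w {L0 - \<delta><..<L0 + \<delta>}" "real_analytic_on z {L0 - \<delta><..<L0 + \<delta>}" by auto
    have init: "w L0 = z0" "z L0 = z0" using w z_curve by (auto simp: analytic_zero_curve_def)
    \<comment> \<open>Only near \<open>L0\<close> is \<open>w L\<close> known, by continuity, to lie
      within \<open>\<delta>0\<close> of \<open>z0\<close>, where local uniqueness applies.\<close>
    have "isCont w L0" "isCont z L0" using \<delta> by (auto intro: real_analytic_on_isCont[OF an(1)] real_analytic_on_isCont[OF an(2)])
    then have lim: "(w \<longlongrightarrow> z0) (nhds L0)" "(z \<longlongrightarrow> z0) (nhds L0)"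
      using init tendsto_at_iff_tendsto_nhds[of w L0] tendsto_at_iff_tendsto_nhds[of z L0] by (simp_all add: isCont_def)
    have "eventually (\<lambda>L. dist (w L) z0 < \<delta>0) (nhds L0)" "eventually (\<lambda>L. dist (z L) z0 < \<delta>0) (nhds L0)"
      by (intro tendstoD lim \<delta>0(1))+
    moreover have "eventually (\<lambda>L. \<bar>L - L0\<bar> < min \<delta> \<delta>0) (nhds L0)"
      using \<delta> \<delta>0 by (auto simp: eventually_nhds_metric dist_real_def intro!: exI[of _ "min \<delta> \<delta>0"])
    ultimately show "eventually (\<lambda>L. w L = z L) (nhds L0)"
    proof eventually_elim
      case (elim L)
      then have L: "\<bar>L - L0\<bar> < \<epsilon>" and "L \<in> {L0 - \<delta><..<L0 + \<delta>}" using \<delta> by auto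
      then have "(L, w L) \<in> ivp_domain \<zeta> c0" "shoot \<zeta> c0 L (w L) = 0" using w by (auto simp: analytic_zero_curve_def)
      then have "solves_ivp \<zeta> c0 L (w L) (ivp_sol \<zeta> c0 L (w L))" "D01 (ivp_sol \<zeta> c0 L (w L)) 1 = 0"
        by (auto intro: ivp_domain_solves simp: shoot_def)
      then show ?case using elim sol'[OF L] \<delta>0(2)[of L "w L" "z L"] by (auto simp: dist_real_def)
    qed
  qed (use \<delta> L in auto)
  have branch: "analytic_branch \<zeta> c0 L0 \<epsilon> (\<lambda>L. ivp_sol \<zeta> c0 L (z L))"
    unfolding analytic_branch_def
  proof (intro conjI ballI)
    show "real_analytic_C1_on (\<lambda>L. ivp_sol \<zeta> c0 L (z L)) {L0 - \<epsilon><..<L0 + \<epsilon>}"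
    proof (rule real_analytic_C1_onI[OF bd W(3) _ C10 \<epsilon>(1,3)])
      show "continuous_on {0..1} (\<lambda>y. W' y $ n)" for n using W(2) by (simp add: analytic_family_def)
      fix h y :: real assume h: "\<bar>h\<bar> < \<epsilon>" and y: "y \<in> {0..1}"
      show "ivp_sol \<zeta> c0 (L0 + h) (z (L0 + h)) y = v0 y + eval_fps (W y) h"
        using ivp_sol_eq(1)[OF sol'(1)[of "L0 + h"] y] h by simp
    qed
    fix L assume "L \<in> {L0 - \<epsilon><..<L0 + \<epsilon>}"
    then have L: "\<bar>L - L0\<bar> < \<epsilon>" by auto
    show "steady_state \<zeta> c0 L (ivp_sol \<zeta> c0 L (z L))"
      using ivp_sol_solves[OF sol'(1)[OF L]] ivp_sol_eq(2)[OF sol'(1)[OF L], of 1] sol'(2)[OF L]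
      by (simp add: steady_state_def solves_ivp_def)
  qed
  have branch_uniq: "\<Phi> L y = ivp_sol \<zeta> c0 L (z L) y"
    if \<delta>: "0 < \<delta>" "\<delta> \<le> \<epsilon>" and \<Phi>: "analytic_branch \<zeta> c0 L0 \<delta> \<Phi>" "\<forall>y\<in>{0..1}. \<Phi> L0 y = ivp_sol \<zeta> c0 L0 z0 y"
      and L: "L \<in> {L0 - \<delta><..<L0 + \<delta>}" and y: "y \<in> {0..1}" for \<delta> \<Phi> L y
  proof -
    define w where "w = (\<lambda>L. D01 (\<Phi> L) 0)"
    have \<Phi>_sol: "solves_ivp \<zeta> c0 L (w L) (\<Phi> L)" "D01 (\<Phi> L) 1 = 0" if "L \<in> {L0 - \<delta><..<L0 + \<delta>}" for L
      using \<Phi>(1) that by (auto simp: analytic_branch_def steady_state_def solves_ivp_def w_def)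
    \<comment> \<open>\<open>\<Phi> L0\<close> and \<open>v0\<close> are known to agree on
      \<open>[0,1]\<close> only; the derivative within that interval does not see the rest.\<close>
    have "(v0 has_real_derivative w L0) (at 0 within {0..1})"
    proof (rule has_field_derivative_transform_within[OF _ zero_less_one])
      show "(\<Phi> L0 has_real_derivative w L0) (at 0 within {0..1})"
        unfolding w_def by (rule C1_01_has_derivative) (use \<Phi>_sol(1)[of L0] \<delta> in \<open>auto simp: solves_ivp_def solves_ode_def\<close>)
    qed (use \<Phi>(2) in \<open>auto simp: v0_def\<close>)
    then have w0: "w L0 = z0" using D01_eq[of v0 "w L0" 0] v0 by (simp add: solves_ivp_def)
    have "analytic_zero_curve \<zeta> c0 L0 z0 \<delta> w"
      unfolding analytic_zero_curve_def
    proof (intro conjI ballI w0)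
      show "real_analytic_on w {L0 - \<delta><..<L0 + \<delta>}"
        unfolding w_def by (rule real_analytic_C1_on_initial_slope) (use \<Phi>(1) in \<open>simp add: analytic_branch_def\<close>)
      fix L assume L: "L \<in> {L0 - \<delta><..<L0 + \<delta>}"
      show "(L, w L) \<in> ivp_domain \<zeta> c0" using \<Phi>_sol(1)[OF L] dom[of L] L \<delta> by (auto simp: ivp_domain_def)
      show "shoot \<zeta> c0 L (w L) = 0" using shoot_eq[OF \<Phi>_sol(1)[OF L]] \<Phi>_sol(2)[OF L] by simp
    qed
    from uniq[OF \<delta> this L] show ?thesis using ivp_sol_eq(1)[OF \<Phi>_sol(1)[OF L] y] by simp
  qed
  show ?thesis
    by (rule exI[of _ \<epsilon>], intro conjI exI[of _ z] allI impI ballI \<epsilon>(1) z_curve branch)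
      (use uniq[OF \<epsilon>(1) order_refl] branch_uniq in auto)
qed

end
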